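(* Let $\mu_X,\mu_Y\in\mathbb{R}$, $\sigma_X,\sigma_Y>0$, $-1<\rho<1$ and let $n\geq1$ be an integer. Let $f$ be the probability density function of $S_n=\sum_{i=1}^n Z_i$, where $Z_1,\ldots,Z_n$ are independent copies of $Z=XY$ and $(X,Y)$ is bivariate normal with mean vector $(\mu_X,\mu_Y)$, variances $(\sigma_X^2,\sigma_Y^2)$ and correlation coefficient $\rho$. Let $r_X,r_Y,s,C_n$, $g_{i,j}(a,b)$, $M$, $(v)_j$ and $\sim$ be as defined in the context. 1. Suppose that $r_X+r_Y\neq0$. Then, as $x\rightarrow\infty$, $$f(x)\sim\frac{s^{-(n+1)/4}C_n}{2\sqrt{2\pi}}\bigg(\frac{1+\rho}{|r_X+r_Y|\sqrt{n}}\bigg)^{(n-1)/2}\exp\bigg(\frac{n}{8}\bigg(\frac{1+\rho}{1-\rho}\bigg)(r_X-r_Y)^2\bigg)\, x^{(n-3)/4}\exp\bigg(\frac{|r_X+r_Y|}{1+\rho}\sqrt{\frac{nx}{s}}-\frac{x}{s(1+\rho)}\bigg)\sum_{\ell=0}^\infty c_\ell(r_X,r_Y,\rho,n)\frac{s^{\ell/2}}{x^{\ell/2}},$$ where $c_0(r_X,r_Y,\rho,n)=1$ and, for $\ell\geq1$, $$c_\ell(r_X,r_Y,\rho,n)=\exp\bigg(-\frac{n}{8}\bigg(\frac{1+\rho}{1-\rho}\bigg)(r_X-r_Y)^2\bigg)\sum_{j=0}^\ell h_{j,\ell}(r_X,r_Y,\rho,n),$$ with, for $0\leq j\leq \ell$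 and $\ell\geq1$, $$h_{j,\ell}(r_X,r_Y,\rho,n)=\frac{((3-n)/2)_{\ell-j}((n-1)/2)_{\ell-j}}{(\ell-j)!\,2^{\ell-j}n^{(\ell-j)/2}}\bigg(\frac{1+\rho}{|r_X+r_Y|}\bigg)^{\ell-j}\sum_{i=\lceil j/2\rceil}^j\bigg(\frac{n}{2}\bigg)_i\bigg(\frac{1-\rho^2}{2}\bigg)^i M\bigg(\frac{n}{2}+i,\frac{n}{2},\frac{n}{8}\bigg(\frac{1+\rho}{1-\rho}\bigg)(r_X-r_Y)^2\bigg)\, g_{i,j}\bigg(\frac{n-3}{4}-\frac{\ell-j}{2},\frac{|r_X+r_Y|}{1+\rho}\sqrt{n}\bigg).$$ 2. Suppose that $r_X+r_Y=0$. Then, as $x\rightarrow\infty$, $$f(x)\sim \frac{x^{n/2-1}}{(2s)^{n/2}\Gamma(n/2)}\exp\bigg(-\frac{nr_X^2}{2}-\frac{x}{s(1+\rho)}\bigg)\sum_{k=0}^\infty d_k(r_X,\rho,n)\frac{s^k}{x^k},$$ where $d_0(r_X,\rho,n)=1$ and, for $k\geq1$, $$d_k(r_X,\rho,n)=(-1)^k\frac{(1-n/2)_k(n/2)_k}{k!}\bigg(\frac{1-\rho^2}{2}\bigg)^k\exp\bigg(-\frac{n}{2}\bigg(\frac{1+\rho}{1-\rho}\bigg)r_X^2\bigg) M\bigg(\frac{n}{2}+k,\frac{n}{2},\frac{n}{2}\bigg(\frac{1+\rho}{1-\rho}\bigg)r_X^2\bigg)$$ $$=(-1)^k\frac{(1-n/2)_k(n/2)_k}{k!}\bigg(\frac{1-\rho^2}{2}\bigg)^k\sum_{j=0}^k\frac{(n/2)^j}{(n/2)_j}\binom{k}{j}\bigg(\frac{1+\rho}{1-\rho}\bigg)^jr_X^{2j}.$$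 3. Suppose that $r_X-r_Y\neq0$. Then, as $x\rightarrow-\infty$, $$f(x)\sim\frac{s^{-(n+1)/4}C_n}{2\sqrt{2\pi}}\bigg(\frac{1-\rho}{|r_X-r_Y|\sqrt{n}}\bigg)^{(n-1)/2}\exp\bigg(\frac{n}{8}\bigg(\frac{1-\rho}{1+\rho}\bigg)(r_X+r_Y)^2\bigg)\,|x|^{(n-3)/4}\exp\bigg(\frac{|r_X-r_Y|}{1-\rho}\sqrt{\frac{n|x|}{s}}+\frac{x}{s(1-\rho)}\bigg)\sum_{\ell=0}^\infty c_\ell(r_X,-r_Y,-\rho,n)\frac{s^{\ell/2}}{|x|^{\ell/2}},$$ where $c_\ell(r_X,-r_Y,-\rho,n)$ is given by the formulas for $c_\ell$ in part 1 with $(r_Y,\rho)$ replaced by $(-r_Y,-\rho)$. 4. Suppose that $r_X-r_Y=0$. Then, as $x\rightarrow-\infty$, $$f(x)\sim \frac{|x|^{n/2-1}}{(2s)^{n/2}\Gamma(n/2)}\exp\bigg(-\frac{nr_X^2}{2}+\frac{x}{s(1-\rho)}\bigg)\sum_{k=0}^\infty d_k(r_X,-\rho,n)\frac{s^k}{|x|^k},$$ where $d_k(r_X,-\rho,n)$ is given by the formulas for $d_k$ in part 2 with $\rho$ replaced by $-\rho$.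
   Context: Notation: $r_X=\mu_X/\sigma_X$, $r_Y=\mu_Y/\sigma_Y$, $s=\sigma_X\sigma_Y$, and $$C_n=\exp\bigg\{-\frac{n(r_X^2+r_Y^2-2\rho r_X r_Y)}{2(1-\rho^2)}\bigg\}.$$ The Pochhammer symbol is $(v)_j=v(v+1)\cdots(v+j-1)$, with $(v)_0=1$. $\lceil\cdot\rceil$ is the ceiling function. $M(a,b,x)=\sum_{j=0}^\infty\frac{(a)_j}{(b)_j}\frac{x^j}{j!}$ is the confluent hypergeometric function of the first kind. For $a,b\in\mathbb{R}$ and integers $i,j\geq 0$, $g_{i,j}(a,b)$ is the coefficient of $u^iy^{j/2}$ in the Puiseux series expansion about $y=0$ of $(1+uy)^a\exp(by^{-1/2}(\sqrt{1+uy}-1))$; that is, it is uniquely determined by $$(1+uy)^a\exp(by^{-1/2}(\sqrt{1+uy}-1))=\sum_{j=0}^\infty\bigg(\sum_{i=\lceil j/2\rceil}^j g_{i,j}(a,b)u^i\bigg)y^{j/2}.$$ Asymptotic expansions are in the sense of Poincaré: $F(x)\sim\phi(x)\sum_{\ell=0}^\infty a_\ell |x|^{-\ell\kappa}$ as $x\to\pm\infty$ (with $\kappa=1/2$ or $\kappa=1$) means that, for every integer $N\geq1$, $F(x)=\phi(x)\big(\sum_{\ell=0}^{N-1}a_\ell|x|^{-\ell\kappa}+O(|x|^{-N\kappa})\big)$ in that limit. *)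

theory Defs
  imports "HOL-Probability.Probability" "HOL-Library.Landau_Symbols"
begin

definition bivariate_normal_density ::
  "real \<Rightarrow> real \<Rightarrow> real \<Rightarrow> real \<Rightarrow> real \<Rightarrow> real \<Rightarrow> real \<Rightarrow> real" where
  "bivariate_normal_density \<mu>X \<mu>Y \<sigma>X \<sigma>Y \<rho> x y =
     1 / (2 * pi * \<sigma>X * \<sigma>Y * sqrt (1 - \<rho>\<^sup>2)) *
     exp (- (((x - \<mu>X) / \<sigma>X)\<^sup>2 - 2 * \<rho> * ((x - \<mu>X) / \<sigma>X) * ((y - \<mu>Y) / \<sigma>Y)
              + ((y - \<mu>Y) / \<sigma>Y)\<^sup>2) / (2 * (1 - \<rho>\<^sup>2)))"

(* Meaningful for positive \<sigma>X, \<sigma>Y and \<bar>\<rho>\<bar> < 1, where the normal law is nondegenerate. *)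
definition bivariate_normal ::
  "'a measure \<Rightarrow> ('a \<Rightarrow> real) \<Rightarrow> ('a \<Rightarrow> real) \<Rightarrow> real \<Rightarrow> real \<Rightarrow> real \<Rightarrow> real \<Rightarrow> real \<Rightarrow> bool" where
  "bivariate_normal N X Y \<mu>X \<mu>Y \<sigma>X \<sigma>Y \<rho> \<longleftrightarrow>
     distributed N (lborel \<Otimes>\<^sub>M lborel) (\<lambda>\<omega>. (X \<omega>, Y \<omega>))
       (\<lambda>(x, y). ennreal (bivariate_normal_density \<mu>X \<mu>Y \<sigma>X \<sigma>Y \<rho> x y))"

definition kummer_M :: "real \<Rightarrow> real \<Rightarrow> real \<Rightarrow> real" where
  "kummer_M a b x = (\<Sum>j. pochhammer a j / pochhammer b j * (x ^ j / fact j))"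

(* The Puiseux expansion is read, for each fixed real u, as a convergent expansion in powers
   of y powr (1/2) for all sufficiently small y > 0 (how small may depend on u).  The values
   outside of \<lceil>j/2\<rceil> \<le> i \<le> j, which do not enter the expansion, are fixed to be 0, so that
   the family of coefficients is uniquely determined. *)
definition is_puiseux_coeffs :: "real \<Rightarrow> real \<Rightarrow> (nat \<Rightarrow> nat \<Rightarrow> real) \<Rightarrow> bool" where
  "is_puiseux_coeffs a b g \<longleftrightarrow>
     (\<forall>i j. i \<notin> {nat \<lceil>real j / 2\<rceil>..j} \<longrightarrow> g i j = 0) \<and>
     (\<forall>u::real. \<forall>\<^sub>F y in at_right 0.
        (\<lambda>j. (\<Sum>i = nat \<lceil>real j / 2\<rceil>..j. g i j * u ^ i) * y powr (real j / 2)) sums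
          ((1 + u * y) powr a * exp (b * y powr (- 1/2) * (sqrt (1 + u * y) - 1))))"

definition g_coeff :: "nat \<Rightarrow> nat \<Rightarrow> real \<Rightarrow> real \<Rightarrow> real" where
  "g_coeff i j a b = (THE g. is_puiseux_coeffs a b g) i j"

definition C_const :: "real \<Rightarrow> real \<Rightarrow> real \<Rightarrow> nat \<Rightarrow> real" where
  "C_const rX rY \<rho> n =
     exp (- (real n * (rX\<^sup>2 + rY\<^sup>2 - 2 * \<rho> * rX * rY) / (2 * (1 - \<rho>\<^sup>2))))"

definition h_coeff :: "nat \<Rightarrow> nat \<Rightarrow> real \<Rightarrow> real \<Rightarrow> real \<Rightarrow> nat \<Rightarrow> real" where
  "h_coeff j l rX rY \<rho> n =
     pochhammer ((3 - real n) / 2) (l - j) * pochhammer ((real n - 1) / 2) (l - j) /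
       (fact (l - j) * 2 ^ (l - j) * real n powr (real (l - j) / 2)) *
     ((1 + \<rho>) / \<bar>rX + rY\<bar>) ^ (l - j) *
     (\<Sum>i = nat \<lceil>real j / 2\<rceil>..j.
        pochhammer (real n / 2) i * ((1 - \<rho>\<^sup>2) / 2) ^ i *
        kummer_M (real n / 2 + real i) (real n / 2)
          (real n / 8 * ((1 + \<rho>) / (1 - \<rho>)) * (rX - rY)\<^sup>2) *
        g_coeff i j ((real n - 3) / 4 - real (l - j) / 2)
          (\<bar>rX + rY\<bar> / (1 + \<rho>) * sqrt (real n)))"

definition c_coeff :: "nat \<Rightarrow> real \<Rightarrow> real \<Rightarrow> real \<Rightarrow> nat \<Rightarrow> real" where
  "c_coeff l rX rY \<rho> n =
     (if l = 0 then 1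
      else exp (- (real n / 8 * ((1 + \<rho>) / (1 - \<rho>)) * (rX - rY)\<^sup>2)) *
           (\<Sum>j = 0..l. h_coeff j l rX rY \<rho> n))"

definition d_coeff :: "nat \<Rightarrow> real \<Rightarrow> real \<Rightarrow> nat \<Rightarrow> real" where
  "d_coeff k rX \<rho> n =
     (if k = 0 then 1
      else (- 1) ^ k * (pochhammer (1 - real n / 2) k * pochhammer (real n / 2) k / fact k) *
           ((1 - \<rho>\<^sup>2) / 2) ^ k *
           exp (- (real n / 2 * ((1 + \<rho>) / (1 - \<rho>)) * rX\<^sup>2)) *
           kummer_M (real n / 2 + real k) (real n / 2)
             (real n / 2 * ((1 + \<rho>) / (1 - \<rho>)) * rX\<^sup>2))"

definition d_coeff_sum :: "nat \<Rightarrow> real \<Rightarrow> real \<Rightarrow> nat \<Rightarrow> real" where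
  "d_coeff_sum k rX \<rho> n =
     (- 1) ^ k * (pochhammer (1 - real n / 2) k * pochhammer (real n / 2) k / fact k) *
     ((1 - \<rho>\<^sup>2) / 2) ^ k *
     (\<Sum>j = 0..k. (real n / 2) ^ j / pochhammer (real n / 2) j * real (k choose j) *
        ((1 + \<rho>) / (1 - \<rho>)) ^ j * rX ^ (2 * j))"

(* F(x) ~ \<phi>(x) * (sum over l of a l * \<bar>x\<bar> powr (- l * \<kappa>)) along the filter L, in the sense of
   Poincare; used with L = at_top and L = at_bot. *)
definition poincare_expansion ::
  "real filter \<Rightarrow> real \<Rightarrow> (real \<Rightarrow> real) \<Rightarrow> (real \<Rightarrow> real) \<Rightarrow> (nat \<Rightarrow> real) \<Rightarrow> bool" where
  "poincare_expansion L \<kappa> F \<phi> a \<longleftrightarrow>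
     (\<forall>N\<ge>1. \<exists>R. R \<in> O[L](\<lambda>x. \<bar>x\<bar> powr (- (real N * \<kappa>))) \<and>
        (\<forall>\<^sub>F x in L. F x = \<phi> x * ((\<Sum>l<N. a l * \<bar>x\<bar> powr (- (real l * \<kappa>))) + R x)))"

end

theory Submission
  imports Defs
begin

text \<open>
  With U and V the half sum and the half difference of X / sigma_X and Y / sigma_Y, scaled by the
  square root of s, one has XY = U^2 - V^2 with U and V independent normal variables. Hence the
  sum of n copies is the difference of two independent noncentral gamma variables, and its density
  at x > 0 is the integral over t > 0 of p(x + t) q(t) for explicit densities p and q. In p a
  modified Bessel function occurs; its Hankel expansion (Watson's lemma applied to Poisson's
  integral) turns p(x + t) / p(x) into a combination of the functions
  (1 + t w^2)^a exp (b (sqrt (1 + t w^2) - 1) / w) with w = x^(-1/2), whose expansions in w define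
  the numbers g_(i,j). The remainder of this expansion is at most w^N exp (eps t) up to a constant,
  uniformly in t, so that it can be integrated against q term by term; the moments of q are
  values of Kummer's function. The tail at minus infinity follows by exchanging the
  two noncentral gamma variables.
\<close>

section \<open>Noncentral gamma densities\<close>

text \<open>The Puiseux series converges only while t w^2 is small, but the integral runs over all t
  > 0; hence the need for a remainder bound uniform in t. A factor exp (eps t) is affordable because
  p (x + t) carries exp (- t / c), where c is the scale of p: the choice eps = 1 / c spends exactly
  this factor and leaves q, whose integral is 1. The terms of the expansion keep the factor, so
  their moments are taken against exp (- t / c) q (t), where the scale c' of q is replaced by d with
  1 / d = 1 / c + 1 / c'. After division by s one has c = 1 + \<rho> and c' = 1 - \<rho>, so d = (1
  - \<open>\<rho>\<^sup>2\<close>) / 2, the base of the powers in the coefficients. The zeroth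
  moment contains M (n / 2, n / 2, z) = exp z. This factor goes into the prefactor, and the
  coefficients therefore begin with exp (- z). If the half sum has mean 0, the Bessel function
  degenerates to a power and only integer powers of 1 / x survive. The laws are handled through
  integrals of nonnegative functions with values in \<open>ennreal\<close>, where sums and integrals
  may be exchanged freely.\<close>

definition power_kernel :: "real \<Rightarrow> real \<Rightarrow> real" where
  "power_kernel \<alpha> t = (if t > 0 then t powr (\<alpha> - 1) / Gamma \<alpha> else 0)"

lemma power_kernel_nonneg: "\<alpha> > 0 \<Longrightarrow> power_kernel \<alpha> t \<ge> 0"
  by (simp add: power_kernel_def Gamma_real_pos less_imp_le)

lemma measurable_power_kernel [measurable]: "power_kernel \<alpha> \<in> borel_measurable borel"
  unfolding power_kernel_def by measurable

text \<open>Euler's Beta integral after \<open>y = x * v\<close>. This semigroup law of the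
  fractional integration kernels is the source of every explicit convolution below.\<close>

lemma nn_integral_power_kernel_convolution:
  assumes "\<alpha> > 0" "\<beta> > 0"
  shows "(\<integral>\<^sup>+y. ennreal (power_kernel \<alpha> (x - y)) * ennreal (power_kernel \<beta> y) \<partial>lborel)
         = ennreal (power_kernel (\<alpha> + \<beta>) x)"
proof (cases "x > 0")
  case False
  have "power_kernel \<alpha> (x - y) = 0 \<or> power_kernel \<beta> y = 0" for y
    using False by (auto simp: power_kernel_def)
  then have "ennreal (power_kernel \<alpha> (x - y)) * ennreal (power_kernel \<beta> y) = 0" for y
    by (metis ennreal_0 mult_zero_left mult_zero_right)
  then show ?thesis using False by (simp only: nn_integral_0_iff_AE) (simp add: power_kernel_def)
next
  case True
  define K where "K = x powr (\<alpha> + \<beta> - 2) / (Gamma \<alpha> * Gamma \<beta>)"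
  define h where "h v = indicator {0..1} v * (v powr (\<beta> - 1) * (1 - v) powr (\<alpha> - 1))" for v :: real
  have K: "K \<ge> 0" using assms by (simp add: K_def Gamma_real_pos less_imp_le)
  have eq: "ennreal (power_kernel \<alpha> (x - (0 + x * v))) * ennreal (power_kernel \<beta> (0 + x * v))
      = ennreal K * ennreal (h v)" for v
  proof -
    have "power_kernel \<alpha> (x - x * v) * power_kernel \<beta> (x * v) = K * h v"
    proof (cases "0 < v \<and> v < 1")
      case True
      have "x - x * v = x * (1 - v)" by (simp add: algebra_simps)
      moreover have "x powr (\<alpha> - 1) * x powr (\<beta> - 1) = x powr (\<alpha> + \<beta> - 2)"
        by (simp add: powr_add[symmetric])
      ultimately show ?thesis using True \<open>x > 0\<close>
        by (simp add: power_kernel_def K_def h_def powr_mult mult_ac)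
    next
      case F: False
      have "x * v < x \<longleftrightarrow> v < 1" using \<open>x > 0\<close> by simp
      then have "power_kernel \<alpha> (x - x * v) * power_kernel \<beta> (x * v) = 0"
        using F \<open>x > 0\<close> by (auto simp: power_kernel_def zero_less_mult_iff)
      \<comment> \<open>At the end points of [0, 1] this rests on \<open>0 powr _ = 0\<close>; the
        kernels live on the open interval only.\<close>
      moreover have "h v = 0" using F by (cases "v = 0"; cases "v = 1") (auto simp: h_def)
      ultimately show ?thesis by simp
    qed
    then show ?thesis using assms K
      by (simp add: ennreal_mult'[symmetric] power_kernel_nonneg)
  qed
  have hB: "(\<integral>\<^sup>+v. ennreal (h v) \<partial>lborel) = ennreal (Beta \<beta> \<alpha>)"
  proof (rule nn_integral_has_integral_lborel)
    show "h \<in> borel_measurable borel" unfolding h_def by measurable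
    show "h v \<ge> 0" for v by (simp add: h_def)
    have "((\<lambda>v. if v \<in> {0..1} then v powr (\<beta> - 1) * (1 - v) powr (\<alpha> - 1) else 0)
       has_integral Beta \<beta> \<alpha>) UNIV"
      using has_integral_Beta_real[OF assms(2,1)] by (subst has_integral_restrict_UNIV)
    then show "(h has_integral Beta \<beta> \<alpha>) UNIV"
      by (rule has_integral_eq_rhs[OF has_integral_eq, rotated]) (auto simp: h_def)
  qed
  have h_meas[measurable]: "h \<in> borel_measurable borel" unfolding h_def by measurable
  have "(\<integral>\<^sup>+y. ennreal (power_kernel \<alpha> (x - y)) * ennreal (power_kernel \<beta> y) \<partial>lborel)
      = ennreal \<bar>x\<bar> * (\<integral>\<^sup>+v. ennreal K * ennreal (h v) \<partial>lborel)"
    using True by (subst nn_integral_real_affine[where c = x and t = 0]) (simp_all only: eq, auto)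
  also have "\<dots> = ennreal x * (ennreal K * ennreal (Beta \<beta> \<alpha>))"
    using True by (simp add: nn_integral_cmult hB)
  also have "\<dots> = ennreal (x * (K * Beta \<beta> \<alpha>))"
    using True K by (simp add: ennreal_mult' mult_ac)
  also have "x * (K * Beta \<beta> \<alpha>) = power_kernel (\<alpha> + \<beta>) x"
  proof -
    have "x * x powr (\<alpha> + \<beta> - 2) = x powr (\<alpha> + \<beta> - 1)"
      using True powr_add[of x 1 "\<alpha> + \<beta> - 2"] by simp
    moreover have "Gamma \<alpha> > 0" "Gamma \<beta> > 0" using assms by (auto intro: Gamma_real_pos)
    ultimately show ?thesis using True
      by (simp add: K_def Beta_def power_kernel_def field_simps)
  qed
  finally show ?thesis .
qed

text \<open>The Laplace transform at 1 / c, by Euler's Gamma integral after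
  \<open>t = c * v\<close>.\<close>

lemma nn_integral_power_kernel_exp:
  assumes "\<alpha> > 0" "c > 0"
  shows "(\<integral>\<^sup>+t. ennreal (power_kernel \<alpha> t * exp (- t / c)) \<partial>lborel) = ennreal (c powr \<alpha>)"
proof -
  define h where "h v = indicator {0..} v * (v powr (\<alpha> - 1) / exp v)" for v :: real
  have h_meas[measurable]: "h \<in> borel_measurable borel" unfolding h_def by measurable
  have G: "Gamma \<alpha> > 0" using assms Gamma_real_pos by simp
  have eq: "power_kernel \<alpha> (0 + c * v) * exp (- (0 + c * v) / c) = c powr (\<alpha> - 1) / Gamma \<alpha> * h v" for v
    using assms G by (cases "v > 0"; cases "v = 0")
      (auto simp: power_kernel_def h_def powr_mult exp_minus field_simps zero_less_mult_iff)
  have hG: "(\<integral>\<^sup>+v. ennreal (h v) \<partial>lborel) = ennreal (Gamma \<alpha>)"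
  proof (rule nn_integral_has_integral_lborel)
    show "h v \<ge> 0" for v by (simp add: h_def)
    have "((\<lambda>v. if v \<in> {0..} then v powr (\<alpha> - 1) / exp v else 0) has_integral Gamma \<alpha>) UNIV"
      using Gamma_integral_real[OF assms(1)] by (subst has_integral_restrict_UNIV)
    then show "(h has_integral Gamma \<alpha>) UNIV"
      by (rule has_integral_eq_rhs[OF has_integral_eq, rotated]) (auto simp: h_def)
  qed (fact h_meas)
  have "(\<integral>\<^sup>+t. ennreal (power_kernel \<alpha> t * exp (- t / c)) \<partial>lborel)
      = ennreal \<bar>c\<bar> * (\<integral>\<^sup>+v. ennreal (c powr (\<alpha> - 1) / Gamma \<alpha> * h v) \<partial>lborel)"
    using assms by (subst nn_integral_real_affine[where c = c and t = 0]) (simp_all only: eq, auto)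
  also have "\<dots> = ennreal c * (ennreal (c powr (\<alpha> - 1) / Gamma \<alpha>) * ennreal (Gamma \<alpha>))"
    using assms G by (subst ennreal_mult') (auto simp: nn_integral_cmult hG)
  also have "\<dots> = ennreal (c * (c powr (\<alpha> - 1) / Gamma \<alpha> * Gamma \<alpha>))"
    using assms G by (simp add: ennreal_mult'[symmetric])
  also have "c * (c powr (\<alpha> - 1) / Gamma \<alpha> * Gamma \<alpha>) = c powr \<alpha>"
  proof -
    have "Gamma \<alpha> \<noteq> 0" using G by linarith
    then show ?thesis using assms powr_add[of c 1 "\<alpha> - 1"] by simp
  qed
  finally show ?thesis .
qed

section \<open>Series of Bessel type and their convolution\<close>

lemma suminf_diagonal_ennreal:
  fixes a :: "nat \<Rightarrow> nat \<Rightarrow> ennreal"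
  shows "(\<Sum>k. \<Sum>l. a k l) = (\<Sum>n. \<Sum>k\<le>n. a k (n - k))"
proof -
  \<comment> \<open>Padding with zeros lets both indices run over all naturals, so the exchange of
    the sums is Tonelli's theorem for the counting measure.\<close>
  define g where "g k n = (if k \<le> n then a k (n - k) else 0)" for k n
  have "(\<Sum>n. g k n) = (\<Sum>l. a k l)" for k
    by (subst suminf_offset[where i = k]) (simp_all add: g_def)
  then have "(\<Sum>k. \<Sum>l. a k l) = (\<Sum>k. \<integral>\<^sup>+n. g k n \<partial>count_space UNIV)"
    by (simp add: nn_integral_count_space_nat)
  also have "\<dots> = (\<integral>\<^sup>+n. (\<Sum>k. g k n) \<partial>count_space UNIV)"
    by (rule nn_integral_suminf[symmetric]) simp
  also have "\<dots> = (\<Sum>n. \<Sum>k. g k n)" by (simp add: nn_integral_count_space_nat)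
  also have "(\<lambda>n. \<Sum>k. g k n) = (\<lambda>n. \<Sum>k\<le>n. a k (n - k))"
    by (rule ext, subst suminf_finite[of "{..n}" for n]) (auto simp: g_def)
  finally show ?thesis .
qed

text \<open>In terms of the modified Bessel function, phi01 nu z = z^((1 - nu) / 2) I_(nu - 1) (2 sqrt z).\<close>

definition phi01 :: "real \<Rightarrow> real \<Rightarrow> real" where
  "phi01 \<nu> z = (\<Sum>k. z ^ k / (fact k * Gamma (\<nu> + real k)))"

text \<open>For k > 0, Gamma (\<nu> + k) is Gamma \<nu> times a Pochhammer symbol that is at least
  \<nu>. A bound that does not depend on k leaves the exponential series as a majorant of
  \<open>phi01\<close>.\<close>

lemma inverse_Gamma_shift_bounded:
  assumes "\<nu> > (0::real)"
  shows "inverse (Gamma (\<nu> + real k)) \<le> inverse (Gamma \<nu>) * max 1 (inverse \<nu>)"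
proof (cases k)
  case 0
  then show ?thesis using assms Gamma_real_pos[OF assms]
    by (auto simp: mult_le_cancel_left1 dest: order.asym)
next
  case (Suc m)
  have "pochhammer \<nu> (Suc m) \<ge> \<nu>"
  proof (induction m)
    case (Suc m)
    have "\<nu> * 1 \<le> pochhammer \<nu> (Suc m) * (\<nu> + real (Suc m))"
      by (rule mult_mono) (use Suc assms in auto)
    then show ?case by (simp add: pochhammer_Suc[of _ "Suc m"])
  qed simp
  moreover have "Gamma (\<nu> + real k) = pochhammer \<nu> (Suc m) * Gamma \<nu>"
    using assms Gamma_real_pos[OF assms] pochhammer_Gamma[of \<nu> "Suc m"] Suc
    by (simp add: field_simps nonpos_Ints_def not_le[symmetric])
  ultimately have "\<nu> * Gamma \<nu> \<le> Gamma (\<nu> + real k)" using Gamma_real_pos[OF assms] by simp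
  then have "inverse (Gamma (\<nu> + real k)) \<le> inverse (\<nu> * Gamma \<nu>)"
    using assms Gamma_real_pos[OF assms] by (intro le_imp_inverse_le) auto
  also have "\<dots> \<le> inverse (Gamma \<nu>) * max 1 (inverse \<nu>)"
    using Gamma_real_pos[OF assms] by (simp add: mult.commute)
  finally show ?thesis .
qed

lemma summable_phi01:
  assumes "\<nu> > 0"
  shows "summable (\<lambda>k. z ^ k / (fact k * Gamma (\<nu> + real k)))"
proof (rule summable_comparison_test')
  show "summable (\<lambda>k. (inverse (Gamma \<nu>) * max 1 (inverse \<nu>)) * (\<bar>z\<bar> ^ k / fact k))"
    using summable_exp[of "\<bar>z\<bar>"] by (intro summable_mult) (simp add: divide_inverse mult.commute)
  show "norm (z ^ k / (fact k * Gamma (\<nu> + real k)))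
      \<le> inverse (Gamma \<nu>) * max 1 (inverse \<nu>) * (\<bar>z\<bar> ^ k / fact k)" if "k \<ge> 0" for k
  proof -
    have "norm (z ^ k / (fact k * Gamma (\<nu> + real k))) = inverse (Gamma (\<nu> + real k)) * (\<bar>z\<bar> ^ k / fact k)"
      using assms Gamma_real_pos[of "\<nu> + real k"] by (simp add: abs_mult power_abs field_simps)
    also have "\<dots> \<le> inverse (Gamma \<nu>) * max 1 (inverse \<nu>) * (\<bar>z\<bar> ^ k / fact k)"
      by (intro mult_right_mono inverse_Gamma_shift_bounded assms) auto
    finally show ?thesis .
  qed
qed

lemma measurable_phi01 [measurable]: "phi01 \<nu> \<in> borel_measurable borel"
  unfolding phi01_def by measurable

lemma phi01_nonneg: "\<nu> > 0 \<Longrightarrow> z \<ge> 0 \<Longrightarrow> phi01 \<nu> z \<ge> 0"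
  unfolding phi01_def
  by (intro suminf_nonneg summable_phi01) (auto intro!: divide_nonneg_pos mult_pos_pos Gamma_real_pos add_pos_nonneg)

lemma ennreal_phi01_kernel:
  assumes "\<nu> > 0" "\<theta> \<ge> 0" "t > 0"
  shows "ennreal (t powr (\<nu> - 1) * phi01 \<nu> (\<theta> * t))
         = (\<Sum>k. ennreal (\<theta> ^ k / fact k) * ennreal (power_kernel (\<nu> + real k) t))"
proof -
  have "(\<Sum>k. ennreal (\<theta> ^ k / fact k) * ennreal (power_kernel (\<nu> + real k) t))
     = (\<Sum>k. ennreal (t powr (\<nu> - 1) * ((\<theta> * t) ^ k / (fact k * Gamma (\<nu> + real k)))))"
  proof (rule suminf_cong)
    fix k
    have "t powr (\<nu> + real k - 1) = t powr (\<nu> - 1) * t ^ k"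
      using assms by (simp add: powr_realpow[symmetric] powr_add[symmetric] algebra_simps)
    then show "ennreal (\<theta> ^ k / fact k) * ennreal (power_kernel (\<nu> + real k) t)
       = ennreal (t powr (\<nu> - 1) * ((\<theta> * t) ^ k / (fact k * Gamma (\<nu> + real k))))"
      using assms by (simp add: ennreal_mult'[symmetric] power_kernel_def power_mult_distrib mult_ac)
  qed
  also have "\<dots> = ennreal (\<Sum>k. t powr (\<nu> - 1) * ((\<theta> * t) ^ k / (fact k * Gamma (\<nu> + real k))))"
    using assms by (intro suminf_ennreal2 summable_mult summable_phi01)
      (auto intro!: mult_nonneg_nonneg divide_nonneg_nonneg Gamma_real_nonneg add_nonneg_nonneg)
  also have "\<dots> = ennreal (t powr (\<nu> - 1) * phi01 \<nu> (\<theta> * t))"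
    using assms by (subst suminf_mult[OF summable_phi01]) (simp_all add: phi01_def)
  finally show ?thesis by simp
qed

text \<open>A series of the kernels of index \<nu> + k with weights
  \<open>\<theta> ^ k / fact k\<close>. Its Laplace transform at 1 / c is
  \<open>c powr \<nu> * exp (\<theta> * c)\<close>, which predicts that both parameters add under
  convolution.\<close>

definition phi01_kernel :: "real \<Rightarrow> real \<Rightarrow> real \<Rightarrow> real" where
  "phi01_kernel \<nu> \<theta> t = (if t > 0 then t powr (\<nu> - 1) * phi01 \<nu> (\<theta> * t) else 0)"

lemma measurable_phi01_kernel [measurable]: "phi01_kernel \<nu> \<theta> \<in> borel_measurable borel"
  unfolding phi01_kernel_def by measurable

lemma phi01_kernel_nonneg: "\<nu> > 0 \<Longrightarrow> \<theta> \<ge> 0 \<Longrightarrow> phi01_kernel \<nu> \<theta> t \<ge> 0"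
  by (simp add: phi01_kernel_def phi01_nonneg)

lemma ennreal_phi01_kernel_series:
  assumes "\<nu> > 0" "\<theta> \<ge> 0"
  shows "ennreal (phi01_kernel \<nu> \<theta> t)
         = (\<Sum>k. ennreal (\<theta> ^ k / fact k) * ennreal (power_kernel (\<nu> + real k) t))"
  using ennreal_phi01_kernel[OF assms, of t] by (simp add: phi01_kernel_def power_kernel_def)

text \<open>Kernels of indices k and l convolve to one that depends on k + l only. The double series
  is therefore summed along diagonals, where the weights combine by the binomial theorem.\<close>

lemma nn_integral_phi01_kernel_convolution:
  assumes "\<nu> > 0" "\<nu>' > 0" "\<theta> \<ge> 0" "\<theta>' \<ge> 0"
  shows "(\<integral>\<^sup>+y. ennreal (phi01_kernel \<nu> \<theta> (x - y)) * ennreal (phi01_kernel \<nu>' \<theta>' y) \<partial>lborel)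
         = ennreal (phi01_kernel (\<nu> + \<nu>') (\<theta> + \<theta>') x)"
proof -
  let ?A = "\<lambda>k. ennreal (\<theta> ^ k / fact k)" and ?B = "\<lambda>l. ennreal (\<theta>' ^ l / fact l)"
  let ?P = "\<lambda>k y. ennreal (power_kernel (\<nu> + real k) (x - y))"
  let ?Q = "\<lambda>l y. ennreal (power_kernel (\<nu>' + real l) y)"
  let ?R = "\<lambda>m. ennreal (power_kernel (\<nu> + \<nu>' + real m) x)"
  have "(\<integral>\<^sup>+y. ennreal (phi01_kernel \<nu> \<theta> (x - y)) * ennreal (phi01_kernel \<nu>' \<theta>' y) \<partial>lborel)
      = (\<integral>\<^sup>+y. (\<Sum>k. \<Sum>l. (?A k * ?B l) * (?P k y * ?Q l y)) \<partial>lborel)"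
  proof (rule nn_integral_cong)
    fix y
    have "(?A k * ?B l) * (?P k y * ?Q l y) = (?A k * ?P k y) * (?B l * ?Q l y)" for k l
      by (simp add: mult_ac)
    then show "ennreal (phi01_kernel \<nu> \<theta> (x - y)) * ennreal (phi01_kernel \<nu>' \<theta>' y)
        = (\<Sum>k. \<Sum>l. (?A k * ?B l) * (?P k y * ?Q l y))"
      using assms by (simp add: ennreal_phi01_kernel_series)
  qed
  also have "\<dots> = (\<Sum>k. \<Sum>l. (?A k * ?B l) * (\<integral>\<^sup>+y. ?P k y * ?Q l y \<partial>lborel))"
    by (simp add: nn_integral_suminf nn_integral_cmult)
  also have "\<dots> = (\<Sum>k. \<Sum>l. (?A k * ?B l) * ?R (k + l))"
    using assms by (simp add: nn_integral_power_kernel_convolution add_ac add_pos_nonneg)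
  also have "\<dots> = (\<Sum>n. \<Sum>k\<le>n. (?A k * ?B (n - k)) * ?R n)"
    by (subst suminf_diagonal_ennreal) simp
  also have "\<dots> = (\<Sum>n. ennreal ((\<theta> + \<theta>') ^ n / fact n) * ?R n)"
  proof (rule suminf_cong)
    fix n
    have "(\<Sum>k\<le>n. ?A k * ?B (n - k)) = ennreal (\<Sum>k\<le>n. \<theta> ^ k / fact k * (\<theta>' ^ (n - k) / fact (n - k)))"
      using assms by (simp add: ennreal_mult'[symmetric])
    also have "(\<Sum>k\<le>n. \<theta> ^ k / fact k * (\<theta>' ^ (n - k) / fact (n - k))) = (\<theta> + \<theta>') ^ n / fact n"
      by (simp add: binomial_ring sum_divide_distrib binomial_fact)
    finally show "(\<Sum>k\<le>n. (?A k * ?B (n - k)) * ?R n) = ennreal ((\<theta> + \<theta>') ^ n / fact n) * ?R n"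
      by (simp add: sum_distrib_right[symmetric])
  qed
  also have "\<dots> = ennreal (phi01_kernel (\<nu> + \<nu>') (\<theta> + \<theta>') x)"
    using assms by (simp add: ennreal_phi01_kernel_series)
  finally show ?thesis .
qed

text \<open>A mixture of gamma densities of shape \<nu> + k and scale c, where k has the Poisson law
  with mean \<open>\<theta> * c\<close>.\<close>

definition noncentral_gamma :: "real \<Rightarrow> real \<Rightarrow> real \<Rightarrow> real \<Rightarrow> real" where
  "noncentral_gamma \<nu> \<theta> c t = phi01_kernel \<nu> \<theta> t * exp (- t / c) / (c powr \<nu> * exp (\<theta> * c))"

lemma measurable_noncentral_gamma [measurable]: "noncentral_gamma \<nu> \<theta> c \<in> borel_measurable borel"
  unfolding noncentral_gamma_def by measurable

lemma noncentral_gamma_nonneg: "\<nu> > 0 \<Longrightarrow> \<theta> \<ge> 0 \<Longrightarrow> noncentral_gamma \<nu> \<theta> c t \<ge> 0"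
  by (simp add: noncentral_gamma_def phi01_kernel_nonneg)

lemma nn_integral_phi01_kernel_exp:
  assumes "\<nu> > 0" "\<theta> \<ge> 0" "c > 0"
  shows "(\<integral>\<^sup>+t. ennreal (phi01_kernel \<nu> \<theta> t * exp (- t / c)) \<partial>lborel) = ennreal (c powr \<nu> * exp (\<theta> * c))"
proof -
  have "(\<integral>\<^sup>+t. ennreal (phi01_kernel \<nu> \<theta> t * exp (- t / c)) \<partial>lborel)
      = (\<integral>\<^sup>+t. (\<Sum>k. ennreal (\<theta> ^ k / fact k) * ennreal (power_kernel (\<nu> + real k) t * exp (- t / c))) \<partial>lborel)"
    using assms by (intro nn_integral_cong)
      (simp add: ennreal_mult'' ennreal_phi01_kernel_series mult.assoc[symmetric] del: minus_divide_left)
  also have "\<dots> = (\<Sum>k. ennreal (\<theta> ^ k / fact k) * ennreal (c powr (\<nu> + real k)))"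
    using assms by (simp add: nn_integral_suminf nn_integral_cmult add_pos_nonneg
        nn_integral_power_kernel_exp[unfolded minus_divide_left[symmetric]])
  also have "\<dots> = (\<Sum>k. ennreal (c powr \<nu> * ((\<theta> * c) ^ k /\<^sub>R fact k)))"
    using assms by (intro suminf_cong)
      (simp add: ennreal_mult'[symmetric] powr_add powr_realpow power_mult_distrib field_simps)
  also have "\<dots> = ennreal (\<Sum>k. c powr \<nu> * ((\<theta> * c) ^ k /\<^sub>R fact k))"
    using assms by (intro suminf_ennreal2 summable_mult summable_exp_generic) auto
  also have "(\<Sum>k. c powr \<nu> * ((\<theta> * c) ^ k /\<^sub>R fact k)) = c powr \<nu> * exp (\<theta> * c)"
    by (subst suminf_mult[OF summable_exp_generic]) (simp add: exp_def)
  finally show ?thesis .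
qed

lemma nn_integral_noncentral_gamma:
  assumes "\<nu> > 0" "\<theta> \<ge> 0" "c > 0"
  shows "(\<integral>\<^sup>+t. ennreal (noncentral_gamma \<nu> \<theta> c t) \<partial>lborel) = 1"
proof -
  let ?K = "c powr \<nu> * exp (\<theta> * c)"
  have K: "?K > 0" using assms by simp
  have "(\<integral>\<^sup>+t. ennreal (noncentral_gamma \<nu> \<theta> c t) \<partial>lborel)
      = (\<integral>\<^sup>+t. ennreal (1 / ?K) * ennreal (phi01_kernel \<nu> \<theta> t * exp (- t / c)) \<partial>lborel)"
    unfolding noncentral_gamma_def using K
    by (intro nn_integral_cong) (simp add: ennreal_mult'[symmetric] del: minus_divide_left)
  also have "\<dots> = ennreal (1 / ?K) * ennreal ?K"
    by (subst nn_integral_cmult) (use assms nn_integral_phi01_kernel_exp in auto)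
  also have "\<dots> = ennreal (1 / ?K * ?K)" using K by (intro ennreal_mult'[symmetric]) simp
  also have "\<dots> = 1" using K assms by simp
  finally show ?thesis .
qed

lemma nn_integral_noncentral_gamma_convolution:
  assumes "\<nu> > 0" "\<nu>' > 0" "\<theta> \<ge> 0" "\<theta>' \<ge> 0" "c > 0"
  shows "(\<integral>\<^sup>+y. ennreal (noncentral_gamma \<nu> \<theta> c (x - y)) * ennreal (noncentral_gamma \<nu>' \<theta>' c y) \<partial>lborel)
         = ennreal (noncentral_gamma (\<nu> + \<nu>') (\<theta> + \<theta>') c x)"
proof -
  let ?K = "exp (- x / c) / (c powr (\<nu> + \<nu>') * exp ((\<theta> + \<theta>') * c))"
  have eq: "noncentral_gamma \<nu> \<theta> c (x - y) * noncentral_gamma \<nu>' \<theta>' c y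
      = ?K * (phi01_kernel \<nu> \<theta> (x - y) * phi01_kernel \<nu>' \<theta>' y)" for y
  proof -
    have "exp (- (x - y) / c) * exp (- y / c) = exp (- x / c)"
      by (simp add: exp_add[symmetric] diff_divide_distrib)
    then have "?K * (phi01_kernel \<nu> \<theta> (x - y) * phi01_kernel \<nu>' \<theta>' y)
       = exp (- (x - y) / c) * exp (- y / c) / (c powr (\<nu> + \<nu>') * exp ((\<theta> + \<theta>') * c)) *
         (phi01_kernel \<nu> \<theta> (x - y) * phi01_kernel \<nu>' \<theta>' y)" by simp
    then show ?thesis
      unfolding noncentral_gamma_def powr_add distrib_right exp_add[of "\<theta> * c"]
      by (simp only: times_divide_times_eq times_divide_eq_left times_divide_eq_right
          divide_divide_eq_left mult_ac)
  qed
  have "(\<integral>\<^sup>+y. ennreal (noncentral_gamma \<nu> \<theta> c (x - y)) * ennreal (noncentral_gamma \<nu>' \<theta>' c y) \<partial>lborel)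
     = (\<integral>\<^sup>+y. ennreal ?K * (ennreal (phi01_kernel \<nu> \<theta> (x - y)) * ennreal (phi01_kernel \<nu>' \<theta>' y)) \<partial>lborel)"
    using assms
    by (intro nn_integral_cong) (simp add: eq phi01_kernel_nonneg noncentral_gamma_nonneg ennreal_mult'[symmetric])
  also have "\<dots> = ennreal ?K * ennreal (phi01_kernel (\<nu> + \<nu>') (\<theta> + \<theta>') x)"
    using assms by (simp add: nn_integral_cmult nn_integral_phi01_kernel_convolution)
  also have "\<dots> = ennreal (noncentral_gamma (\<nu> + \<nu>') (\<theta> + \<theta>') c x)"
    using assms by (simp add: noncentral_gamma_def phi01_kernel_nonneg ennreal_mult'[symmetric] mult_ac)
  finally show ?thesis .
qed

section \<open>Squares of normal variables\<close>

lemma phi01_half: "z \<ge> 0 \<Longrightarrow> phi01 (1/2) z = cosh (2 * sqrt z) / sqrt pi"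
proof -
  assume z: "z \<ge> 0"
  let ?f = "\<lambda>n. if even n then (2 * sqrt z) ^ n / fact n else 0"
  have "(\<lambda>n. ?f (2 * n)) sums cosh (2 * sqrt z)"
    using cosh_converges[of "2 * sqrt z"]
    by (subst sums_mono_reindex[where f = ?f]) (auto simp: strict_mono_def scaleR_conv_of_real divide_inverse mult.commute cong: if_cong elim!: evenE)
  then have "(\<lambda>n. ?f (2 * n) / sqrt pi) sums (cosh (2 * sqrt z) / sqrt pi)"
    by (rule sums_divide)
  moreover have "?f (2 * n) / sqrt pi = z ^ n / (fact n * Gamma (1/2 + real n))" for n
  proof -
    \<comment> \<open>Together with \<open>fact_double\<close>, which writes (2 n)! through the same
      Pochhammer symbol, this identifies the series with that of cosh.\<close>
    have "Gamma (1/2 + real n) = pochhammer (1/2) n * sqrt pi"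
    proof -
      have "(1/2::real) \<notin> \<int>\<^sub>\<le>\<^sub>0" by (auto dest: nonpos_Ints_nonpos)
      then show ?thesis using pochhammer_Gamma[of "1/2::real" n] by (simp add: Gamma_one_half_real field_simps)
    qed
    moreover have "(2 * sqrt z) ^ (2 * n) = 4 ^ n * z ^ n"
      using z by (simp add: power_mult power_mult_distrib)
    ultimately show ?thesis
      unfolding fact_double by (simp add: power_mult)
  qed
  ultimately show ?thesis by (simp add: phi01_def sums_iff)
qed

text \<open>Substitution on compact intervals, then monotone convergence as the intervals exhaust
  the half line.\<close>

lemma nn_integral_square_substitution:
  fixes f :: "real \<Rightarrow> real"
  assumes [measurable]: "f \<in> borel_measurable borel"
  shows "(\<integral>\<^sup>+t. ennreal (f t * indicator {0..} t) \<partial>lborel)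
         = (\<integral>\<^sup>+x. ennreal (f (x\<^sup>2) * (2 * x) * indicator {0..} x) \<partial>lborel)"
proof -
  let ?L = "\<lambda>i t. ennreal (f t * indicator {0..(real i)\<^sup>2} t)"
  let ?R = "\<lambda>i x. ennreal (f (x\<^sup>2) * (2 * x) * indicator {0..real i} x)"
  have "(\<integral>\<^sup>+t. ?L i t \<partial>lborel) = (\<integral>\<^sup>+x. ?R i x \<partial>lborel)" for i
  proof -
    have "((\<lambda>x. x\<^sup>2) has_real_derivative 2 * x) (at x)" for x :: real
      by (auto intro!: derivative_eq_intros)
    then show ?thesis
      using nn_integral_substitution[of "\<lambda>x. x\<^sup>2" 0 "real i" f "\<lambda>x. 2 * x"]
      by (auto simp: set_borel_measurable_def intro!: continuous_intros)
  qed
  moreover have "(\<lambda>i. \<integral>\<^sup>+t. ?L i t \<partial>lborel) \<longlonglongrightarrow> (\<integral>\<^sup>+t. ennreal (f t * indicator {0..} t) \<partial>lborel)"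
  proof (rule nn_integral_LIMSEQ)
    show "incseq ?L"
      by (auto simp: incseq_def le_fun_def indicator_def intro: order.trans power_mono)
    show "(\<lambda>i. ?L i t) \<longlonglongrightarrow> ennreal (f t * indicator {0..} t)" for t
    proof (rule tendsto_eventually)
      obtain k :: nat where k: "\<bar>t\<bar> + 1 \<le> real k" using real_arch_simple by blast
      have "t \<le> (real i)\<^sup>2" if "i \<ge> k" for i
      proof -
        have "real i \<ge> 1" "t \<le> real i" using k that by auto
        then show ?thesis using mult_mono[of 1 "real i" "real i" "real i"]
          unfolding power2_eq_square by linarith
      qed
      then show "\<forall>\<^sub>F i in sequentially. ?L i t = ennreal (f t * indicator {0..} t)"
        unfolding eventually_sequentially by (intro exI[of _ k]) (auto simp: indicator_def)
    qed
  qed measurable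
  moreover have "(\<lambda>i. \<integral>\<^sup>+x. ?R i x \<partial>lborel)
      \<longlonglongrightarrow> (\<integral>\<^sup>+x. ennreal (f (x\<^sup>2) * (2 * x) * indicator {0..} x) \<partial>lborel)"
  proof (rule nn_integral_LIMSEQ)
    show "incseq ?R"
      by (auto simp: incseq_def le_fun_def indicator_def)
    show "(\<lambda>i. ?R i x) \<longlonglongrightarrow> ennreal (f (x\<^sup>2) * (2 * x) * indicator {0..} x)" for x
    proof (rule tendsto_eventually)
      obtain k :: nat where k: "x \<le> real k" using real_arch_simple by blast
      then show "\<forall>\<^sub>F i in sequentially. ?R i x = ennreal (f (x\<^sup>2) * (2 * x) * indicator {0..} x)"
        unfolding eventually_sequentially by (intro exI[of _ k]) (auto simp: indicator_def)
    qed
  qed measurable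
  ultimately show ?thesis using LIMSEQ_unique by simp
qed

text \<open>A value t > 0 has the two square roots x and - x. The sum of the normal densities there
  is a multiple of cosh (2 m x / c) with \<open>c = 2 * \<sigma>\<^sup>2\<close>, which is
  \<open>phi01 (1/2)\<close> by \<open>phi01_half\<close>.\<close>

lemma nn_integral_normal_square:
  assumes "\<sigma> > 0" and [measurable]: "A \<in> sets borel"
  shows "(\<integral>\<^sup>+x. ennreal (normal_density m \<sigma> x) * indicator A (x\<^sup>2) \<partial>lborel)
       = (\<integral>\<^sup>+t. ennreal (noncentral_gamma (1/2) (m\<^sup>2 / (2 * \<sigma>\<^sup>2)\<^sup>2) (2 * \<sigma>\<^sup>2) t) * indicator A t \<partial>lborel)"
proof -
  define c where "c = 2 * \<sigma>\<^sup>2"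
  define g where "g t = noncentral_gamma (1/2) (m\<^sup>2 / c\<^sup>2) c t * indicator A t" for t
  define h where "h x = ennreal (normal_density m \<sigma> x) * indicator A (x\<^sup>2)" for x
  have c: "c > 0" using assms by (simp add: c_def)
  have g_meas [measurable]: "g \<in> borel_measurable borel" unfolding g_def by measurable
  have h_meas [measurable]: "h \<in> borel_measurable borel" unfolding h_def by measurable
  have key: "g (x\<^sup>2) * (2 * x) = (normal_density m \<sigma> x + normal_density m \<sigma> (- x)) * indicator A (x\<^sup>2)"
    if "x > 0" for x
  proof -
    have p: "(x\<^sup>2) powr (1/2 - 1) = 1 / x"
      using that by (simp add: powr_minus_divide powr_half_sqrt)
    have s: "2 * sqrt (m\<^sup>2 * x\<^sup>2 / c\<^sup>2) = \<bar>2 * m * x / c\<bar>"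
      using that c by (simp add: real_sqrt_mult real_sqrt_divide abs_mult)
    have ch: "cosh \<bar>y\<bar> = cosh y" for y :: real by (auto simp: abs_if)
    have e: "exp (- (x\<^sup>2) / c) / exp (m\<^sup>2 / c\<^sup>2 * c) * cosh (2 * m * x / c) * 2
          = exp (- (x - m)\<^sup>2 / c) + exp (- (- x - m)\<^sup>2 / c)"
    proof -
      have "m\<^sup>2 / c\<^sup>2 * c = m\<^sup>2 / c" using c by (simp add: power2_eq_square)
      moreover have "- (x - m)\<^sup>2 / c = - (x\<^sup>2) / c - m\<^sup>2 / c + 2 * m * x / c"
        "- (- x - m)\<^sup>2 / c = - (x\<^sup>2) / c - m\<^sup>2 / c - 2 * m * x / c"
        by (simp_all add: power2_eq_square algebra_simps add_divide_distrib diff_divide_distrib)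
      moreover have "cosh y * 2 = exp y + exp (- y)" for y :: real by (simp add: cosh_field_def)
      ultimately show ?thesis
        by (simp add: exp_add exp_diff exp_minus mult.assoc) (simp add: divide_inverse ring_distribs mult_ac)
    qed
    have "noncentral_gamma (1/2) (m\<^sup>2 / c\<^sup>2) c (x\<^sup>2) * (2 * x)
       = (exp (- (x\<^sup>2) / c) / exp (m\<^sup>2 / c\<^sup>2 * c) * cosh (2 * m * x / c) * 2) / (sqrt pi * sqrt c)"
      unfolding noncentral_gamma_def phi01_kernel_def p
      using that c by (simp add: phi01_half s ch powr_half_sqrt del: abs_divide abs_mult) (simp add: mult_ac)
    also have "\<dots> = normal_density m \<sigma> x + normal_density m \<sigma> (- x)"
    proof -
      have "sqrt (2 * pi * \<sigma>\<^sup>2) = sqrt pi * sqrt c" by (simp add: c_def real_sqrt_mult)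
      then show ?thesis unfolding e by (simp add: normal_density_def c_def add_divide_distrib)
    qed
    finally show ?thesis by (simp add: g_def)
  qed
  have gt: "g t * indicator {0..} t = g t" for t
    by (auto simp: g_def indicator_def noncentral_gamma_def phi01_kernel_def)
  \<comment> \<open>The point 0 is dropped as a null set; then the negative half line is folded onto
    the positive one.\<close>
  have "(\<integral>\<^sup>+x. h x \<partial>lborel) = (\<integral>\<^sup>+x. h x * indicator {0<..} x + h x * indicator {..<0} x \<partial>lborel)"
    by (intro nn_integral_cong_AE AE_I[of _ _ "{0}"]) (auto simp: indicator_def)
  also have "\<dots> = (\<integral>\<^sup>+x. h x * indicator {0<..} x \<partial>lborel) + (\<integral>\<^sup>+x. h x * indicator {..<0} x \<partial>lborel)"
    by (rule nn_integral_add) auto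
  also have "(\<integral>\<^sup>+x. h x * indicator {..<0} x \<partial>lborel) = (\<integral>\<^sup>+x. h (- x) * indicator {0<..} x \<partial>lborel)"
    by (subst nn_integral_real_affine[where c = "-1" and t = 0])
      (auto intro!: nn_integral_cong simp: indicator_def)
  also have "(\<integral>\<^sup>+x. h x * indicator {0<..} x \<partial>lborel) + \<dots>
       = (\<integral>\<^sup>+x. (h x + h (- x)) * indicator {0<..} x \<partial>lborel)"
    by (subst nn_integral_add[symmetric]) (auto simp: distrib_right)
  also have "\<dots> = (\<integral>\<^sup>+x. ennreal (g (x\<^sup>2) * (2 * x) * indicator {0..} x) \<partial>lborel)"
  proof (intro nn_integral_cong)
    fix x :: real
    show "(h x + h (- x)) * indicator {0<..} x = ennreal (g (x\<^sup>2) * (2 * x) * indicator {0..} x)"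
    proof (cases "x > 0")
      case True
      then show ?thesis by (auto simp: key h_def indicator_def)
    qed (auto simp: indicator_def)
  qed
  also have "\<dots> = (\<integral>\<^sup>+t. ennreal (g t) \<partial>lborel)"
    by (subst nn_integral_square_substitution[symmetric]) (simp_all add: gt)
  also have "\<dots> = (\<integral>\<^sup>+t. ennreal (noncentral_gamma (1/2) (m\<^sup>2 / c\<^sup>2) c t) * indicator A t \<partial>lborel)"
    by (auto intro!: nn_integral_cong simp: g_def indicator_def)
  finally show ?thesis by (simp add: h_def c_def)
qed

section \<open>Noncentral gamma laws and their negatives as measures\<close>

definition gamma_measure :: "real \<Rightarrow> real \<Rightarrow> real \<Rightarrow> real measure" where
  "gamma_measure \<nu> \<theta> c = density lborel (\<lambda>t. ennreal (noncentral_gamma \<nu> \<theta> c t))"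

definition neg_gamma_measure :: "real \<Rightarrow> real \<Rightarrow> real \<Rightarrow> real measure" where
  "neg_gamma_measure \<nu> \<theta> c = density lborel (\<lambda>t. ennreal (noncentral_gamma \<nu> \<theta> c (- t)))"

lemma sets_gamma_measure [simp, measurable_cong]:
  "sets (gamma_measure \<nu> \<theta> c) = sets borel" "sets (neg_gamma_measure \<nu> \<theta> c) = sets borel"
  by (simp_all add: gamma_measure_def neg_gamma_measure_def)

lemma finite_gamma_measure:
  assumes "\<nu> > 0" "\<theta> \<ge> 0" "c > 0"
  shows "finite_measure (gamma_measure \<nu> \<theta> c)" "finite_measure (neg_gamma_measure \<nu> \<theta> c)"
proof -
  have "(\<integral>\<^sup>+t. ennreal (noncentral_gamma \<nu> \<theta> c (- t)) \<partial>lborel) = 1"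
    using nn_integral_real_affine[of "\<lambda>t. ennreal (noncentral_gamma \<nu> \<theta> c t)" "-1" 0]
      nn_integral_noncentral_gamma[OF assms] by simp
  then show "finite_measure (gamma_measure \<nu> \<theta> c)" "finite_measure (neg_gamma_measure \<nu> \<theta> c)"
    using nn_integral_noncentral_gamma[OF assms]
    by (auto intro!: finite_measureI simp: gamma_measure_def neg_gamma_measure_def emeasure_density)
qed

lemma convolution_gamma_measure:
  assumes "\<nu> > 0" "\<nu>' > 0" "\<theta> \<ge> 0" "\<theta>' \<ge> 0" "c > 0"
  shows "(gamma_measure \<nu> \<theta> c \<star> gamma_measure \<nu>' \<theta>' c) = gamma_measure (\<nu> + \<nu>') (\<theta> + \<theta>') c"
  using assms finite_gamma_measure[of \<nu> \<theta> c] finite_gamma_measure[of \<nu>' \<theta>' c]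
  unfolding gamma_measure_def
  by (subst convolution_density) (simp_all add: nn_integral_noncentral_gamma_convolution)

lemma convolution_neg_gamma_measure:
  assumes "\<nu> > 0" "\<nu>' > 0" "\<theta> \<ge> 0" "\<theta>' \<ge> 0" "c > 0"
  shows "(neg_gamma_measure \<nu> \<theta> c \<star> neg_gamma_measure \<nu>' \<theta>' c) = neg_gamma_measure (\<nu> + \<nu>') (\<theta> + \<theta>') c"
proof -
  have "(\<integral>\<^sup>+y. ennreal (noncentral_gamma \<nu> \<theta> c (y - x)) * ennreal (noncentral_gamma \<nu>' \<theta>' c (- y)) \<partial>lborel)
     = ennreal (noncentral_gamma (\<nu> + \<nu>') (\<theta> + \<theta>') c (- x))" for x
    using nn_integral_noncentral_gamma_convolution[OF assms, of "- x"]
      nn_integral_real_affine[of "\<lambda>y. ennreal (noncentral_gamma \<nu> \<theta> c (- x - y)) * ennreal (noncentral_gamma \<nu>' \<theta>' c y)" "-1" 0]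
    by simp
  then show ?thesis
    using assms finite_gamma_measure[of \<nu> \<theta> c] finite_gamma_measure[of \<nu>' \<theta>' c]
    unfolding neg_gamma_measure_def
    by (subst convolution_density) (simp_all add: nn_integral_noncentral_gamma_convolution)
qed

lemma distr_normal_square:
  assumes "\<sigma> > 0"
  shows "distr (density lborel (\<lambda>x. ennreal (normal_density m \<sigma> x))) borel (\<lambda>x. x\<^sup>2)
       = gamma_measure (1/2) (m\<^sup>2 / (2 * \<sigma>\<^sup>2)\<^sup>2) (2 * \<sigma>\<^sup>2)"
proof (rule measure_eqI)
  fix A assume "A \<in> sets (distr (density lborel (\<lambda>x. ennreal (normal_density m \<sigma> x))) borel (\<lambda>x. x\<^sup>2))"
  then have [measurable]: "A \<in> sets borel" by simp
  have "(\<lambda>x::real. x\<^sup>2) -` A \<in> sets borel" using measurable_sets_borel[of "\<lambda>x::real. x\<^sup>2" borel A] by simp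
  then show "emeasure (distr (density lborel (\<lambda>x. ennreal (normal_density m \<sigma> x))) borel (\<lambda>x. x\<^sup>2)) A
      = emeasure (gamma_measure (1/2) (m\<^sup>2 / (2 * \<sigma>\<^sup>2)\<^sup>2) (2 * \<sigma>\<^sup>2)) A"
    using nn_integral_normal_square[OF assms, of A m]
    by (simp add: emeasure_distr emeasure_density gamma_measure_def indicator_vimage[symmetric] indicator_def)
qed simp

lemma neg_gamma_measure_eq_distr: "neg_gamma_measure \<nu> \<theta> c = distr (gamma_measure \<nu> \<theta> c) borel uminus"
proof (rule measure_eqI)
  fix A assume "A \<in> sets (neg_gamma_measure \<nu> \<theta> c)"
  then have [measurable]: "A \<in> sets borel" by simp
  have m: "uminus -` A \<in> sets borel" using measurable_sets_borel[of "uminus::real\<Rightarrow>real" borel A] by simp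
  have "emeasure (neg_gamma_measure \<nu> \<theta> c) A
      = (\<integral>\<^sup>+t. ennreal (noncentral_gamma \<nu> \<theta> c (- t)) * indicator A t \<partial>lborel)"
    by (simp add: neg_gamma_measure_def emeasure_density)
  also have "\<dots> = (\<integral>\<^sup>+t. ennreal (noncentral_gamma \<nu> \<theta> c t) * indicator A (- t) \<partial>lborel)"
    by (subst nn_integral_real_affine[where c = "-1" and t = 0]) simp_all
  also have "\<dots> = emeasure (distr (gamma_measure \<nu> \<theta> c) borel uminus) A"
    using m by (simp add: emeasure_distr gamma_measure_def emeasure_density indicator_def)
  finally show "emeasure (neg_gamma_measure \<nu> \<theta> c) A = emeasure (distr (gamma_measure \<nu> \<theta> c) borel uminus) A" .
qed simp

section \<open>The law of a sum of products of normal variables\<close>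

text \<open>For the standardised deviations a and b the quadratic form in the exponent is diagonal
  in a + b and a - b; this is the independence of the half sum and the half difference. The factor 2
  is the reciprocal of the Jacobian of the map from (x, y) to (u, v).\<close>

lemma bivariate_normal_density_factor:
  assumes "\<sigma>X > 0" "\<sigma>Y > 0" "- 1 < \<rho>" "\<rho> < 1"
    and "s = \<sigma>X * \<sigma>Y" "p = \<mu>X / \<sigma>X + \<mu>Y / \<sigma>Y" "q = \<mu>X / \<sigma>X - \<mu>Y / \<sigma>Y"
  shows "normal_density (sqrt s * p / 2) (sqrt (s * (1 + \<rho>) / 2)) (sqrt s / 2 * (x / \<sigma>X + y / \<sigma>Y)) *
         normal_density (sqrt s * q / 2) (sqrt (s * (1 - \<rho>) / 2)) (sqrt s / 2 * (x / \<sigma>X - y / \<sigma>Y))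
       = 2 * bivariate_normal_density \<mu>X \<mu>Y \<sigma>X \<sigma>Y \<rho> x y"
proof -
  have s: "s > 0" using assms by simp
  define a b where "a = (x - \<mu>X) / \<sigma>X" and "b = (y - \<mu>Y) / \<sigma>Y"
  have 1: "sqrt s / 2 * (x / \<sigma>X + y / \<sigma>Y) - sqrt s * p / 2 = sqrt s / 2 * (a + b)"
    unfolding a_def b_def assms(6) by (simp add: diff_divide_distrib algebra_simps)
  have 2: "sqrt s / 2 * (x / \<sigma>X - y / \<sigma>Y) - sqrt s * q / 2 = sqrt s / 2 * (a - b)"
    unfolding a_def b_def assms(7) by (simp add: diff_divide_distrib algebra_simps)
  have v1: "(sqrt (s * (1 + \<rho>) / 2))\<^sup>2 = s * (1 + \<rho>) / 2" and v2: "(sqrt (s * (1 - \<rho>) / 2))\<^sup>2 = s * (1 - \<rho>) / 2"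
    using s assms by auto
  have e0: "- (sqrt s / 2 * z)\<^sup>2 / (2 * (s * d / 2)) = - (z\<^sup>2 / (4 * d))" for z d
    using s by (simp add: power_mult_distrib power_divide)
  note e1 = e0[of "a + b" "1 + \<rho>"] and e2 = e0[of "a - b" "1 - \<rho>"]
  have r: "1 - \<rho>\<^sup>2 = (1 + \<rho>) * (1 - \<rho>)" by (simp add: power2_eq_square algebra_simps)
  have "(a + b)\<^sup>2 / (4 * (1 + \<rho>)) + (a - b)\<^sup>2 / (4 * (1 - \<rho>))
      = ((a + b)\<^sup>2 * (1 - \<rho>) + (a - b)\<^sup>2 * (1 + \<rho>)) / (4 * ((1 + \<rho>) * (1 - \<rho>)))"
  proof -
    have "A / (4 * d) + B / (4 * e) = (A * e + B * d) / (4 * (d * e))" if "d \<noteq> 0" "e \<noteq> 0" for A B d e :: real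
      using that by (simp add: field_simps)
    from this[of "1 + \<rho>" "1 - \<rho>"] show ?thesis using assms by simp
  qed
  also have "(a + b)\<^sup>2 * (1 - \<rho>) + (a - b)\<^sup>2 * (1 + \<rho>) = 2 * (a\<^sup>2 - 2 * \<rho> * a * b + b\<^sup>2)"
    by (simp add: power2_eq_square algebra_simps)
  also have "2 * (a\<^sup>2 - 2 * \<rho> * a * b + b\<^sup>2) / (4 * ((1 + \<rho>) * (1 - \<rho>)))
      = (a\<^sup>2 - 2 * \<rho> * a * b + b\<^sup>2) / (2 * (1 - \<rho>\<^sup>2))"
    unfolding r by (metis (no_types) mult.assoc mult_divide_mult_cancel_left mult_2 numeral_Bit0 zero_neq_numeral one_add_one distrib_right)
  finally have e: "- ((a + b)\<^sup>2 / (4 * (1 + \<rho>))) + - ((a - b)\<^sup>2 / (4 * (1 - \<rho>)))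
      = - (a\<^sup>2 - 2 * \<rho> * a * b + b\<^sup>2) / (2 * (1 - \<rho>\<^sup>2))"
    by (simp only: minus_divide_left[symmetric] minus_add_distrib[symmetric])
  have "sqrt (2 * pi * (s * (1 + \<rho>) / 2)) * sqrt (2 * pi * (s * (1 - \<rho>) / 2))
      = sqrt (pi\<^sup>2 * s\<^sup>2 * (1 - \<rho>\<^sup>2))"
  proof -
    have "(2 * pi * (s * (1 + \<rho>) / 2)) * (2 * pi * (s * (1 - \<rho>) / 2)) = pi\<^sup>2 * s\<^sup>2 * (1 - \<rho>\<^sup>2)"
      by (simp add: power2_eq_square field_simps)
    then show ?thesis by (metis real_sqrt_mult)
  qed
  also have "\<dots> = pi * s * sqrt (1 - \<rho>\<^sup>2)"
    using s by (simp add: real_sqrt_mult)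
  finally have n: "1 / sqrt (2 * pi * (s * (1 + \<rho>) / 2)) * (1 / sqrt (2 * pi * (s * (1 - \<rho>) / 2)))
      = 2 * (1 / (2 * pi * \<sigma>X * \<sigma>Y * sqrt (1 - \<rho>\<^sup>2)))"
    by (simp only: times_divide_times_eq) (simp add: assms(5) mult_ac)
  have arr: "(A * E) * (B * F) = 2 * (D * (E * F))" if "A * B = 2 * D" for A B D E F :: real
  proof -
    have "(A * E) * (B * F) = (A * B) * (E * F)" by (simp only: mult_ac)
    then show ?thesis using that by simp
  qed
  show ?thesis
    unfolding normal_density_def bivariate_normal_density_def v1 v2 1 2 e1 e2 a_def[symmetric] b_def[symmetric]
      e[symmetric] exp_add
    by (rule arr[OF n])
qed

lemma measurable_bivariate_normal_density [measurable]:
  "(\<lambda>z. bivariate_normal_density \<mu>X \<mu>Y \<sigma>X \<sigma>Y \<rho> (fst z) (snd z)) \<in> borel_measurable (lborel \<Otimes>\<^sub>M lborel)"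
  unfolding bivariate_normal_density_def by measurable

text \<open>The linear map is split into two substitutions in one variable,
  \<open>v = u - k * y\<close> and \<open>u = k * y / 2 + l * x\<close>, with Tonelli's theorem
  between them. Their combined Jacobian is \<open>k * l = 1/2\<close>.\<close>

lemma nn_integral_rotate_bivariate:
  fixes h :: "real \<Rightarrow> real \<Rightarrow> ennreal"
  assumes [measurable]: "case_prod h \<in> borel_measurable (borel \<Otimes>\<^sub>M borel)"
    and "\<sigma>X > 0" "\<sigma>Y > 0" "s = \<sigma>X * \<sigma>Y"
  shows "(\<integral>\<^sup>+u. \<integral>\<^sup>+v. h u v \<partial>lborel \<partial>lborel)
     = ennreal (1/2) * (\<integral>\<^sup>+x. \<integral>\<^sup>+y. h (sqrt s / 2 * (x / \<sigma>X + y / \<sigma>Y)) (sqrt s / 2 * (x / \<sigma>X - y / \<sigma>Y)) \<partial>lborel \<partial>lborel)"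
proof -
  define k where "k = sqrt s / \<sigma>Y"
  define l where "l = sqrt s / (2 * \<sigma>X)"
  have k: "k > 0" and l: "l > 0" using assms by (auto simp: k_def l_def)
  have kl: "k * l = 1/2" using assms by (simp add: k_def l_def)
  have 1: "(\<integral>\<^sup>+v. h u v \<partial>lborel) = ennreal k * (\<integral>\<^sup>+y. h u (u - k * y) \<partial>lborel)" for u
    using k nn_integral_real_affine[of "h u" "- k" u] by simp
  have 2: "(\<integral>\<^sup>+u. h u (u - k * y) \<partial>lborel) = ennreal l * (\<integral>\<^sup>+x. h (k * y / 2 + l * x) (k * y / 2 + l * x - k * y) \<partial>lborel)" for y
    using l nn_integral_real_affine[of "\<lambda>u. h u (u - k * y)" l "k * y / 2"] by simp
  have "(\<integral>\<^sup>+u. \<integral>\<^sup>+v. h u v \<partial>lborel \<partial>lborel) = ennreal k * (\<integral>\<^sup>+u. \<integral>\<^sup>+y. h u (u - k * y) \<partial>lborel \<partial>lborel)"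
    unfolding 1 by (rule nn_integral_cmult) measurable
  also have "(\<integral>\<^sup>+u. \<integral>\<^sup>+y. h u (u - k * y) \<partial>lborel \<partial>lborel) = (\<integral>\<^sup>+y. \<integral>\<^sup>+u. h u (u - k * y) \<partial>lborel \<partial>lborel)"
    by (rule lborel_pair.Fubini') measurable
  also have "\<dots> = ennreal l * (\<integral>\<^sup>+y. \<integral>\<^sup>+x. h (k * y / 2 + l * x) (k * y / 2 + l * x - k * y) \<partial>lborel \<partial>lborel)"
    unfolding 2 by (rule nn_integral_cmult) measurable
  also have "(\<integral>\<^sup>+y. \<integral>\<^sup>+x. h (k * y / 2 + l * x) (k * y / 2 + l * x - k * y) \<partial>lborel \<partial>lborel)
      = (\<integral>\<^sup>+x. \<integral>\<^sup>+y. h (k * y / 2 + l * x) (k * y / 2 + l * x - k * y) \<partial>lborel \<partial>lborel)"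
    by (rule lborel_pair.Fubini') measurable
  also have "(\<lambda>x y. h (k * y / 2 + l * x) (k * y / 2 + l * x - k * y))
      = (\<lambda>x y. h (sqrt s / 2 * (x / \<sigma>X + y / \<sigma>Y)) (sqrt s / 2 * (x / \<sigma>X - y / \<sigma>Y)))"
    by (intro ext arg_cong2[where f = h]) (simp_all add: k_def l_def algebra_simps)
  finally show ?thesis
    using k l by (simp add: mult.assoc[symmetric] ennreal_mult'[symmetric] kl)
qed

text \<open>The half sum has mean \<open>sqrt s * p / 2\<close> and variance
  \<open>s * (1 + \<rho>) / 2\<close>, so its square is noncentral gamma with scale
  \<open>s * (1 + \<rho>)\<close>; likewise for the half difference with q and 1 - \<rho>. The two
  measures are compared by integrating the indicator of a set in both coordinate systems.\<close>

lemma distr_product_bivariate_normal: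
  assumes "\<sigma>X > 0" "\<sigma>Y > 0" "- 1 < \<rho>" "\<rho> < 1"
    and "s = \<sigma>X * \<sigma>Y" "p = \<mu>X / \<sigma>X + \<mu>Y / \<sigma>Y" "q = \<mu>X / \<sigma>X - \<mu>Y / \<sigma>Y"
    and "bivariate_normal N X Y \<mu>X \<mu>Y \<sigma>X \<sigma>Y \<rho>"
  shows "distr N borel (\<lambda>\<omega>. X \<omega> * Y \<omega>)
       = (gamma_measure (1/2) (p\<^sup>2 / (4 * (1 + \<rho>)\<^sup>2 * s)) (s * (1 + \<rho>)) \<star>
          neg_gamma_measure (1/2) (q\<^sup>2 / (4 * (1 - \<rho>)\<^sup>2 * s)) (s * (1 - \<rho>)))" (is "?L = (?A \<star> ?B)")
proof (rule measure_eqI)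
  have s: "s > 0" using assms by simp
  have D: "distributed N (lborel \<Otimes>\<^sub>M lborel) (\<lambda>\<omega>. (X \<omega>, Y \<omega>))
       (\<lambda>z. ennreal (bivariate_normal_density \<mu>X \<mu>Y \<sigma>X \<sigma>Y \<rho> (fst z) (snd z)))"
    using assms(8) unfolding bivariate_normal_def by (simp add: case_prod_unfold)
  have XY: "(\<lambda>\<omega>. X \<omega> * Y \<omega>) \<in> borel_measurable N"
    using measurable_compose[OF distributed_measurable[OF D], of "\<lambda>z. fst z * snd z" borel] by simp
  define f1 where "f1 = normal_density (sqrt s * p / 2) (sqrt (s * (1 + \<rho>) / 2))"
  define f2 where "f2 = normal_density (sqrt s * q / 2) (sqrt (s * (1 - \<rho>) / 2))"
  have [measurable]: "f1 \<in> borel_measurable borel" "f2 \<in> borel_measurable borel"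
    by (simp_all add: f1_def f2_def)
  have f_nonneg: "f1 u \<ge> 0" "f2 u \<ge> 0" for u by (simp_all add: f1_def f2_def)
  have sd: "sqrt (s * (1 + \<rho>) / 2) > 0" "sqrt (s * (1 - \<rho>) / 2) > 0" using s assms by auto
  \<comment> \<open>The parameters that \<open>distr_normal_square\<close> yields for mean
    \<open>sqrt s * w / 2\<close> and variance \<open>s * d / 2\<close>.\<close>
  have par: "(sqrt s * w / 2)\<^sup>2 / (2 * (sqrt (s * d / 2))\<^sup>2)\<^sup>2 = w\<^sup>2 / (4 * d\<^sup>2 * s)"
    "2 * (sqrt (s * d / 2))\<^sup>2 = s * d" if "d > 0" for w d
  proof -
    show 1: "2 * (sqrt (s * d / 2))\<^sup>2 = s * d" using s that by simp
    have "(sqrt s * w / 2)\<^sup>2 = s * w\<^sup>2 / 4" using s by (simp add: power_mult_distrib power_divide)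
    then show "(sqrt s * w / 2)\<^sup>2 / (2 * (sqrt (s * d / 2))\<^sup>2)\<^sup>2 = w\<^sup>2 / (4 * d\<^sup>2 * s)"
      unfolding 1 using s that by (simp add: power_mult_distrib field_simps power2_eq_square)
  qed
  have A: "?A = distr (density lborel (\<lambda>x. ennreal (f1 x))) borel (\<lambda>x. x\<^sup>2)"
    unfolding f1_def distr_normal_square[OF sd(1)] by (subst par, use assms in simp)+ (rule refl)
  have B: "?B = distr (distr (density lborel (\<lambda>x. ennreal (f2 x))) borel (\<lambda>x. x\<^sup>2)) borel uminus"
    unfolding f2_def distr_normal_square[OF sd(2)] neg_gamma_measure_eq_distr
    by (subst par, use assms in simp)+ (rule refl)
  have fin: "finite_measure ?A" "finite_measure ?B"
    using s assms by (auto intro!: finite_gamma_measure)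
  fix S assume "S \<in> sets ?L"
  then have [measurable]: "S \<in> sets borel" by simp
  have "emeasure (?A \<star> ?B) S = (\<integral>\<^sup>+z. indicator S z \<partial>(?A \<star> ?B))"
    by (rule nn_integral_indicator[symmetric]) simp
  also have "\<dots> = (\<integral>\<^sup>+a. \<integral>\<^sup>+b. indicator S (a + b) \<partial>?B \<partial>?A)"
    using fin by (intro nn_integral_convolution) auto
  also have "\<dots> = (\<integral>\<^sup>+u. \<integral>\<^sup>+v. ennreal (f1 u * f2 v) * indicator S (u\<^sup>2 - v\<^sup>2) \<partial>lborel \<partial>lborel)"
    unfolding A B
    by (subst nn_integral_distr, simp, measurable)
       (simp add: nn_integral_distr nn_integral_density nn_integral_cmult[symmetric] ennreal_mult f_nonneg mult.assoc)
  also have "\<dots> = ennreal (1/2) * (\<integral>\<^sup>+x. \<integral>\<^sup>+y. ennreal (2 * bivariate_normal_density \<mu>X \<mu>Y \<sigma>X \<sigma>Y \<rho> x y) * indicator S (x * y) \<partial>lborel \<partial>lborel)"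
  proof -
    have "(sqrt s / 2 * (x / \<sigma>X + y / \<sigma>Y))\<^sup>2 - (sqrt s / 2 * (x / \<sigma>X - y / \<sigma>Y))\<^sup>2 = x * y" for x y
    proof -
      have "(sqrt s / 2 * (x / \<sigma>X + y / \<sigma>Y))\<^sup>2 - (sqrt s / 2 * (x / \<sigma>X - y / \<sigma>Y))\<^sup>2
          = s / 4 * ((x / \<sigma>X + y / \<sigma>Y)\<^sup>2 - (x / \<sigma>X - y / \<sigma>Y)\<^sup>2)"
        unfolding power_mult_distrib using s by (simp add: power_divide right_diff_distrib)
      also have "\<dots> = s * (x / \<sigma>X) * (y / \<sigma>Y)" by (simp add: power2_eq_square algebra_simps)
      finally show ?thesis using assms by simp
    qed
    then show ?thesis
      by (subst nn_integral_rotate_bivariate[OF _ assms(1,2,5)], measurable)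
         (simp only: f1_def f2_def bivariate_normal_density_factor[OF assms(1-7)])
  qed
  also have "\<dots> = (\<integral>\<^sup>+x. \<integral>\<^sup>+y. ennreal (bivariate_normal_density \<mu>X \<mu>Y \<sigma>X \<sigma>Y \<rho> x y) * indicator S (x * y) \<partial>lborel \<partial>lborel)"
  proof -
    have [measurable]: "(\<lambda>z. bivariate_normal_density \<mu>X \<mu>Y \<sigma>X \<sigma>Y \<rho> (fst z) (snd z)) \<in> borel_measurable (borel \<Otimes>\<^sub>M borel)"
      unfolding bivariate_normal_density_def by measurable
    define D where "D x y = ennreal (bivariate_normal_density \<mu>X \<mu>Y \<sigma>X \<sigma>Y \<rho> x y) * indicator S (x * y)" for x y
    have [measurable]: "case_prod D \<in> borel_measurable (borel \<Otimes>\<^sub>M borel)"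
      unfolding D_def case_prod_unfold by measurable
    have "ennreal (2 * d) * i = ennreal 2 * (ennreal d * i)" for d i by (simp add: ennreal_mult' mult.assoc)
    then have "(\<integral>\<^sup>+x. \<integral>\<^sup>+y. ennreal (2 * bivariate_normal_density \<mu>X \<mu>Y \<sigma>X \<sigma>Y \<rho> x y) * indicator S (x * y) \<partial>lborel \<partial>lborel)
        = (\<integral>\<^sup>+x. \<integral>\<^sup>+y. ennreal 2 * D x y \<partial>lborel \<partial>lborel)"
      by (simp only: D_def)
    also have "\<dots> = ennreal 2 * (\<integral>\<^sup>+x. \<integral>\<^sup>+y. D x y \<partial>lborel \<partial>lborel)"
      by (subst nn_integral_cmult, measurable)+
    finally have "ennreal (1/2) * (\<integral>\<^sup>+x. \<integral>\<^sup>+y. ennreal (2 * bivariate_normal_density \<mu>X \<mu>Y \<sigma>X \<sigma>Y \<rho> x y) * indicator S (x * y) \<partial>lborel \<partial>lborel)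
        = ennreal (1/2 * 2) * (\<integral>\<^sup>+x. \<integral>\<^sup>+y. D x y \<partial>lborel \<partial>lborel)"
      by (subst ennreal_mult') (simp_all only: mult.assoc)
    then show ?thesis by (simp add: D_def)
  qed
  also have "\<dots> = (\<integral>\<^sup>+z. ennreal (bivariate_normal_density \<mu>X \<mu>Y \<sigma>X \<sigma>Y \<rho> (fst z) (snd z)) * indicator S (fst z * snd z) \<partial>(lborel \<Otimes>\<^sub>M lborel))"
    by (subst lborel.nn_integral_fst[symmetric]) simp_all
  also have "\<dots> = (\<integral>\<^sup>+\<omega>. indicator S (fst (X \<omega>, Y \<omega>) * snd (X \<omega>, Y \<omega>)) \<partial>N)"
    by (rule distributed_nn_integral[OF D]) measurable
  also have "\<dots> = emeasure ?L S"
    using XY by (simp add: nn_integral_indicator[symmetric] nn_integral_distr del: nn_integral_indicator)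
  finally show "emeasure ?L S = emeasure (?A \<star> ?B) S" by simp
qed simp

text \<open>Both families are closed under convolution with additive parameters, because all
  summands share the scales c and c'. The induction step rearranges four factors until equal kinds
  are adjacent.\<close>

lemma (in prob_space) distr_sum_gamma_measures:
  fixes Z :: "nat \<Rightarrow> 'a \<Rightarrow> real"
  assumes "m \<ge> 1" "indep_vars (\<lambda>_. borel) Z {1..m}"
    and "\<And>i. i \<in> {1..m} \<Longrightarrow> distr M borel (Z i) = (gamma_measure (1/2) \<theta> c \<star> neg_gamma_measure (1/2) \<theta>' c')"
    and pos: "\<theta> \<ge> 0" "\<theta>' \<ge> 0" "c > 0" "c' > 0"
  shows "distr M borel (\<lambda>\<omega>. \<Sum>i = 1..m. Z i \<omega>)
       = (gamma_measure (real m / 2) (real m * \<theta>) c \<star> neg_gamma_measure (real m / 2) (real m * \<theta>') c')"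
  using assms(1-3)
proof (induction m rule: dec_induct)
  case base
  then show ?case by simp
next
  case (step m)
  let ?A = "gamma_measure (real m / 2) (real m * \<theta>) c" and ?B = "neg_gamma_measure (real m / 2) (real m * \<theta>') c'"
  let ?A1 = "gamma_measure (1/2) \<theta> c" and ?B1 = "neg_gamma_measure (1/2) \<theta>' c'"
  note [simp] = finite_gamma_measure convolution_finite
  have m: "real m > 0" using step by simp
  have ind: "indep_vars (\<lambda>_. borel) Z {1..m}" using step.prems(1) by (rule indep_vars_subset) auto
  have IH: "distr M borel (\<lambda>\<omega>. \<Sum>i = 1..m. Z i \<omega>) = (?A \<star> ?B)"
    using step.IH[OF ind] step.prems(2) by auto
  have Zm [measurable]: "random_variable borel (Z i)" if "i \<in> {1..Suc m}" for i
    using step.prems(1) that by (auto simp: indep_vars_def)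
  have [measurable]: "random_variable borel (\<lambda>\<omega>. \<Sum>i = 1..m. Z i \<omega>)" by measurable
  have iv: "indep_var borel (Z (Suc m)) borel (\<lambda>\<omega>. \<Sum>i = 1..m. Z i \<omega>)"
    by (rule indep_vars_sum) (use step.prems(1) in \<open>auto simp: atLeastAtMostSuc_conv\<close>)
  have "distr M borel (\<lambda>\<omega>. \<Sum>i = 1..Suc m. Z i \<omega>) = distr M borel (\<lambda>\<omega>. Z (Suc m) \<omega> + (\<Sum>i = 1..m. Z i \<omega>))"
    by (simp add: atLeastAtMostSuc_conv)
  also have "\<dots> = ((?A1 \<star> ?B1) \<star> (?A \<star> ?B))"
    using sum_indep_random_variable[OF iv] step.prems(2)[of "Suc m"] IH by simp
  also have "\<dots> = (((?A1 \<star> ?B1) \<star> ?A) \<star> ?B)"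
    using pos m by (intro convolution_associative) auto
  also have "((?A1 \<star> ?B1) \<star> ?A) = (?A \<star> (?A1 \<star> ?B1))"
    using pos m by (intro convolution_commutative) auto
  also have "\<dots> = ((?A \<star> ?A1) \<star> ?B1)"
    using pos m by (intro convolution_associative) auto
  also have "(\<dots> \<star> ?B) = ((?A \<star> ?A1) \<star> (?B1 \<star> ?B))"
    using pos m by (intro convolution_associative[symmetric]) auto
  also have "(?A \<star> ?A1) = gamma_measure (real (Suc m) / 2) (real (Suc m) * \<theta>) c"
    using pos m by (subst convolution_gamma_measure) (simp_all add: algebra_simps add_divide_distrib)
  also have "(?B1 \<star> ?B) = neg_gamma_measure (real (Suc m) / 2) (real (Suc m) * \<theta>') c'"
    using pos m by (subst convolution_neg_gamma_measure) (simp_all add: algebra_simps add_divide_distrib)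
  finally show ?case .
qed

text \<open>Densities of one measure agree up to a null set only. Continuity turns this into
  pointwise estimates at the very end.\<close>

lemma convolution_gamma_measures_density:
  assumes "\<nu> > 0" "\<theta> \<ge> 0" "\<theta>' \<ge> 0" "c > 0" "c' > 0"
    and [measurable]: "f \<in> borel_measurable borel"
    and "density lborel f = (gamma_measure \<nu> \<theta> c \<star> neg_gamma_measure \<nu> \<theta>' c')"
  shows "AE x in lborel. f x = (\<integral>\<^sup>+t. ennreal (noncentral_gamma \<nu> \<theta> c (x + t)) * ennreal (noncentral_gamma \<nu> \<theta>' c' t) \<partial>lborel)"
proof -
  let ?g = "\<lambda>x. \<integral>\<^sup>+t. ennreal (noncentral_gamma \<nu> \<theta> c (x + t)) * ennreal (noncentral_gamma \<nu> \<theta>' c' t) \<partial>lborel"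
  have "(\<integral>\<^sup>+y. ennreal (noncentral_gamma \<nu> \<theta> c (x - y)) * ennreal (noncentral_gamma \<nu> \<theta>' c' (- y)) \<partial>lborel) = ?g x" for x
    by (subst nn_integral_real_affine[where c = "-1" and t = 0]) simp_all
  then have "density lborel f = density lborel ?g"
    using assms finite_gamma_measure[of \<nu> \<theta> c] finite_gamma_measure[of \<nu> \<theta>' c']
    unfolding gamma_measure_def neg_gamma_measure_def
    by (subst (asm) convolution_density) simp_all
  then show ?thesis
    by (intro sigma_finite_measure.density_unique[OF sigma_finite_lborel]) simp_all
qed

text \<open>Allows the asymptotic analysis to be done for s = 1; the factor s returns in
  \<open>nn_integral_rescaled_gamma_difference\<close> and
  \<open>poincare_expansion_rescale\<close>.\<close>

lemma noncentral_gamma_scale: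
  assumes "s > 0" "c > 0"
  shows "noncentral_gamma \<nu> (\<theta> / s) (s * c) t = noncentral_gamma \<nu> \<theta> c (t / s) / s"
proof (cases "t > 0")
  case True
  have "(t / s) powr (\<nu> - 1) / s = t powr (\<nu> - 1) / s powr \<nu>"
    using True assms by (simp add: powr_divide powr_diff)
  then have "(t / s) powr (\<nu> - 1) = t powr (\<nu> - 1) * s / s powr \<nu>"
    using assms by (simp add: field_simps)
  then show ?thesis using True assms
    by (simp add: noncentral_gamma_def phi01_kernel_def powr_mult field_simps)
qed (use assms in \<open>simp add: noncentral_gamma_def phi01_kernel_def zero_less_divide_iff\<close>)

section \<open>Puiseux coefficients\<close>

text \<open>An identity theorem with data on one side of 0. Once the earlier coefficients vanish,
  the series may be divided by \<open>w ^ j\<close>, as w > 0, and w sent to 0. Convergence at a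
  single positive point already gives continuity at 0.\<close>

lemma powser_eventually_zero_imp_coeff_zero:
  fixes c :: "nat \<Rightarrow> real"
  assumes "\<forall>\<^sub>F w in at_right 0. (\<lambda>j. c j * w ^ j) sums 0"
  shows "c j = 0"
proof (induction j rule: less_induct)
  case (less j)
  obtain e where e: "e > 0" "\<And>w. w > 0 \<Longrightarrow> w < e \<Longrightarrow> (\<lambda>j. c j * w ^ j) sums 0"
    using assms by (auto simp: eventually_at_right_field)
  define h where "h w = (\<Sum>n. c (n + j) * w ^ n)" for w
  have shift: "(\<lambda>n. c (n + j) * w ^ n) sums 0" if "w > 0" "w < e" for w
  proof -
    have "(\<lambda>n. c (n + j) * w ^ (n + j)) sums (0 - (\<Sum>i<j. c i * w ^ i))"
      using sums_split_initial_segment[OF e(2)[OF that]] .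
    then have "(\<lambda>n. (c (n + j) * w ^ (n + j)) / w ^ j) sums ((0 - (\<Sum>i<j. c i * w ^ i)) / w ^ j)"
      by (rule sums_divide)
    then show ?thesis using that less by (simp add: power_add)
  qed
  have "isCont h 0"
    unfolding h_def by (rule isCont_powser[of _ "e/2"]) (use shift[of "e/2"] e(1) in \<open>auto simp: sums_iff\<close>)
  then have "(h \<longlongrightarrow> h 0) (at_right 0)"
    unfolding isCont_def by (rule tendsto_mono[OF at_le, rotated]) simp
  moreover have "\<forall>\<^sub>F w in at_right 0. h w = 0"
    unfolding eventually_at_right_field using e(1) shift by (intro exI[of _ e]) (auto simp: h_def sums_iff)
  then have "(h \<longlongrightarrow> 0) (at_right 0)" by (rule tendsto_eventually)
  ultimately have "h 0 = 0" by (intro tendsto_unique[OF trivial_limit_at_right_real])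
  then show ?case using powser_zero[of "\<lambda>n. c (n + j)"] by (simp add: h_def)
qed

text \<open>From m to m + 1 the left side grows by \<open>\<bar>x - m\<bar> / (m + 1)\<close>, the
  binomial coefficient (k + m choose m) by (k + m + 1) / (m + 1). The crude factor
  \<open>2 ^ m\<close> is the origin of the condition
  \<open>2 * \<bar>u\<bar> * w\<^sup>2 < 1\<close> below.\<close>

lemma abs_gbinomial_le:
  fixes x :: real
  assumes "\<bar>x\<bar> \<le> real k"
  shows "\<bar>x gchoose m\<bar> \<le> 2 ^ (k + m)"
proof -
  have "\<bar>x gchoose m\<bar> \<le> real ((k + m) choose m)"
  proof (induction m)
    case (Suc m)
    have 1: "(x gchoose Suc m) = (x gchoose m) * (x - real m) / real (Suc m)"
      by (simp add: gbinomial_prod_rev atLeast0_lessThan_Suc field_simps)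
    have "real (Suc m) * real ((k + Suc m) choose Suc m) = real (k + Suc m) * real ((k + m) choose m)"
    proof -
      have "Suc m * ((k + Suc m) choose Suc m) = (k + Suc m) * ((k + m) choose m)"
        using Suc_times_binomial_eq[of "k + m" m] by (simp only: add_Suc_right mult.commute)
      then show ?thesis by (metis of_nat_mult)
    qed
    then have 2: "real ((k + Suc m) choose Suc m) = real ((k + m) choose m) * real (k + Suc m) / real (Suc m)"
      by (simp add: field_simps)
    have "\<bar>x gchoose m\<bar> * \<bar>x - real m\<bar> \<le> real ((k + m) choose m) * real (k + Suc m)"
      by (rule mult_mono[OF Suc.IH]) (use assms in auto)
    then show ?case
      unfolding 1 2 by (simp only: abs_mult abs_divide abs_of_nat) (rule divide_right_mono, auto)
  qed simp
  also have "real ((k + m) choose m) \<le> 2 ^ (k + m)"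
    using binomial_le_pow2[of "k + m" m] by (metis of_nat_le_iff of_nat_numeral of_nat_power)
  finally show ?thesis .
qed

text \<open>The coefficient of x^m in (sqrt (1 + x) - 1)^r (1 + x)^a; it vanishes for m < r.\<close>

definition sqrt_coeff :: "real \<Rightarrow> nat \<Rightarrow> nat \<Rightarrow> real" where
  "sqrt_coeff a r m = (\<Sum>l\<le>r. real (r choose l) * (- 1) ^ (r - l) * ((a + real l / 2) gchoose m))"

lemma fps_binomial_power: "fps_binomial (c::real) ^ l = fps_binomial (real l * c)"
  by (induction l) (simp_all add: fps_binomial_0 fps_binomial_add_mult[symmetric] algebra_simps)

text \<open>The alternating sum hides its vanishing for m < r. As formal power series it is plain:
  sqrt (1 + x) - 1 has no constant term, so its r-th power starts at \<open>x ^ r\<close>.\<close>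

lemma sqrt_coeff_fps: "sqrt_coeff a r m = fps_nth ((fps_binomial (1/2) - 1) ^ r * fps_binomial a) m"
proof -
  have "(fps_binomial (1/2) - 1) ^ r * fps_binomial a
      = (\<Sum>l\<le>r. of_nat (r choose l) * fps_binomial (1/2) ^ l * (- 1) ^ (r - l)) * fps_binomial a"
    using binomial_ring[of "fps_binomial (1/2::real)" "- 1" r] by simp
  also have "\<dots> = (\<Sum>l\<le>r. fps_const (real (r choose l) * (- 1) ^ (r - l)) * fps_binomial (a + real l / 2))"
    unfolding sum_distrib_right
  proof (intro sum.cong refl)
    fix l
    have "(- 1 :: real fps) ^ (r - l) = fps_const ((- 1) ^ (r - l))"
      by (simp add: fps_const_power[symmetric] fps_const_neg[symmetric])
    then show "of_nat (r choose l) * fps_binomial (1/2) ^ l * (- 1) ^ (r - l) * fps_binomial a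
        = fps_const (real (r choose l) * (- 1) ^ (r - l)) * fps_binomial (a + real l / 2)"
      by (simp add: fps_binomial_power fps_binomial_add_mult fps_of_nat[symmetric] fps_const_mult[symmetric] mult_ac
          del: fps_const_mult)
  qed
  finally show ?thesis by (simp add: sqrt_coeff_def fps_sum_nth mult.assoc)
qed

lemma sqrt_coeff_eq_0: "m < r \<Longrightarrow> sqrt_coeff a r m = 0"
  unfolding sqrt_coeff_fps fps_mult_nth
  by (intro sum.neutral ballI) (simp add: startsby_zero_power_prefix)

text \<open>One factor \<open>2 ^ r\<close> is the sum of the binomial coefficients, the other comes
  from \<open>abs_gbinomial_le\<close>, since |a + l / 2| is at most the ceiling of |a| plus
  r.\<close>

lemma abs_sqrt_coeff_le: "\<bar>sqrt_coeff a r m\<bar> \<le> 2 ^ nat \<lceil>\<bar>a\<bar>\<rceil> * 4 ^ r * 2 ^ m"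
proof -
  have "\<bar>sqrt_coeff a r m\<bar> \<le> (\<Sum>l\<le>r. real (r choose l) * 2 ^ (nat \<lceil>\<bar>a\<bar>\<rceil> + r + m))"
    unfolding sqrt_coeff_def
  proof (rule order.trans[OF sum_abs sum_mono])
    fix l assume l: "l \<in> {..r}"
    have "\<bar>(a + real l / 2) gchoose m\<bar> \<le> 2 ^ (nat \<lceil>\<bar>a\<bar>\<rceil> + r + m)"
      by (rule abs_gbinomial_le) (use l in \<open>simp add: abs_le_iff; linarith\<close>)
    then show "\<bar>real (r choose l) * (- 1) ^ (r - l) * ((a + real l / 2) gchoose m)\<bar>
        \<le> real (r choose l) * 2 ^ (nat \<lceil>\<bar>a\<bar>\<rceil> + r + m)"
      by (simp add: abs_mult power_abs mult_left_mono)
  qed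
  also have "\<dots> = 2 ^ nat \<lceil>\<bar>a\<bar>\<rceil> * (2 * 2) ^ r * 2 ^ m"
    unfolding sum_distrib_right[symmetric] of_nat_sum[symmetric] choose_row_sum
    by (simp only: power_add power_mult_distrib of_nat_power of_nat_numeral mult_ac)
  finally show ?thesis by simp
qed

text \<open>The general term of the double expansion with w for the square root of y: r indexes the
  exponential series, m the powers of \<open>u * w\<^sup>2\<close>.\<close>

definition puiseux_term :: "real \<Rightarrow> real \<Rightarrow> real \<Rightarrow> real \<Rightarrow> nat \<times> nat \<Rightarrow> real" where
  "puiseux_term a b u w = (\<lambda>(r, m). (b / w) ^ r / fact r * sqrt_coeff a r m * (u * w\<^sup>2) ^ m)"

lemma has_sum_exp: "((\<lambda>n. x ^ n / fact n) has_sum exp (x::real)) UNIV"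
proof (rule norm_summable_imp_has_sum)
  show "summable (\<lambda>n. norm (x ^ n / fact n))"
    using summable_norm_exp[of x] by (simp add: divide_inverse mult.commute)
  show "(\<lambda>n. x ^ n / fact n) sums exp x"
    using exp_converges[of x] by (simp add: divide_inverse mult.commute)
qed

lemma sqrt_power_eq_powr: "x > 0 \<Longrightarrow> sqrt x ^ l = x powr (real l / 2)"
proof -
  assume x: "x > 0"
  have "sqrt x ^ l = (sqrt x) powr real l" using x by (simp add: powr_realpow)
  also have "\<dots> = (x powr (1/2)) powr real l" using x powr_half_sqrt[of x] by simp
  also have "\<dots> = x powr (real l / 2)" unfolding powr_powr by simp
  finally show ?thesis .
qed

lemma has_sum_gbinomial:
  fixes x :: real
  assumes "\<bar>x\<bar> < 1"
  shows "((\<lambda>m. (a gchoose m) * x ^ m) has_sum (1 + x) powr a) UNIV"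
proof (rule norm_summable_imp_has_sum)
  define y where "y = (\<bar>x\<bar> + 1) / 2"
  have y: "\<bar>x\<bar> < y" "y < 1" using assms by (auto simp: y_def)
  have "summable (\<lambda>m. (a gchoose m) * y ^ m)"
    using gen_binomial_real[of y a] y by (auto simp: sums_iff)
  then show "summable (\<lambda>m. norm ((a gchoose m) * x ^ m))"
    by (rule powser_insidea) (use y in auto)
  show "(\<lambda>m. (a gchoose m) * x ^ m) sums (1 + x) powr a"
    by (rule gen_binomial_real) fact
qed

text \<open>The bound on \<open>sqrt_coeff\<close> separates the variables: an exponential series in
  r with the factor 4 and a geometric series in m with the factor 2. The bound explodes as w tends
  to 0, which is harmless: \<open>puiseux_remainder_sqrt\<close> uses it only at a point of order 1
  / sqrt (1 + t).\<close>

lemma puiseux_majorant: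
  assumes "w > 0" "2 * \<bar>u\<bar> * w\<^sup>2 < 1"
  obtains B where "((\<lambda>p. \<bar>puiseux_term a b u w p\<bar>) has_sum B) (UNIV \<times> UNIV)"
    and "B \<le> 2 ^ nat \<lceil>\<bar>a\<bar>\<rceil> * exp (4 * \<bar>b\<bar> / w) / (1 - 2 * \<bar>u\<bar> * w\<^sup>2)"
proof -
  define A where "A = (2::real) ^ nat \<lceil>\<bar>a\<bar>\<rceil>"
  define x where "x = 2 * \<bar>u\<bar> * w\<^sup>2"
  define f where "f p = A * ((4 * \<bar>b\<bar> / w) ^ fst p / fact (fst p)) * x ^ snd p" for p :: "nat \<times> nat"
  have x: "x \<ge> 0" "x < 1" using assms by (auto simp: x_def)
  have f_nonneg: "f p \<ge> 0" for p using assms x by (simp add: f_def A_def)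
  have inner: "((\<lambda>m. f (r, m)) has_sum (A * ((4 * \<bar>b\<bar> / w) ^ r / fact r) * (1 / (1 - x)))) UNIV" for r
    using x f_nonneg[of "(r, _)"] unfolding f_def fst_conv snd_conv
    by (intro has_sum_cmult_right norm_summable_imp_has_sum) (auto intro!: geometric_sums summable_geometric simp: power_abs)
  have outer: "((\<lambda>r. A * ((4 * \<bar>b\<bar> / w) ^ r / fact r) * (1 / (1 - x))) has_sum
      (A * exp (4 * \<bar>b\<bar> / w) * (1 / (1 - x)))) UNIV"
    by (rule has_sum_cmult_left[OF has_sum_cmult_right[OF has_sum_exp]])
  have "(\<lambda>p. norm (f p)) summable_on (Sigma UNIV (\<lambda>_. UNIV))"
    unfolding Infinite_Sum.abs_summable_on_Sigma_iff
  proof (intro conjI ballI)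
    fix r show "(\<lambda>m. norm (f (r, m))) summable_on UNIV"
      using inner[of r] f_nonneg by (auto simp: summable_on_def)
  next
    have "infsum (\<lambda>m. norm (f (r, m))) UNIV = A * ((4 * \<bar>b\<bar> / w) ^ r / fact r) * (1 / (1 - x))" for r
      using inner[of r] f_nonneg by (simp add: infsumI)
    moreover have "\<bar>A * ((4 * \<bar>b\<bar> / w) ^ r / fact r) * (1 / (1 - x))\<bar> = A * ((4 * \<bar>b\<bar> / w) ^ r / fact r) * (1 / (1 - x))" for r
      using x assms by (simp add: A_def)
    ultimately have "(\<lambda>r. norm (infsum (\<lambda>m. norm (f (r, m))) UNIV))
        = (\<lambda>r. A * ((4 * \<bar>b\<bar> / w) ^ r / fact r) * (1 / (1 - x)))"
      by (intro ext) (simp only: real_norm_def)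
    then show "(\<lambda>r. norm (infsum (\<lambda>m. norm (f (r, m))) UNIV)) summable_on UNIV"
      using outer unfolding summable_on_def by metis
  qed
  then have f_sum: "f summable_on (Sigma UNIV (\<lambda>_. UNIV))" by (rule Infinite_Sum.abs_summable_summable)
  have tot: "(f has_sum (A * exp (4 * \<bar>b\<bar> / w) * (1 / (1 - x)))) (Sigma UNIV (\<lambda>_. UNIV))"
    by (rule has_sum_SigmaI[OF _ outer f_sum]) (use inner in simp)
  have le: "\<bar>puiseux_term a b u w p\<bar> \<le> f p" for p
  proof -
    obtain r m where p: "p = (r, m)" by force
    have "\<bar>puiseux_term a b u w p\<bar> = (\<bar>b\<bar> / w) ^ r / fact r * \<bar>sqrt_coeff a r m\<bar> * (\<bar>u\<bar> * w\<^sup>2) ^ m"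
      using assms by (simp add: p puiseux_term_def abs_mult power_abs)
    also have "\<dots> \<le> (\<bar>b\<bar> / w) ^ r / fact r * (A * 4 ^ r * 2 ^ m) * (\<bar>u\<bar> * w\<^sup>2) ^ m"
      unfolding A_def using assms by (intro mult_right_mono mult_left_mono abs_sqrt_coeff_le) auto
    also have "\<dots> = f p"
      by (simp add: f_def p x_def power_mult_distrib power_divide mult_ac)
    finally show ?thesis .
  qed
  have s: "(\<lambda>p. \<bar>puiseux_term a b u w p\<bar>) summable_on (Sigma UNIV (\<lambda>_. UNIV))"
    by (rule summable_on_comparison_test[OF f_sum]) (use le in auto)
  show thesis
  proof (rule that)
    show "((\<lambda>p. \<bar>puiseux_term a b u w p\<bar>) has_sum infsum (\<lambda>p. \<bar>puiseux_term a b u w p\<bar>) (UNIV \<times> UNIV)) (UNIV \<times> UNIV)"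
      using s by (simp add: has_sum_infsum)
    have "infsum (\<lambda>p. \<bar>puiseux_term a b u w p\<bar>) (UNIV \<times> UNIV) \<le> A * exp (4 * \<bar>b\<bar> / w) * (1 / (1 - x))"
      by (rule has_sum_mono[OF has_sum_infsum[OF s] tot]) (use le in auto)
    then show "infsum (\<lambda>p. \<bar>puiseux_term a b u w p\<bar>) (UNIV \<times> UNIV)
        \<le> 2 ^ nat \<lceil>\<bar>a\<bar>\<rceil> * exp (4 * \<bar>b\<bar> / w) / (1 - 2 * \<bar>u\<bar> * w\<^sup>2)"
      by (simp add: A_def x_def)
  qed
qed

definition puiseux_fun :: "real \<Rightarrow> real \<Rightarrow> real \<Rightarrow> real \<Rightarrow> real" where
  "puiseux_fun a b u w = (1 + u * w\<^sup>2) powr a * exp (b * (sqrt (1 + u * w\<^sup>2) - 1) / w)"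

text \<open>Absolute summability permits summing over m first. For fixed r, the binomial series of
  the powers a + l / 2 recombine to (sqrt (1 + x) - 1)^r (1 + x)^a; the sum over r is then an
  exponential series.\<close>

lemma has_sum_puiseux_term:
  assumes "w > 0" "2 * \<bar>u\<bar> * w\<^sup>2 < 1"
  shows "(puiseux_term a b u w has_sum puiseux_fun a b u w) (UNIV \<times> UNIV)"
proof -
  define x where "x = u * w\<^sup>2"
  have x: "\<bar>x\<bar> < 1" using assms by (simp add: x_def abs_mult)
  obtain B where "((\<lambda>p. \<bar>puiseux_term a b u w p\<bar>) has_sum B) (UNIV \<times> UNIV)"
    using puiseux_majorant[OF assms] by blast
  then have "(\<lambda>p. norm (puiseux_term a b u w p)) summable_on (UNIV \<times> UNIV)"
    unfolding summable_on_def real_norm_def by blast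
  then have S: "(puiseux_term a b u w has_sum infsum (puiseux_term a b u w) (UNIV \<times> UNIV)) (Sigma UNIV (\<lambda>_. UNIV))"
    by (rule has_sum_infsum[OF Infinite_Sum.abs_summable_summable])
  have inner: "((\<lambda>m. puiseux_term a b u w (r, m)) has_sum
     (((b / w) * (sqrt (1 + x) - 1)) ^ r / fact r * (1 + x) powr a)) UNIV" for r
  proof -
    have "((\<lambda>m. \<Sum>l\<le>r. real (r choose l) * (- 1) ^ (r - l) * (((a + real l / 2) gchoose m) * x ^ m)) has_sum
        (\<Sum>l\<le>r. real (r choose l) * (- 1) ^ (r - l) * (1 + x) powr (a + real l / 2))) UNIV"
    proof -
      have "((\<lambda>m. \<Sum>l\<in>L. real (r choose l) * (- 1) ^ (r - l) * (((a + real l / 2) gchoose m) * x ^ m)) has_sum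
        (\<Sum>l\<in>L. real (r choose l) * (- 1) ^ (r - l) * (1 + x) powr (a + real l / 2))) UNIV" if "finite L" for L
        using that by induction (auto intro!: has_sum_add has_sum_cmult_right[OF has_sum_gbinomial[OF x]])
      then show ?thesis by simp
    qed
    then have "((\<lambda>m. (b / w) ^ r / fact r * (\<Sum>l\<le>r. real (r choose l) * (- 1) ^ (r - l) * (((a + real l / 2) gchoose m) * x ^ m))) has_sum
        (b / w) ^ r / fact r * (\<Sum>l\<le>r. real (r choose l) * (- 1) ^ (r - l) * (1 + x) powr (a + real l / 2))) UNIV"
      by (rule has_sum_cmult_right)
    also have "(\<lambda>m. (b / w) ^ r / fact r * (\<Sum>l\<le>r. real (r choose l) * (- 1) ^ (r - l) * (((a + real l / 2) gchoose m) * x ^ m)))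
        = (\<lambda>m. puiseux_term a b u w (r, m))"
      unfolding puiseux_term_def sqrt_coeff_def x_def prod.case
      by (simp only: sum_distrib_left sum_distrib_right mult.assoc)
    also have "(\<Sum>l\<le>r. real (r choose l) * (- 1) ^ (r - l) * (1 + x) powr (a + real l / 2))
        = (\<Sum>l\<le>r. real (r choose l) * sqrt (1 + x) ^ l * (- 1) ^ (r - l)) * (1 + x) powr a"
    proof -
      have "(1 + x) powr (a + real l / 2) = sqrt (1 + x) ^ l * (1 + x) powr a" for l
        using x sqrt_power_eq_powr[of "1 + x" l] by (simp add: powr_add abs_less_iff mult.commute)
      then show ?thesis by (simp add: sum_distrib_right sum_distrib_left mult_ac)
    qed
    also have "(\<Sum>l\<le>r. real (r choose l) * sqrt (1 + x) ^ l * (- 1) ^ (r - l)) = (sqrt (1 + x) - 1) ^ r"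
      using binomial_ring[of "sqrt (1 + x)" "- 1" r] by simp
    also have "(b / w) ^ r / fact r * ((sqrt (1 + x) - 1) ^ r * (1 + x) powr a)
        = ((b / w) * (sqrt (1 + x) - 1)) ^ r / fact r * (1 + x) powr a"
      unfolding power_mult_distrib by (simp only: mult_ac times_divide_eq_left times_divide_eq_right)
    finally show ?thesis .
  qed
  have "((\<lambda>r. ((b / w) * (sqrt (1 + x) - 1)) ^ r / fact r * (1 + x) powr a) has_sum
      infsum (puiseux_term a b u w) (UNIV \<times> UNIV)) UNIV"
    by (rule has_sum_SigmaD[OF S]) (use inner in simp)
  moreover have "((\<lambda>r. ((b / w) * (sqrt (1 + x) - 1)) ^ r / fact r * (1 + x) powr a) has_sum
      exp ((b / w) * (sqrt (1 + x) - 1)) * (1 + x) powr a) UNIV"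
    by (rule has_sum_cmult_left[OF has_sum_exp])
  ultimately have "infsum (puiseux_term a b u w) (UNIV \<times> UNIV) = exp ((b / w) * (sqrt (1 + x) - 1)) * (1 + x) powr a"
    by (rule has_sum_unique)
  with S show ?thesis by (simp add: puiseux_fun_def x_def mult_ac)
qed

text \<open>
  Expanding the exponential, the r-th term contributes u^m w^(2 m - r), where w = y^(1/2); this is
  u^i w^j for m = i and r = 2 i - j.
\<close>

definition puiseux_coeff :: "real \<Rightarrow> real \<Rightarrow> nat \<Rightarrow> nat \<Rightarrow> real" where
  "puiseux_coeff a b i j =
     (if i \<in> {(j + 1) div 2..j} then b ^ (2 * i - j) / fact (2 * i - j) * sqrt_coeff a (2 * i - j) i else 0)"

lemma nat_ceiling_half: "nat \<lceil>real j / 2\<rceil> = (j + 1) div 2"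
proof -
  have "\<lceil>real j / 2\<rceil> = int ((j + 1) div 2)"
    by (rule ceiling_unique) (cases "even j"; auto elim!: evenE oddE)+
  then show ?thesis by simp
qed

text \<open>The map (j, i) to (2 i - j, i) is a bijection from the pairs with
  \<open>(j + 1) div 2 \<le> i \<le> j\<close> onto the pairs (r, m) with r \<le> m. In this range
  the subtraction on naturals is exact, and for each j only finitely many terms are
  collected.\<close>

lemma has_sum_regroup_puiseux:
  fixes f :: "nat \<times> nat \<Rightarrow> real"
  assumes "(f has_sum S) (UNIV \<times> UNIV)" "\<And>r m. m < r \<Longrightarrow> f (r, m) = 0"
  shows "(\<lambda>j. \<Sum>i = (j + 1) div 2..j. f (2 * i - j, i)) sums S"
proof -
  have "(f has_sum S) {(r, m). r \<le> m}"
    using assms(1) by (subst has_sum_cong_neutral[of "UNIV \<times> UNIV" _ f f]) (use assms(2) in \<open>auto simp: not_le\<close>)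
  moreover have "bij_betw (\<lambda>(j, i). (2 * i - j, i)) (Sigma UNIV (\<lambda>j::nat. {(j + 1) div 2..j})) {(r, m). r \<le> m}"
    by (rule bij_betwI[where g = "\<lambda>(r, m). (2 * m - r, m)"]) auto
  ultimately have "((\<lambda>p. f (2 * snd p - fst p, snd p)) has_sum S) (Sigma UNIV (\<lambda>j. {(j + 1) div 2..j}))"
    using has_sum_reindex_bij_betw[of "\<lambda>(j, i). (2 * i - j, i)" "Sigma UNIV (\<lambda>j. {(j + 1) div 2..j})" "{(r, m). r \<le> m}" f S]
    by (simp add: case_prod_unfold)
  then have "((\<lambda>j. \<Sum>i = (j + 1) div 2..j. f (2 * i - j, i)) has_sum S) UNIV"
    by (rule has_sum_SigmaD) (auto intro!: has_sum_finiteI)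
  then show ?thesis by (rule has_sum_imp_sums)
qed

lemma puiseux_term_diag:
  assumes "w > 0" "i \<in> {(j + 1) div 2..j}"
  shows "puiseux_term a b u w (2 * i - j, i) = puiseux_coeff a b i j * u ^ i * w ^ j"
proof -
  have "w ^ (2 * i) = w ^ (2 * i - j) * w ^ j"
    using assms by (subst power_add[symmetric], intro arg_cong[of _ _ "power w"]) auto
  then have "(b / w) ^ (2 * i - j) * (u * w\<^sup>2) ^ i = b ^ (2 * i - j) * u ^ i * w ^ j"
    using assms by (simp add: power_divide power_mult_distrib flip: power_mult)
  then show ?thesis using assms by (simp add: puiseux_term_def puiseux_coeff_def mult_ac)
qed

definition puiseux_poly :: "real \<Rightarrow> real \<Rightarrow> nat \<Rightarrow> real \<Rightarrow> real" where
  "puiseux_poly a b j u = (\<Sum>i = (j + 1) div 2..j. puiseux_coeff a b i j * u ^ i)"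

lemma puiseux_sums:
  assumes "w > 0" "2 * \<bar>u\<bar> * w\<^sup>2 < 1"
  shows "(\<lambda>j. puiseux_poly a b j u * w ^ j) sums puiseux_fun a b u w"
proof -
  have "(\<lambda>j. \<Sum>i = (j + 1) div 2..j. puiseux_term a b u w (2 * i - j, i)) sums puiseux_fun a b u w"
    by (rule has_sum_regroup_puiseux[OF has_sum_puiseux_term[OF assms]]) (simp add: puiseux_term_def sqrt_coeff_eq_0)
  also have "(\<lambda>j. \<Sum>i = (j + 1) div 2..j. puiseux_term a b u w (2 * i - j, i)) = (\<lambda>j. puiseux_poly a b j u * w ^ j)"
    by (simp add: puiseux_poly_def sum_distrib_right puiseux_term_diag[OF assms(1)])
  finally show ?thesis .
qed

text \<open>Collecting terms of the same j can only lower absolute values, so the majorant of the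
  double series passes to the single series.\<close>

lemma puiseux_abs_sums:
  assumes "w > 0" "2 * \<bar>u\<bar> * w\<^sup>2 < 1"
  shows "summable (\<lambda>j. \<bar>puiseux_poly a b j u\<bar> * w ^ j)"
    and "(\<Sum>j. \<bar>puiseux_poly a b j u\<bar> * w ^ j) \<le> 2 ^ nat \<lceil>\<bar>a\<bar>\<rceil> * exp (4 * \<bar>b\<bar> / w) / (1 - 2 * \<bar>u\<bar> * w\<^sup>2)"
proof -
  obtain B where B: "((\<lambda>p. \<bar>puiseux_term a b u w p\<bar>) has_sum B) (UNIV \<times> UNIV)"
    "B \<le> 2 ^ nat \<lceil>\<bar>a\<bar>\<rceil> * exp (4 * \<bar>b\<bar> / w) / (1 - 2 * \<bar>u\<bar> * w\<^sup>2)"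
    using puiseux_majorant[OF assms] by blast
  have s: "(\<lambda>j. \<Sum>i = (j + 1) div 2..j. \<bar>puiseux_term a b u w (2 * i - j, i)\<bar>) sums B"
    by (rule has_sum_regroup_puiseux[OF B(1)]) (simp add: puiseux_term_def sqrt_coeff_eq_0)
  have le: "\<bar>puiseux_poly a b j u\<bar> * w ^ j \<le> (\<Sum>i = (j + 1) div 2..j. \<bar>puiseux_term a b u w (2 * i - j, i)\<bar>)" for j
  proof -
    have "\<bar>puiseux_poly a b j u\<bar> * w ^ j = \<bar>\<Sum>i = (j + 1) div 2..j. puiseux_term a b u w (2 * i - j, i)\<bar>"
      using assms(1) by (simp add: puiseux_poly_def sum_distrib_right[symmetric] puiseux_term_diag[OF assms(1)] abs_mult)
    then show ?thesis by simp
  qed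
  show sm: "summable (\<lambda>j. \<bar>puiseux_poly a b j u\<bar> * w ^ j)"
    by (rule summable_comparison_test'[OF sums_summable[OF s], of 0]) (use le assms in \<open>simp add: abs_mult\<close>)
  have "(\<Sum>j. \<bar>puiseux_poly a b j u\<bar> * w ^ j) \<le> B"
    using suminf_le[OF le sm sums_summable[OF s]] s by (simp add: sums_iff)
  then show "(\<Sum>j. \<bar>puiseux_poly a b j u\<bar> * w ^ j) \<le> 2 ^ nat \<lceil>\<bar>a\<bar>\<rceil> * exp (4 * \<bar>b\<bar> / w) / (1 - 2 * \<bar>u\<bar> * w\<^sup>2)"
    using B(2) by simp
qed

section \<open>Existence and uniqueness of the Puiseux coefficients\<close>

lemma is_puiseux_coeffs_puiseux_coeff: "is_puiseux_coeffs a b (puiseux_coeff a b)"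
  unfolding is_puiseux_coeffs_def nat_ceiling_half
proof (intro conjI allI impI)
  fix u :: real
  have "\<forall>\<^sub>F y in at_right (0::real). 2 * \<bar>u\<bar> * y < 1"
  proof -
    have "((\<lambda>y. 2 * \<bar>u\<bar> * y) \<longlongrightarrow> 2 * \<bar>u\<bar> * 0) (at_right 0)" by (intro tendsto_intros)
    then show ?thesis by (rule order_tendstoD) simp
  qed
  moreover have "\<forall>\<^sub>F y in at_right (0::real). y > 0" by (simp add: eventually_at_right_less)
  ultimately show "\<forall>\<^sub>F y in at_right 0.
        (\<lambda>j. (\<Sum>i = (j + 1) div 2..j. puiseux_coeff a b i j * u ^ i) * y powr (real j / 2)) sums
          ((1 + u * y) powr a * exp (b * y powr (- 1/2) * (sqrt (1 + u * y) - 1)))"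
  proof eventually_elim
    case (elim y)
    define w where "w = sqrt y"
    have w: "w > 0" "w\<^sup>2 = y" using elim by (simp_all add: w_def)
    have p: "y powr (real j / 2) = w ^ j" for j
      using elim sqrt_power_eq_powr[of y j] by (simp add: w_def)
    have "y powr (- 1/2) = 1 / w"
    proof -
      have "y powr (- 1/2) = 1 / y powr (1/2)" using powr_minus_divide[of y "1/2"] by (simp only: minus_divide_left)
      also have "y powr (1/2) = w" using elim powr_half_sqrt[of y] by (simp only: w_def less_imp_le)
      finally show ?thesis .
    qed
    then have "b * y powr (- 1/2) * (sqrt (1 + u * y) - 1) = b * (sqrt (1 + u * y) - 1) / w" by simp
    then show ?case
      using puiseux_sums[OF w(1), of u a b] elim(1) unfolding p w(2) puiseux_poly_def puiseux_fun_def by (simp only: HOL.simp_thms)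
  qed
qed (auto simp: puiseux_coeff_def)

text \<open>Two identity theorems in turn: for fixed u the powers of w are compared, then for fixed
  j polynomials in u that agree everywhere. The prescribed zeros let every polynomial be written as
  a sum over all i \<le> j.\<close>

lemma is_puiseux_coeffs_unique:
  assumes g: "is_puiseux_coeffs a b g" and h: "is_puiseux_coeffs a b h"
  shows "g = h"
proof (intro ext)
  fix i j :: nat
  define c where "c u j = (\<Sum>i\<le>j. (g i j - h i j) * u ^ i)" for u :: real and j
  have c0: "c u j = 0" for u :: real and j :: nat
  proof (rule powser_eventually_zero_imp_coeff_zero)
    have diff: "(\<Sum>i = nat \<lceil>real j / 2\<rceil>..j. g i j * u ^ i) - (\<Sum>i = nat \<lceil>real j / 2\<rceil>..j. h i j * u ^ i) = c u j" for j
    proof -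
      have "c u j = (\<Sum>i = nat \<lceil>real j / 2\<rceil>..j. (g i j - h i j) * u ^ i)"
        unfolding c_def using g h by (intro sum.mono_neutral_right) (auto simp: is_puiseux_coeffs_def)
      then show ?thesis by (simp add: left_diff_distrib sum_subtractf)
    qed
    have "\<forall>\<^sub>F y in at_right 0. (\<lambda>j. c u j * y powr (real (j::nat) / 2)) sums 0"
      using g[unfolded is_puiseux_coeffs_def, THEN conjunct2, rule_format, of u]
        h[unfolded is_puiseux_coeffs_def, THEN conjunct2, rule_format, of u]
    proof eventually_elim
      case (elim y)
      from sums_diff[OF elim] show ?case by (simp add: left_diff_distrib[symmetric] diff)
    qed
    then obtain e where e: "e > 0" "\<And>y. y > 0 \<Longrightarrow> y < e \<Longrightarrow> (\<lambda>j. c u j * y powr (real j / 2)) sums 0"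
      by (auto simp: eventually_at_right_field)
    show "\<forall>\<^sub>F w in at_right 0. (\<lambda>j. c u j * w ^ j) sums 0"
      unfolding eventually_at_right_field
    proof (intro exI[of _ "sqrt e"] conjI allI impI)
      fix w :: real assume w: "0 < w" "w < sqrt e"
      then have "w\<^sup>2 < e" using e(1) by (metis real_sqrt_less_iff real_sqrt_abs abs_of_pos)
      moreover have "(w\<^sup>2) powr (real j / 2) = w ^ j" for j
        using w sqrt_power_eq_powr[of "w\<^sup>2" j] by simp
      ultimately show "(\<lambda>j. c u j * w ^ j) sums 0" using e(2)[of "w\<^sup>2"] w by simp
    qed (use e in simp)
  qed
  show "g i j = h i j"
  proof (cases "i \<le> j")
    case True
    have "\<forall>u. (\<Sum>i\<le>j. (g i j - h i j) * u ^ i) = 0" using c0[of _ j] by (simp add: c_def)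
    then have "\<forall>i\<le>j. g i j - h i j = 0" using polyfun_eq_0[of "\<lambda>i. g i j - h i j" j] by blast
    with True show ?thesis by simp
  next
    case False
    then show ?thesis using g h by (simp add: is_puiseux_coeffs_def)
  qed
qed

lemma g_coeff_eq: "g_coeff i j a b = puiseux_coeff a b i j"
proof -
  have "(THE g. is_puiseux_coeffs a b g) = puiseux_coeff a b"
    using is_puiseux_coeffs_puiseux_coeff is_puiseux_coeffs_unique by (intro the_equality) blast+
  then show ?thesis by (simp add: g_coeff_def)
qed

section \<open>Remainder of the Puiseux expansion, uniformly in t\<close>

lemma exp_sqrt_le:
  assumes "\<epsilon> > 0" "t \<ge> 0"
  shows "exp (D * sqrt (1 + t)) \<le> exp (\<epsilon> + D\<^sup>2 / (4 * \<epsilon>)) * exp (\<epsilon> * t)"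
proof -
  define \<tau> where "\<tau> = sqrt (1 + t)"
  have t: "\<tau>\<^sup>2 = 1 + t" using assms by (simp add: \<tau>_def)
  \<comment> \<open>Completing the square: the linear growth in \<tau> is absorbed by a small
    multiple of its square 1 + t.\<close>
  have "0 \<le> (2 * \<epsilon> * \<tau> - D)\<^sup>2 / (4 * \<epsilon>)" using assms by simp
  also have "\<dots> = \<epsilon> * \<tau>\<^sup>2 + D\<^sup>2 / (4 * \<epsilon>) - D * \<tau>"
    using assms by (simp add: power2_eq_square field_simps)
  finally have "D * \<tau> \<le> \<epsilon> + D\<^sup>2 / (4 * \<epsilon>) + \<epsilon> * t" unfolding t by (simp add: algebra_simps)
  then show ?thesis by (simp add: \<tau>_def exp_add[symmetric])
qed

text \<open>The division by w does no damage: 1 + t w^2 is at most (1 + w sqrt (1 + t))^2, so the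
  difference quotient in the exponent stays below sqrt (1 + t) however small w is. The power is
  absorbed through ln \<tau> \<le> \<tau>.\<close>

lemma puiseux_fun_bound:
  assumes "t \<ge> 0" "w > 0" "w \<le> 1"
  shows "\<bar>puiseux_fun a b t w\<bar> \<le> exp ((2 * \<bar>a\<bar> + \<bar>b\<bar>) * sqrt (1 + t))"
proof -
  define \<tau> where "\<tau> = sqrt (1 + t)"
  have \<tau>: "\<tau> \<ge> 1" "\<tau>\<^sup>2 = 1 + t" using assms by (auto simp: \<tau>_def)
  have tw: "t * w\<^sup>2 \<le> t" using assms by (simp add: mult_left_le power_le_one)
  have "(1 + t * w\<^sup>2) powr a \<le> (1 + t * w\<^sup>2) powr \<bar>a\<bar>"
    using assms by (intro powr_mono) auto
  also have "\<dots> \<le> (\<tau>\<^sup>2) powr \<bar>a\<bar>"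
    unfolding \<tau>(2) using assms tw by (intro powr_mono2) auto
  also have "\<dots> = exp (2 * \<bar>a\<bar> * ln \<tau>)"
    using \<tau>(1) by (simp add: powr_def ln_realpow)
  also have "\<dots> \<le> exp (2 * \<bar>a\<bar> * \<tau>)"
    using \<tau>(1) ln_le_minus_one[of \<tau>] by (auto intro!: mult_left_mono)
  finally have 1: "(1 + t * w\<^sup>2) powr a \<le> exp (2 * \<bar>a\<bar> * \<tau>)" .
  have "1 + t * w\<^sup>2 \<le> (1 + \<tau> * w)\<^sup>2"
    using assms \<tau> by (simp add: power2_sum power_mult_distrib)
      (smt (verit) mult_nonneg_nonneg mult_right_mono zero_le_power2)
  then have "sqrt (1 + t * w\<^sup>2) \<le> 1 + \<tau> * w"
    using assms \<tau> by (intro real_le_lsqrt) auto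
  moreover have "1 \<le> sqrt (1 + t * w\<^sup>2)" using assms by simp
  ultimately have q: "0 \<le> (sqrt (1 + t * w\<^sup>2) - 1) / w" "(sqrt (1 + t * w\<^sup>2) - 1) / w \<le> \<tau>"
    using assms by (auto simp: divide_le_eq)
  have "b * (sqrt (1 + t * w\<^sup>2) - 1) / w \<le> \<bar>b\<bar> * ((sqrt (1 + t * w\<^sup>2) - 1) / w)"
    using mult_right_mono[OF abs_ge_self[of b] q(1)] by simp
  also have "\<dots> \<le> \<bar>b\<bar> * \<tau>" using q(2) by (rule mult_left_mono) simp
  finally have 2: "exp (b * (sqrt (1 + t * w\<^sup>2) - 1) / w) \<le> exp (\<bar>b\<bar> * \<tau>)" by simp
  have "\<bar>puiseux_fun a b t w\<bar> = (1 + t * w\<^sup>2) powr a * exp (b * (sqrt (1 + t * w\<^sup>2) - 1) / w)"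
    by (simp add: puiseux_fun_def)
  also have "\<dots> \<le> exp (2 * \<bar>a\<bar> * \<tau>) * exp (\<bar>b\<bar> * \<tau>)"
    by (rule mult_mono[OF 1 2]) auto
  finally show ?thesis by (simp add: exp_add[symmetric] \<tau>_def algebra_simps)
qed

text \<open>
  The series is only used for w below v = 1 / (2 sqrt (1 + t)), where it is dominated by its value
  at v. For larger w no smallness is needed: 1 is at most (2 w sqrt (1 + t))^N.
\<close>

lemma puiseux_remainder_sqrt:
  assumes "t \<ge> 0" "w > 0" "w \<le> 1"
  shows "\<bar>puiseux_fun a b t w - (\<Sum>j<N. puiseux_poly a b j t * w ^ j)\<bar>
     \<le> 2 * real (N + 1) * 2 ^ nat \<lceil>\<bar>a\<bar>\<rceil> * w ^ N * exp ((4 * real N + 2 * \<bar>a\<bar> + 8 * \<bar>b\<bar>) * sqrt (1 + t))"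
proof -
  let ?R = "\<bar>puiseux_fun a b t w - (\<Sum>j<N. puiseux_poly a b j t * w ^ j)\<bar>"
  define \<tau> where "\<tau> = sqrt (1 + t)"
  define v where "v = 1 / (2 * \<tau>)"
  define A where "A = (2::real) ^ nat \<lceil>\<bar>a\<bar>\<rceil>"
  \<comment> \<open>The majorant at \<open>w = v\<close>: there 4 |b| / v is 8 |b| \<tau>, and the
    denominator is at least 1/2 because \<open>2 * t * v\<^sup>2\<close> is at most 1/2.\<close>
  define B where "B = 2 * A * exp (8 * \<bar>b\<bar> * \<tau>)"
  define P where "P j = \<bar>puiseux_poly a b j t\<bar>" for j
  have \<tau>: "\<tau> \<ge> 1" "\<tau>\<^sup>2 = 1 + t" using assms by (auto simp: \<tau>_def)
  have v: "v > 0" "2 * v * \<tau> = 1" using \<tau> by (auto simp: v_def)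
  have A: "A \<ge> 1" by (simp add: A_def)
  have tv: "2 * \<bar>t\<bar> * v\<^sup>2 \<le> 1/2"
  proof -
    have "v\<^sup>2 = 1 / (4 * (1 + t))" unfolding v_def power_divide power_mult_distrib \<tau>(2) by simp
    moreover have "t / (1 + t) \<le> 1" using assms by simp
    ultimately show ?thesis using assms by (simp del: divide_le_eq_1)
  qed
  have sm: "summable (\<lambda>j. P j * v ^ j)"
    unfolding P_def by (rule puiseux_abs_sums) (use v tv in auto)
  have "(\<Sum>j. P j * v ^ j) \<le> A * exp (4 * \<bar>b\<bar> / v) / (1 - 2 * \<bar>t\<bar> * v\<^sup>2)"
    unfolding P_def A_def by (rule puiseux_abs_sums) (use v tv in auto)
  also have "\<dots> \<le> A * exp (4 * \<bar>b\<bar> / v) / (1/2)"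
    using tv A by (intro divide_left_mono) auto
  also have "\<dots> = B" by (simp add: B_def v_def)
  finally have sB: "(\<Sum>j. P j * v ^ j) \<le> B" .
  have P_nonneg: "P j * v ^ j \<ge> 0" for j using v by (simp add: P_def)
  have PB: "P j * v ^ j \<le> B" for j
    using sum_le_suminf[OF sm, of "{j}"] P_nonneg sB by auto
  have B: "B \<ge> 0" using A by (simp add: B_def)
  have vt: "(w / v) ^ N = w ^ N * (2 * \<tau>) ^ N" by (simp add: v_def power_mult_distrib power_divide)
  have te: "(2 * \<tau>) ^ N \<le> exp (2 * real N * \<tau>)"
  proof -
    have "2 * \<tau> \<le> exp (2 * \<tau>)" using exp_ge_add_one_self[of "2 * \<tau>"] by linarith
    then have "(2 * \<tau>) ^ N \<le> exp (2 * \<tau>) ^ N" using \<tau> by (intro power_mono) auto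
    then show ?thesis by (simp add: exp_of_nat_mult[symmetric] mult_ac)
  qed
  \<comment> \<open>The 4 N covers two factors \<open>(2 * \<tau>) ^ N\<close>, each at most
    \<open>exp (2 * N * \<tau>)\<close>: for w > v, one bounds the coefficients through their size
    at v, and the other comes with the inserted \<open>w ^ N\<close>.\<close>
  define E where "E = exp ((4 * real N + 2 * \<bar>a\<bar> + 8 * \<bar>b\<bar>) * \<tau>)"
  have "?R \<le> 2 * real (N + 1) * A * w ^ N * E"
  proof (cases "w \<le> v")
    case True
    have "2 * \<bar>t\<bar> * w\<^sup>2 \<le> 2 * \<bar>t\<bar> * v\<^sup>2" using True assms by (intro mult_left_mono power_mono) auto
    then have "(\<lambda>j. puiseux_poly a b j t * w ^ j) sums puiseux_fun a b t w"
      using tv assms by (intro puiseux_sums) auto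
    from sums_split_initial_segment[OF this, of N]
    have s: "(\<lambda>j. puiseux_poly a b (j + N) t * w ^ (j + N)) sums (puiseux_fun a b t w - (\<Sum>j<N. puiseux_poly a b j t * w ^ j))" .
    \<comment> \<open>As w / v \<le> 1, only N of its j + N factors are kept; the tail at w is then
      \<open>(w / v) ^ N\<close> times the tail at v.\<close>
    have le: "norm (puiseux_poly a b (j + N) t * w ^ (j + N)) \<le> (w / v) ^ N * (P (j + N) * v ^ (j + N))" for j
    proof -
      have "w ^ (j + N) = (w / v) ^ (j + N) * v ^ (j + N)" using v by (simp add: power_divide)
      also have "\<dots> \<le> (w / v) ^ N * v ^ (j + N)"
        using True v assms by (intro mult_right_mono power_decreasing) auto
      finally have "P (j + N) * w ^ (j + N) \<le> P (j + N) * ((w / v) ^ N * v ^ (j + N))"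
        by (rule mult_left_mono) (simp add: P_def)
      then show ?thesis using assms by (simp add: P_def abs_mult mult_ac)
    qed
    have sm': "summable (\<lambda>j. P (j + N) * v ^ (j + N))" using sm by (subst summable_iff_shift)
    have "?R \<le> (\<Sum>j. (w / v) ^ N * (P (j + N) * v ^ (j + N)))"
      using norm_suminf_le[OF le summable_mult[OF sm']] s by (simp add: sums_iff)
    also have "\<dots> = (w / v) ^ N * (\<Sum>j. P (j + N) * v ^ (j + N))" by (rule suminf_mult[OF sm'])
    also have "\<dots> \<le> (w / v) ^ N * B"
    proof (rule mult_left_mono)
      have "(\<Sum>i<N. P i * v ^ i) \<ge> 0" by (intro sum_nonneg P_nonneg)
      then show "(\<Sum>j. P (j + N) * v ^ (j + N)) \<le> B"
        using suminf_split_initial_segment[OF sm, of N] sB by linarith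
    qed (use assms v in auto)
    also have "\<dots> = w ^ N * (2 * \<tau>) ^ N * B" by (simp add: vt)
    also have "\<dots> \<le> w ^ N * exp (2 * real N * \<tau>) * B"
      using te B assms by (intro mult_right_mono mult_left_mono) auto
    also have "\<dots> = 2 * A * w ^ N * exp (2 * real N * \<tau> + 8 * \<bar>b\<bar> * \<tau>)"
      by (simp add: B_def exp_add)
    also have "\<dots> \<le> 2 * A * w ^ N * E"
    proof -
      have "2 * real N * \<tau> + 8 * \<bar>b\<bar> * \<tau> \<le> (4 * real N + 2 * \<bar>a\<bar> + 8 * \<bar>b\<bar>) * \<tau>"
        unfolding distrib_right[symmetric] using \<tau> by (intro mult_right_mono) auto
      then show ?thesis unfolding E_def using A assms by (intro mult_left_mono) auto
    qed
    also have "\<dots> \<le> 2 * real (N + 1) * A * w ^ N * E"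
      using A assms by (simp add: E_def mult_le_cancel_right)
    finally show ?thesis .
  next
    case False
    have wv: "1 \<le> w ^ N * (2 * \<tau>) ^ N"
    proof -
      have "1 \<le> (w / v)" using False v by simp
      then have "1 \<le> (w / v) ^ N" by (rule one_le_power)
      then show ?thesis by (simp add: vt)
    qed
    have pj: "\<bar>puiseux_poly a b j t * w ^ j\<bar> \<le> B * (2 * \<tau>) ^ N" if "j < N" for j
    proof -
      have "\<bar>puiseux_poly a b j t * w ^ j\<bar> = P j * w ^ j" using assms by (simp add: P_def abs_mult)
      also have "\<dots> \<le> P j * 1" using assms by (intro mult_left_mono power_le_one) (auto simp: P_def)
      also have "P j * 1 = P j * v ^ j * (2 * \<tau>) ^ j"
      proof -
        have "v * (2 * \<tau>) = 1" using v(2) by simp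
        then have "v ^ j * (2 * \<tau>) ^ j = 1" by (metis power_mult_distrib power_one)
        then show ?thesis by (simp only: mult.assoc)
      qed
      also have "\<dots> \<le> B * (2 * \<tau>) ^ N"
        using PB[of j] \<tau> that B by (intro mult_mono power_increasing) auto
      finally show ?thesis .
    qed
    have "?R
        \<le> \<bar>puiseux_fun a b t w\<bar> + (\<Sum>j<N. \<bar>puiseux_poly a b j t * w ^ j\<bar>)"
      by (rule order.trans[OF abs_triangle_ineq4]) (simp add: sum_abs)
    also have "\<dots> \<le> exp ((2 * \<bar>a\<bar> + \<bar>b\<bar>) * \<tau>) + (\<Sum>j<N. B * (2 * \<tau>) ^ N)"
      using pj puiseux_fun_bound[OF assms, of a b] by (intro add_mono sum_mono) (auto simp: \<tau>_def)
    also have "\<dots> \<le> exp ((2 * \<bar>a\<bar> + \<bar>b\<bar>) * \<tau>) + real N * (B * exp (2 * real N * \<tau>))"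
      using te B by (simp add: mult_left_mono)
    also have "\<dots> \<le> 2 * real (N + 1) * A * exp ((2 * real N + 2 * \<bar>a\<bar> + 8 * \<bar>b\<bar>) * \<tau>)" (is "_ \<le> ?E")
    proof -
      define F where "F = exp ((2 * real N + 2 * \<bar>a\<bar> + 8 * \<bar>b\<bar>) * \<tau>)"
      have "exp ((2 * \<bar>a\<bar> + \<bar>b\<bar>) * \<tau>) \<le> F"
        unfolding F_def using \<tau> by (intro iffD2[OF exp_le_cancel_iff] mult_right_mono) auto
      also have "F \<le> 2 * A * F" using A by (simp add: F_def)
      finally have 1: "exp ((2 * \<bar>a\<bar> + \<bar>b\<bar>) * \<tau>) \<le> 2 * A * F" .
      have "B * exp (2 * real N * \<tau>) = 2 * A * exp ((2 * real N + 8 * \<bar>b\<bar>) * \<tau>)"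
        by (simp add: B_def exp_add distrib_right)
      also have "\<dots> \<le> 2 * A * F"
        unfolding F_def using \<tau> A by (intro mult_left_mono iffD2[OF exp_le_cancel_iff] mult_right_mono) auto
      finally have "real N * (B * exp (2 * real N * \<tau>)) \<le> real N * (2 * A * F)" by (rule mult_left_mono) simp
      from add_mono[OF 1 this] show ?thesis unfolding F_def[symmetric] by (simp add: algebra_simps)
    qed
    also have "?E \<le> ?E * (w ^ N * (2 * \<tau>) ^ N)"
      using mult_left_mono[OF wv, of ?E] A by simp
    also have "\<dots> \<le> ?E * (w ^ N * exp (2 * real N * \<tau>))"
      using te A assms by (intro mult_left_mono) auto
    also have "\<dots> = 2 * real (N + 1) * A * w ^ N * E"
    proof -
      have "exp ((2 * real N + 2 * \<bar>a\<bar> + 8 * \<bar>b\<bar>) * \<tau>) * exp (2 * real N * \<tau>) = E"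
        by (simp add: E_def exp_add[symmetric] algebra_simps)
      then show ?thesis by (metis (no_types, lifting) mult.assoc mult.commute)
    qed
    finally show ?thesis .
  qed
  then show ?thesis by (simp add: A_def E_def \<tau>_def)
qed

text \<open>Exponential growth in sqrt (1 + t) is slower than exp (\<epsilon> t) for every
  \<epsilon> > 0, at the price of the constant only. This freedom is needed to match \<epsilon> to
  the scale of the gamma density.\<close>

lemma puiseux_remainder:
  assumes "\<epsilon> > 0"
  obtains C where "C \<ge> 0"
    and "\<And>t w. t \<ge> 0 \<Longrightarrow> w > 0 \<Longrightarrow> w \<le> 1 \<Longrightarrow>
       \<bar>puiseux_fun a b t w - (\<Sum>j<N. puiseux_poly a b j t * w ^ j)\<bar> \<le> C * w ^ N * exp (\<epsilon> * t)"
proof -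
  define D where "D = 4 * real N + 2 * \<bar>a\<bar> + 8 * \<bar>b\<bar>"
  define C0 where "C0 = 2 * real (N + 1) * (2::real) ^ nat \<lceil>\<bar>a\<bar>\<rceil>"
  show thesis
  proof (rule that[of "C0 * exp (\<epsilon> + D\<^sup>2 / (4 * \<epsilon>))"])
    show "C0 * exp (\<epsilon> + D\<^sup>2 / (4 * \<epsilon>)) \<ge> 0" by (simp add: C0_def)
    fix t w :: real assume tw: "t \<ge> 0" "w > 0" "w \<le> 1"
    have "\<bar>puiseux_fun a b t w - (\<Sum>j<N. puiseux_poly a b j t * w ^ j)\<bar> \<le> C0 * w ^ N * exp (D * sqrt (1 + t))"
      using puiseux_remainder_sqrt[OF tw, of a b N] by (simp add: C0_def D_def)
    also have "\<dots> \<le> C0 * w ^ N * (exp (\<epsilon> + D\<^sup>2 / (4 * \<epsilon>)) * exp (\<epsilon> * t))"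
      using tw exp_sqrt_le[OF assms tw(1), of D] by (intro mult_left_mono) (auto simp: C0_def)
    finally show "\<bar>puiseux_fun a b t w - (\<Sum>j<N. puiseux_poly a b j t * w ^ j)\<bar>
        \<le> C0 * exp (\<epsilon> + D\<^sup>2 / (4 * \<epsilon>)) * w ^ N * exp (\<epsilon> * t)" by (simp add: mult_ac)
  qed
qed

section \<open>Hankel's expansion\<close>

text \<open>The k-th coefficient of the expansion of I_(nu - 1) in negative powers of its argument.\<close>

definition bessel_coeff :: "real \<Rightarrow> nat \<Rightarrow> real" where
  "bessel_coeff \<nu> k = pochhammer (3/2 - \<nu>) k * pochhammer (\<nu> - 1/2) k / (fact k * 2 ^ k)"

text \<open>Integrates a pointwise estimate; it serves both Watson's lemma and the final integration
  against the second density. \<open>F\<close> differs from an integrable sum by at most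
  \<open>H\<close>, hence is integrable, and the extended value becomes an ordinary
  integral.\<close>

lemma nn_integral_approx_sum:
  fixes F :: "'a \<Rightarrow> real"
  assumes [measurable]: "F \<in> borel_measurable M" and F: "\<And>x. F x \<ge> 0"
    and g: "\<And>l. l < N \<Longrightarrow> has_bochner_integral M (g l) (G l)"
    and H: "has_bochner_integral M H h"
    and bound: "\<And>x. \<bar>F x - (\<Sum>l<N. g l x)\<bar> \<le> H x"
    and val: "(\<integral>\<^sup>+x. ennreal (F x) \<partial>M) = ennreal val" "val \<ge> 0"
  shows "\<bar>val - (\<Sum>l<(N::nat). G l)\<bar> \<le> h"
proof -
  have gi: "integrable M (\<lambda>x. \<Sum>l<N. g l x)"
    using g by (intro Bochner_Integration.integrable_sum) (auto simp: has_bochner_integral_iff)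
  have Hi: "integrable M H" using H by (simp add: has_bochner_integral_iff)
  have di: "integrable M (\<lambda>x. F x - (\<Sum>l<N. g l x))"
    by (rule Bochner_Integration.integrable_bound[OF Hi])
      (use borel_measurable_integrable[OF gi] bound in \<open>auto intro!: AE_I2 borel_measurable_diff order.trans[OF bound abs_ge_self]\<close>)
  have Fi: "integrable M F" using Bochner_Integration.integrable_add[OF di gi] by simp
  have "val = integral\<^sup>L M F"
    using nn_integral_eq_integral[OF Fi] F val by (simp add: integral_nonneg_AE)
  moreover have "(\<Sum>l<N. G l) = (\<integral>x. (\<Sum>l<N. g l x) \<partial>M)"
    using g by (subst Bochner_Integration.integral_sum) (auto simp: has_bochner_integral_iff intro!: sum.cong)
  ultimately have "val - (\<Sum>l<N. G l) = (\<integral>x. F x - (\<Sum>l<N. g l x) \<partial>M)"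
    using Fi gi by simp
  also have "\<bar>\<dots>\<bar> \<le> (\<integral>x. \<bar>F x - (\<Sum>l<N. g l x)\<bar> \<partial>M)" by (rule integral_abs_bound)
  also have "\<dots> \<le> integral\<^sup>L M H"
    using di Hi bound by (intro integral_mono) auto
  finally show ?thesis using H by (simp add: has_bochner_integral_iff)
qed

lemma power_le_fact_exp: "z \<ge> 0 \<Longrightarrow> z ^ k \<le> fact k * exp (z::real)"
proof -
  assume z: "z \<ge> 0"
  have "(\<Sum>n\<in>{k}. inverse (fact n) *\<^sub>R z ^ n) \<le> (\<Sum>n. inverse (fact n) *\<^sub>R z ^ n)"
    by (rule sum_le_suminf[OF summable_exp_generic]) (use z in auto)
  then show ?thesis by (simp add: exp_def field_simps)
qed

lemma exp_minus_le_powr: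
  obtains C where "C \<ge> 0" and "\<And>z::real. z \<ge> 1 \<Longrightarrow> exp (- z) \<le> C * z powr (- p)"
proof (rule that)
  let ?k = "nat \<lceil>\<bar>p\<bar>\<rceil>"
  show "(fact ?k :: real) \<ge> 0" by simp
  fix z :: real assume z: "z \<ge> 1"
  have "z powr p \<le> z powr real ?k" using z by (intro powr_mono) linarith+
  also have "z powr real ?k = z ^ ?k" using z by (intro powr_realpow) simp
  also have "\<dots> \<le> fact ?k * exp z" using z by (intro power_le_fact_exp) simp
  finally show "exp (- z) \<le> fact ?k * z powr (- p)"
    using z by (simp add: exp_minus powr_minus field_simps)
qed

text \<open>For v < 1 this is a Taylor remainder inside the disc of convergence. For v \<ge> 1 the
  function is cut off, and the Taylor polynomial itself is of order \<open>v ^ N\<close>, since all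
  its exponents are below N.\<close>

lemma half_power_remainder:
  fixes \<beta> :: real
  obtains C where "C \<ge> 0"
    and "\<And>v. v > 0 \<Longrightarrow> \<bar>(if v < 1 then (1 - v / 2) powr \<beta> else 0) - (\<Sum>k<N. (\<beta> gchoose k) * (- v / 2) ^ k)\<bar> \<le> C * v ^ N"
proof -
  define c where "c k = \<bar>\<beta> gchoose k\<bar> * (1/2) ^ k" for k
  have c: "c k \<ge> 0" for k by (simp add: c_def)
  \<comment> \<open>Any point strictly between 1/2 and the radius of convergence 1 would do;
    convergence there is absolute at 1/2, the value of v / 2 at the cut.\<close>
  have "summable (\<lambda>m. (\<beta> gchoose m) * (3/4) ^ m)"
    using gen_binomial_real[of "3/4" \<beta>] by (simp add: sums_iff)
  then have "summable (\<lambda>m. norm ((\<beta> gchoose m) * (1/2) ^ m))"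
    by (rule powser_insidea) simp
  then have sm: "summable c" by (simp add: c_def[abs_def] abs_mult power_abs)
  show thesis
  proof (rule that[of "suminf c"])
    show "suminf c \<ge> 0" using c by (intro suminf_nonneg sm)
    fix v :: real assume v: "v > 0"
    have tm: "\<bar>(\<beta> gchoose k) * (- v / 2) ^ k\<bar> = c k * v ^ k" for k
      using v by (simp add: c_def abs_mult power_abs power_divide)
    show "\<bar>(if v < 1 then (1 - v / 2) powr \<beta> else 0) - (\<Sum>k<N. (\<beta> gchoose k) * (- v / 2) ^ k)\<bar> \<le> suminf c * v ^ N"
    proof (cases "v < 1")
      case True
      have "(\<lambda>k. (\<beta> gchoose k) * (- v / 2) ^ k) sums (1 - v / 2) powr \<beta>"
        using gen_binomial_real[of "- v / 2" \<beta>] v True by simp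
      from sums_split_initial_segment[OF this, of N]
      have s: "(\<lambda>k. (\<beta> gchoose (k + N)) * (- v / 2) ^ (k + N)) sums
          ((1 - v / 2) powr \<beta> - (\<Sum>k<N. (\<beta> gchoose k) * (- v / 2) ^ k))" .
      have le: "norm ((\<beta> gchoose (k + N)) * (- v / 2) ^ (k + N)) \<le> c (k + N) * v ^ N" for k
      proof -
        have "v ^ (k + N) \<le> v ^ N" using v True by (intro power_decreasing) auto
        then show ?thesis using tm[of "k + N"] c[of "k + N"] by (simp add: mult_left_mono)
      qed
      have sm': "summable (\<lambda>k. c (k + N))" using sm by (subst summable_iff_shift)
      have "\<bar>(1 - v / 2) powr \<beta> - (\<Sum>k<N. (\<beta> gchoose k) * (- v / 2) ^ k)\<bar> \<le> (\<Sum>k. c (k + N) * v ^ N)"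
        using norm_suminf_le[OF le summable_mult2[OF sm']] s by (simp add: sums_iff)
      also have "\<dots> = (\<Sum>k. c (k + N)) * v ^ N" by (rule suminf_mult2[OF sm', symmetric])
      also have "\<dots> \<le> suminf c * v ^ N"
        using suminf_split_initial_segment[OF sm, of N] sum_nonneg[of "{..<N}" c] c v by (intro mult_right_mono) auto
      finally show ?thesis using True by simp
    next
      case False
      have "\<bar>\<Sum>k<N. (\<beta> gchoose k) * (- v / 2) ^ k\<bar> \<le> (\<Sum>k<N. c k * v ^ N)"
      proof (rule order.trans[OF sum_abs sum_mono])
        fix k assume "k \<in> {..<N}"
        then have "v ^ k \<le> v ^ N" using False by (intro power_increasing) auto
        then show "\<bar>(\<beta> gchoose k) * (- v / 2) ^ k\<bar> \<le> c k * v ^ N"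
          unfolding tm using c by (intro mult_left_mono)
      qed
      also have "\<dots> = (\<Sum>k<N. c k) * v ^ N" by (simp add: sum_distrib_right)
      also have "\<dots> \<le> suminf c * v ^ N"
        using sum_le_suminf[OF sm, of "{..<N}"] c v by (intro mult_right_mono) auto
      finally show ?thesis using False by simp
    qed
  qed
qed

text \<open>Poisson's integral, read off at the point 1 from the convolution of the kernels of index
  \<beta> + 1 and 1/2, the latter being a cosh. With y = x^2 and x = 1 - v the factor 1 - y is 2 v
  (1 - v / 2). The two exponentials of cosh (z x), divided by exp z, are the main part exp (- z v)
  and a part that is small for v < 1.\<close>

lemma phi01_integral:
  assumes "\<beta> > - 1" "z > 0"
  shows "(\<integral>\<^sup>+v. ennreal (power_kernel (\<beta> + 1) v * (if v < 1 then (1 - v / 2) powr \<beta> else 0) * (exp (- z * v) + exp (- 2 * z + z * v))) \<partial>lborel)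
       = ennreal (phi01 (\<beta> + 3/2) (z\<^sup>2 / 4) * sqrt pi * 2 powr (- \<beta>) * exp (- z))"
proof -
  define l where "l = z\<^sup>2 / 4"
  have l: "l > 0" "2 * sqrt l = z" using assms by (auto simp: l_def real_sqrt_divide)
  define f where "f y = phi01_kernel (\<beta> + 1) 0 (1 - y) * phi01_kernel (1/2) l y" for y
  define K where "K = sqrt pi * 2 powr (- \<beta>) * exp (- z)"
  define F where "F v = power_kernel (\<beta> + 1) v * (if v < 1 then (1 - v / 2) powr \<beta> else 0) * (exp (- z * v) + exp (- 2 * z + z * v))" for v
  have K: "K > 0" by (simp add: K_def)
  have fm [measurable]: "f \<in> borel_measurable borel" unfolding f_def by measurable
  have Fm [measurable]: "F \<in> borel_measurable borel" unfolding F_def by measurable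
  have f_nonneg: "f y \<ge> 0" for y using assms l by (simp add: f_def phi01_kernel_nonneg)
  have phi0: "phi01 \<nu> 0 = 1 / Gamma \<nu>" for \<nu>
    using powser_zero[of "\<lambda>k. 1 / (fact k * Gamma (\<nu> + real k))"] by (simp add: phi01_def)
  have "ennreal (phi01 (\<beta> + 3/2) l) = (\<integral>\<^sup>+y. ennreal (f y) \<partial>lborel)"
    using nn_integral_phi01_kernel_convolution[of "\<beta> + 1" "1/2" 0 l 1] assms l
    by (simp add: f_def ennreal_mult' phi01_kernel_nonneg phi01_kernel_def[of "\<beta> + 3/2"] add.assoc)
  also have "\<dots> = (\<integral>\<^sup>+y. ennreal (f y * indicator {0..} y) \<partial>lborel)"
    by (intro nn_integral_cong) (auto simp: f_def phi01_kernel_def indicator_def)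
  also have "\<dots> = (\<integral>\<^sup>+x. ennreal (f (x\<^sup>2) * (2 * x) * indicator {0..} x) \<partial>lborel)"
    by (rule nn_integral_square_substitution) measurable
  also have "\<dots> = (\<integral>\<^sup>+v. ennreal (f ((1 - v)\<^sup>2) * (2 * (1 - v)) * indicator {0..} (1 - v)) \<partial>lborel)"
    by (subst nn_integral_real_affine[where c = "-1" and t = 1]) simp_all
  also have "\<dots> = (\<integral>\<^sup>+v. ennreal (1 / K) * ennreal (F v) \<partial>lborel)"
  proof (intro nn_integral_cong)
    fix v :: real
    have "f ((1 - v)\<^sup>2) * (2 * (1 - v)) * indicator {0..} (1 - v) = 1 / K * F v"
    proof (cases "0 < v \<and> v < 1")
      case True
      define x where "x = 1 - v"
      have x: "x > 0" "x < 1" using True by (auto simp: x_def)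
      have "x\<^sup>2 < 1" using x by (simp add: power_less_one_iff abs_square_less_1)
      have p: "(x\<^sup>2) powr (1/2 - 1) = 1 / x"
        using x by (simp add: powr_minus_divide powr_half_sqrt)
      have "sqrt (l * x\<^sup>2) = sqrt l * x" using x by (simp add: real_sqrt_mult)
      then have s: "2 * sqrt (l * x\<^sup>2) = z * x" using l(2) by simp
      have "1 - x\<^sup>2 = v * (2 * (1 - v / 2))" by (simp add: x_def power2_eq_square algebra_simps)
      then have "(1 - x\<^sup>2) powr \<beta> = v powr \<beta> * (2 powr \<beta> * (1 - v / 2) powr \<beta>)"
      proof -
        have "(2 * (1 - v / 2)) powr \<beta> = 2 powr \<beta> * (1 - v / 2) powr \<beta>"
          by (subst powr_mult) (use True in auto)
        moreover have "(v * (2 * (1 - v / 2))) powr \<beta> = v powr \<beta> * (2 * (1 - v / 2)) powr \<beta>"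
          by (subst powr_mult) (use True in auto)
        ultimately show ?thesis using \<open>1 - x\<^sup>2 = v * (2 * (1 - v / 2))\<close> by (simp only:)
      qed
      then have "phi01_kernel (\<beta> + 1) 0 (1 - x\<^sup>2) = v powr \<beta> * (2 powr \<beta> * (1 - v / 2) powr \<beta>) / Gamma (\<beta> + 1)"
        using \<open>x\<^sup>2 < 1\<close> by (simp add: phi01_kernel_def phi0)
      moreover have "phi01_kernel (1/2) l (x\<^sup>2) * (2 * x) = 2 * cosh (z * x) / sqrt pi"
        using x p l by (simp add: phi01_kernel_def phi01_half s)
      ultimately have 1: "f (x\<^sup>2) * (2 * x) = power_kernel (\<beta> + 1) v * (2 powr \<beta> * (1 - v / 2) powr \<beta>) * (2 * cosh (z * x) / sqrt pi)"
        unfolding f_def mult.assoc[of _ "phi01_kernel (1/2) l (x\<^sup>2)"] using True by (simp only:) (simp add: power_kernel_def)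
      have "2 * cosh (z * x) = exp (z * x) + exp (- (z * x))" by (simp add: cosh_field_def)
      also have "\<dots> = exp z * (exp (- z * v) + exp (- 2 * z + z * v))"
        by (simp add: x_def exp_add[symmetric] distrib_left algebra_simps)
      finally have 2: "2 * cosh (z * x) = exp z * (exp (- z * v) + exp (- 2 * z + z * v))" .
      have 3: "1 / K = 2 powr \<beta> * exp z / sqrt pi"
        by (simp add: K_def powr_minus exp_minus field_simps)
      show ?thesis
        using x True 1 unfolding x_def[symmetric] 2 3 by (simp add: F_def mult_ac)
    next
      case False
      then show ?thesis
        by (cases "v = 1") (auto simp: F_def power_kernel_def f_def phi01_kernel_def indicator_def abs_square_less_1 not_less
             intro: one_le_power)
    qed
    then show "ennreal (f ((1 - v)\<^sup>2) * (2 * (1 - v)) * indicator {0..} (1 - v)) = ennreal (1 / K) * ennreal (F v)"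
      using K by (simp only: ennreal_mult'[symmetric] divide_nonneg_pos zero_le_one)
  qed
  also have "\<dots> = ennreal (1 / K) * (\<integral>\<^sup>+v. ennreal (F v) \<partial>lborel)"
    by (rule nn_integral_cmult) measurable
  finally have "ennreal K * ennreal (phi01 (\<beta> + 3/2) l) = ennreal K * (ennreal (1 / K) * (\<integral>\<^sup>+v. ennreal (F v) \<partial>lborel))"
    by simp
  also have "\<dots> = (\<integral>\<^sup>+v. ennreal (F v) \<partial>lborel)"
    using K by (simp add: mult.assoc[symmetric] ennreal_mult'[symmetric])
  finally show ?thesis
    using K by (simp add: F_def ennreal_mult'[symmetric] less_imp_le) (simp add: K_def l_def mult_ac)
qed

lemma has_bochner_integral_power_kernel_exp:
  assumes "\<alpha> > 0" "z > 0"
  shows "has_bochner_integral lborel (\<lambda>v. power_kernel \<alpha> v * v ^ k * exp (- z * v))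
     (pochhammer \<alpha> k * z powr (- \<alpha> - real k))"
proof (rule has_bochner_integral_nn_integral)
  have G: "Gamma (\<alpha> + real k) = pochhammer \<alpha> k * Gamma \<alpha>"
    using assms Gamma_real_pos[of \<alpha>] pochhammer_Gamma[of \<alpha> k]
    by (simp add: field_simps nonpos_Ints_def not_le[symmetric])
  have "Gamma \<alpha> > 0" "Gamma (\<alpha> + real k) > 0" using assms by (auto intro!: Gamma_real_pos add_pos_nonneg)
  then have eq: "power_kernel \<alpha> v * v ^ k = pochhammer \<alpha> k * power_kernel (\<alpha> + real k) v" for v
    using assms unfolding G power_kernel_def
    by (auto simp: powr_add powr_realpow powr_diff field_simps)
  have ph: "pochhammer \<alpha> k \<ge> 0" using assms by (intro pochhammer_nonneg)
  have "(\<integral>\<^sup>+v. ennreal (power_kernel \<alpha> v * v ^ k * exp (- z * v)) \<partial>lborel)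
      = (\<integral>\<^sup>+v. ennreal (pochhammer \<alpha> k) * ennreal (power_kernel (\<alpha> + real k) v * exp (- v / (1 / z))) \<partial>lborel)"
    unfolding eq using ph by (intro nn_integral_cong) (simp add: ennreal_mult'[symmetric] mult.assoc mult.commute[of z])
  also have "\<dots> = ennreal (pochhammer \<alpha> k) * ennreal ((1 / z) powr (\<alpha> + real k))"
    by (subst nn_integral_cmult) (use assms nn_integral_power_kernel_exp[of "\<alpha> + real k" "1 / z"] in \<open>auto intro: add_pos_nonneg\<close>)
  also have "\<dots> = ennreal (pochhammer \<alpha> k * z powr (- \<alpha> - real k))"
    using ph assms by (subst ennreal_mult'[symmetric]) (simp_all add: powr_divide powr_diff powr_minus powr_add field_simps)
  finally show "(\<integral>\<^sup>+v. ennreal (power_kernel \<alpha> v * v ^ k * exp (- z * v)) \<partial>lborel)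
      = ennreal (pochhammer \<alpha> k * z powr (- \<alpha> - real k))" .
  show "0 \<le> pochhammer \<alpha> k * z powr (- \<alpha> - real k)" using ph by simp
  show "AE v in lborel. 0 \<le> power_kernel \<alpha> v * v ^ k * exp (- z * v)"
    unfolding eq using ph assms by (auto intro!: mult_nonneg_nonneg power_kernel_nonneg add_pos_nonneg)
qed measurable

text \<open>The Taylor polynomial of (1 - v / 2)^\<beta> is integrated term by term against the main
  exponential over the whole half line; its remainder gives the error. The second exponential is at
  most exp (- z) on the range of integration, hence beyond all orders.\<close>

lemma phi01_asymptotic_Watson:
  assumes "\<beta> \<ge> - 1/2"
  obtains C where "C \<ge> 0" and "\<And>z. z \<ge> 1 \<Longrightarrow>
    \<bar>phi01 (\<beta> + 3/2) (z\<^sup>2 / 4) * (z / 2) powr (\<beta> + 1/2) * sqrt (2 * pi * z) * exp (- z)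
      - (\<Sum>k<N. bessel_coeff (\<beta> + 3/2) k / z ^ k)\<bar> \<le> C / z ^ N"
proof -
  obtain C1 where C1: "C1 \<ge> 0" "\<And>v. v > 0 \<Longrightarrow>
     \<bar>(if v < 1 then (1 - v / 2) powr \<beta> else 0) - (\<Sum>k<N. (\<beta> gchoose k) * (- v / 2) ^ k)\<bar> \<le> C1 * v ^ N"
    using half_power_remainder[of \<beta> N] by blast
  obtain C2 where C2: "C2 \<ge> 0" "\<And>z::real. z \<ge> 1 \<Longrightarrow> exp (- z) \<le> C2 * z powr (- (\<beta> + 1 + real N))"
    using exp_minus_le_powr[of "\<beta> + 1 + real N"] by blast
  have M: "(1 - v / 2) powr \<beta> \<le> 2" if "0 < v" "v < 1" for v
  proof (cases "\<beta> \<ge> 0")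
    case True
    then have "(1 - v / 2) powr \<beta> \<le> 1 powr \<beta>" using that by (intro powr_mono2) auto
    then show ?thesis by simp
  next
    case False
    have "(1 - v / 2) powr \<beta> \<le> (1/2) powr \<beta>" using that False by (intro powr_mono2') auto
    also have "\<dots> \<le> (1/2) powr (- 1)" using assms by (intro powr_mono') auto
    finally show ?thesis by (simp add: powr_minus)
  qed
  define C where "C = C1 * pochhammer (\<beta> + 1) N + 2 * exp 1 * C2"
  have ph: "pochhammer (\<beta> + 1) N \<ge> 0" using assms by (intro pochhammer_nonneg) auto
  show thesis
  proof (rule that[of C])
    show "C \<ge> 0" using C1(1) C2(1) ph by (simp add: C_def)
    fix z :: real assume z: "z \<ge> 1"
    define P where "P = power_kernel (\<beta> + 1)"
    have P: "P v \<ge> 0" for v using assms by (simp add: P_def power_kernel_nonneg)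
    have [measurable]: "P \<in> borel_measurable borel" by (simp add: P_def)
    define \<phi> where "\<phi> v = (if v < 1 then (1 - v / 2) powr \<beta> else 0)" for v :: real
    have [measurable]: "\<phi> \<in> borel_measurable borel" unfolding \<phi>_def by measurable
    define F where "F v = P v * \<phi> v * (exp (- z * v) + exp (- 2 * z + z * v))" for v
    define g where "g k v = ((\<beta> gchoose k) * (- 1/2) ^ k) * (P v * v ^ k * exp (- z * v))" for k v
    \<comment> \<open>The second summand covers the small exponential: for v < 1 it is at most exp
      (- z), the power is at most 2, and \<open>exp 1 * exp (- v)\<close>, which is at least 1
      there, makes the bound integrable on the half line.\<close>
    define H where "H v = C1 * (P v * v ^ N * exp (- z * v)) + (2 * exp 1 * exp (- z)) * (P v * v ^ 0 * exp (- 1 * v))" for v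
    define val where "val = phi01 (\<beta> + 3/2) (z\<^sup>2 / 4) * sqrt pi * 2 powr (- \<beta>) * exp (- z)"
    have G: "has_bochner_integral lborel (g k) (((\<beta> gchoose k) * (- 1/2) ^ k) * (pochhammer (\<beta> + 1) k * z powr (- (\<beta> + 1) - real k)))" for k
      unfolding g_def P_def using assms z
      by (intro has_bochner_integral_mult_right has_bochner_integral_power_kernel_exp) auto
    have Hh: "has_bochner_integral lborel H
       (C1 * (pochhammer (\<beta> + 1) N * z powr (- (\<beta> + 1) - real N)) + (2 * exp 1 * exp (- z)) * (pochhammer (\<beta> + 1) 0 * 1 powr (- (\<beta> + 1) - real 0)))"
      unfolding H_def P_def using assms z
      by (intro has_bochner_integral_add has_bochner_integral_mult_right has_bochner_integral_power_kernel_exp) auto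
    have "\<bar>val - (\<Sum>k<N. ((\<beta> gchoose k) * (- 1/2) ^ k) * (pochhammer (\<beta> + 1) k * z powr (- (\<beta> + 1) - real k)))\<bar>
        \<le> C1 * (pochhammer (\<beta> + 1) N * z powr (- (\<beta> + 1) - real N)) + (2 * exp 1 * exp (- z)) * (pochhammer (\<beta> + 1) 0 * 1 powr (- (\<beta> + 1) - real 0))"
    proof (rule nn_integral_approx_sum[OF _ _ G Hh])
      show "F \<in> borel_measurable lborel" unfolding F_def by measurable
      show "F v \<ge> 0" for v using P by (simp add: F_def \<phi>_def)
      show "(\<integral>\<^sup>+v. ennreal (F v) \<partial>lborel) = ennreal val"
        using phi01_integral[of \<beta> z] assms z by (simp add: F_def P_def \<phi>_def val_def)
      show "val \<ge> 0" using assms by (simp add: val_def phi01_nonneg)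
      fix v :: real
      show "\<bar>F v - (\<Sum>k<N. g k v)\<bar> \<le> H v"
      proof (cases "v > 0")
        case False
        then have "P v = 0" by (simp add: P_def power_kernel_def)
        then show ?thesis by (simp add: F_def g_def H_def)
      next
        case True
        have "F v - (\<Sum>k<N. g k v) = P v * exp (- z * v) * (\<phi> v - (\<Sum>k<N. (\<beta> gchoose k) * (- v / 2) ^ k))
            + P v * \<phi> v * exp (- 2 * z + z * v)"
        proof -
          have "g k v = P v * exp (- z * v) * ((\<beta> gchoose k) * (- v / 2) ^ k)" for k
          proof -
            have "(- v / 2) ^ k = (- 1/2) ^ k * v ^ k" by (subst power_mult_distrib[symmetric]) simp
            then show ?thesis by (simp add: g_def mult_ac)
          qed
          then have "(\<Sum>k<N. g k v) = P v * exp (- z * v) * (\<Sum>k<N. (\<beta> gchoose k) * (- v / 2) ^ k)"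
            by (simp only: sum_distrib_left)
          then show ?thesis by (simp only: F_def) (simp only: ring_distribs mult_ac)
        qed
        also have "\<bar>\<dots>\<bar> \<le> P v * exp (- z * v) * (C1 * v ^ N) + 2 * exp 1 * exp (- z) * (P v * exp (- v))"
        proof (rule order.trans[OF abs_triangle_ineq add_mono])
          show "\<bar>P v * exp (- z * v) * (\<phi> v - (\<Sum>k<N. (\<beta> gchoose k) * (- v / 2) ^ k))\<bar> \<le> P v * exp (- z * v) * (C1 * v ^ N)"
            using C1(2)[OF True] P[of v] by (simp add: abs_mult \<phi>_def mult_left_mono)
          show "\<bar>P v * \<phi> v * exp (- 2 * z + z * v)\<bar> \<le> 2 * exp 1 * exp (- z) * (P v * exp (- v))"
          proof (cases "v < 1")
            case v1: True
            have "- 2 * z + z * v \<le> - z" using v1 z by (simp add: mult_left_le)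
            moreover have "exp 1 * exp (- v) \<ge> 1" using v1 by (simp add: exp_add[symmetric] flip: exp_minus)
            ultimately have "exp (- 2 * z + z * v) * 1 \<le> exp (- z) * (exp 1 * exp (- v))"
              by (intro mult_mono) auto
            moreover have "\<phi> v \<le> 2" "\<phi> v \<ge> 0" using M[OF True v1] v1 by (auto simp: \<phi>_def)
            ultimately have "\<phi> v * exp (- 2 * z + z * v) \<le> 2 * (exp (- z) * (exp 1 * exp (- v)))"
              by (intro mult_mono) auto
            then have "P v * (\<phi> v * exp (- 2 * z + z * v)) \<le> P v * (2 * (exp (- z) * (exp 1 * exp (- v))))"
              using P[of v] by (rule mult_left_mono)
            then show ?thesis using P[of v] \<open>\<phi> v \<ge> 0\<close> by (simp add: abs_mult mult_ac)
          qed (use P[of v] in \<open>simp add: \<phi>_def\<close>)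
        qed
        also have "\<dots> = H v" by (simp add: H_def mult_ac)
        finally show ?thesis .
      qed
    qed
    also have "\<dots> = C1 * pochhammer (\<beta> + 1) N * z powr (- (\<beta> + 1 + real N)) + 2 * exp 1 * exp (- z)"
      by (simp add: algebra_simps)
    also have "\<dots> \<le> C * z powr (- (\<beta> + 1 + real N))"
      using mult_left_mono[OF C2(2)[OF z], of "2 * exp 1"] by (simp add: C_def algebra_simps)
    finally have main: "\<bar>val - (\<Sum>k<N. ((\<beta> gchoose k) * (- 1/2) ^ k) * (pochhammer (\<beta> + 1) k * z powr (- (\<beta> + 1) - real k)))\<bar>
       \<le> C * z powr (- (\<beta> + 1 + real N))" .
    have zk: "z powr (\<beta> + 1) * z powr (- (\<beta> + 1) - real k) = 1 / z ^ k" for k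
      using z by (simp add: powr_add[symmetric] powr_minus powr_realpow divide_inverse)
    \<comment> \<open>The binomial coefficient with its sign is the Pochhammer symbol of - \<beta>
      over k!; for \<nu> = \<beta> + 3/2 the two arguments are 3/2 - \<nu> and \<nu> - 1/2.\<close>
    have bc: "((\<beta> gchoose k) * (- 1/2) ^ k) * (pochhammer (\<beta> + 1) k * y) = bessel_coeff (\<beta> + 3/2) k * y" for k y
    proof -
      have "(- 1/2 :: real) ^ k = (- 1) ^ k / 2 ^ k" by (rule power_divide)
      then show ?thesis
        by (simp add: bessel_coeff_def gbinomial_pochhammer power_mult_distrib[symmetric] add.commute mult_ac)
    qed
    have lhs: "phi01 (\<beta> + 3/2) (z\<^sup>2 / 4) * (z / 2) powr (\<beta> + 1/2) * sqrt (2 * pi * z) * exp (- z) = z powr (\<beta> + 1) * val"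
    proof -
      have "(z / 2) powr (\<beta> + 1/2) * sqrt (2 * pi * z) = z powr (\<beta> + 1) * sqrt pi * 2 powr (- \<beta>)"
      proof -
        have "sqrt (2 * pi * z) = sqrt pi * (2 powr (1/2) * z powr (1/2))"
          using z by (simp add: real_sqrt_mult powr_half_sqrt)
        moreover have "(z / 2) powr (\<beta> + 1/2) = z powr (\<beta> + 1/2) * 2 powr (- (\<beta> + 1/2))"
        proof -
          have "(z / 2) powr (\<beta> + 1/2) = z powr (\<beta> + 1/2) / 2 powr (\<beta> + 1/2)"
            by (subst powr_divide) (use z in auto)
          then show ?thesis by (simp only: powr_minus divide_inverse)
        qed
        moreover have "z powr (\<beta> + 1/2) * z powr (1/2) = z powr (\<beta> + 1)"
          "(2::real) powr (- (\<beta> + 1/2)) * 2 powr (1/2) = 2 powr (- \<beta>)"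
          by (simp_all add: add.commute flip: powr_add)
        moreover have "(A * B) * (S * (D * G)) = (A * G) * S * (B * D)" for A B S D G :: real
          by (simp only: mult_ac)
        ultimately show ?thesis by (simp only:)
      qed
      moreover have "X * A * B * E = X * (A * B) * E" "X * (A * S * D) * E = A * (X * S * D * E)" for X A B S D E :: real
        by (simp_all only: mult_ac)
      ultimately show ?thesis unfolding val_def by (simp only:)
    qed
    have rhs: "(\<Sum>k<N. bessel_coeff (\<beta> + 3/2) k / z ^ k)
        = z powr (\<beta> + 1) * (\<Sum>k<N. ((\<beta> gchoose k) * (- 1/2) ^ k) * (pochhammer (\<beta> + 1) k * z powr (- (\<beta> + 1) - real k)))"
      unfolding bc sum_distrib_left
    proof (intro sum.cong refl)
      fix k
      have "z powr (\<beta> + 1) * (bessel_coeff (\<beta> + 3/2) k * z powr (- (\<beta> + 1) - real k))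
          = bessel_coeff (\<beta> + 3/2) k * (z powr (\<beta> + 1) * z powr (- (\<beta> + 1) - real k))" by (simp only: mult_ac)
      then show "bessel_coeff (\<beta> + 3/2) k / z ^ k = z powr (\<beta> + 1) * (bessel_coeff (\<beta> + 3/2) k * z powr (- (\<beta> + 1) - real k))"
        unfolding zk by simp
    qed
    show "\<bar>phi01 (\<beta> + 3/2) (z\<^sup>2 / 4) * (z / 2) powr (\<beta> + 1/2) * sqrt (2 * pi * z) * exp (- z)
      - (\<Sum>k<N. bessel_coeff (\<beta> + 3/2) k / z ^ k)\<bar> \<le> C / z ^ N"
    proof -
      have "z powr (\<beta> + 1) * (C * z powr (- (\<beta> + 1 + real N))) = C / z ^ N"
        using zk[of N] by (simp add: algebra_simps)
      then show ?thesis
        unfolding lhs rhs right_diff_distrib[symmetric] abs_mult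
        using mult_left_mono[OF main, of "z powr (\<beta> + 1)"] by simp
    qed
  qed
qed

text \<open>For n = 1 Poisson's integral diverges, but phi01 (1/2) is elementary.\<close>

lemma phi01_asymptotic:
  assumes "n \<ge> 1" "\<nu> = real n / 2"
  obtains C where "C \<ge> 0" and "\<And>z. z \<ge> 1 \<Longrightarrow>
    \<bar>phi01 \<nu> (z\<^sup>2 / 4) * (z / 2) powr (\<nu> - 1) * sqrt (2 * pi * z) * exp (- z)
      - (\<Sum>k<N. bessel_coeff \<nu> k / z ^ k)\<bar> \<le> C / z ^ N"
proof (cases "n = 1")
  case False
  then have "\<nu> - 3/2 \<ge> - 1/2" using assms by simp
  then show thesis
    using phi01_asymptotic_Watson[of "\<nu> - 3/2" N] that by (simp add: algebra_simps) blast
next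
  case True
  then have \<nu>: "\<nu> = 1/2" using assms by simp
  obtain C0 where C0: "C0 \<ge> 0" "\<And>z::real. z \<ge> 1 \<Longrightarrow> exp (- z) \<le> C0 * z powr (- real N)"
    using exp_minus_le_powr[of "real N"] by blast
  show thesis
  \<comment> \<open>The extra 1 pays for N = 0, where the empty sum leaves the leading term 1 in the
    remainder.\<close>
  proof (rule that[of "C0 + 1"])
    show "C0 + 1 \<ge> 0" using C0 by simp
    fix z :: real assume z: "z \<ge> 1"
    \<comment> \<open>Since \<nu> - 1/2 = 0, the expansion stops after its first term; what remains
      is exponentially small.\<close>
    have b: "bessel_coeff \<nu> k = (if k = 0 then 1 else 0)" for k
      by (simp add: bessel_coeff_def \<nu> pochhammer_0_left)
    have "sqrt (z\<^sup>2 / 4) * 2 = z" using z by (simp add: real_sqrt_divide)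
    then have ph: "phi01 \<nu> (z\<^sup>2 / 4) = cosh z / sqrt pi" by (simp add: \<nu> phi01_half mult.commute)
    have "(z / 2) powr (\<nu> - 1) * sqrt (2 * pi * z) = 2 * sqrt pi"
    proof -
      have "(z / 2) powr (\<nu> - 1) = 1 / sqrt (z / 2)"
        using z powr_minus_divide[of "z / 2" "1/2"] powr_half_sqrt[of "z / 2"] by (simp add: \<nu>)
      moreover have "sqrt (2 * pi * z) = sqrt (z / 2) * (2 * sqrt pi)"
      proof -
        have "2 * pi * z = (z / 2) * (2\<^sup>2 * pi)" by simp
        then show ?thesis by (metis real_sqrt_mult real_sqrt_abs abs_numeral)
      qed
      ultimately show ?thesis using z by simp
    qed
    then have "phi01 \<nu> (z\<^sup>2 / 4) * (z / 2) powr (\<nu> - 1) * sqrt (2 * pi * z) * exp (- z) = 2 * cosh z * exp (- z)"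
      unfolding ph by (simp add: mult.assoc)
    also have "\<dots> = 1 + exp (- z) * exp (- z)"
      by (simp add: cosh_field_def distrib_right exp_minus)
    finally have e: "phi01 \<nu> (z\<^sup>2 / 4) * (z / 2) powr (\<nu> - 1) * sqrt (2 * pi * z) * exp (- z) = 1 + exp (- z) * exp (- z)" .
    have s: "(\<Sum>k<N. bessel_coeff \<nu> k / z ^ k) = (if N = 0 then 0 else 1)"
      unfolding b by (simp add: if_distrib[of "\<lambda>x. x / _"] sum.delta cong: if_cong)
    have "exp (- z) * exp (- z) \<le> exp (- z) * 1" using z by (intro mult_left_mono) auto
    also have "\<dots> \<le> C0 / z ^ N" using C0(2)[OF z] z by (simp add: powr_minus powr_realpow divide_inverse)
    finally have le: "exp (- z) * exp (- z) \<le> C0 / z ^ N" .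
    have "0 \<le> 1 / z ^ N" using z by simp
    then show "\<bar>phi01 \<nu> (z\<^sup>2 / 4) * (z / 2) powr (\<nu> - 1) * sqrt (2 * pi * z) * exp (- z)
      - (\<Sum>k<N. bessel_coeff \<nu> k / z ^ k)\<bar> \<le> (C0 + 1) / z ^ N"
    proof (cases "N = 0")
      case True
      then show ?thesis unfolding e s using le by simp
    next
      case False
      have "\<bar>1 + exp (- z) * exp (- z) - 1\<bar> = exp (- z) * exp (- z)" by simp
      then show ?thesis
        using False le \<open>0 \<le> 1 / z ^ N\<close> unfolding e s add_divide_distrib by (simp only: if_False)
    qed
  qed
qed

section \<open>Moments and Kummer's function\<close>

text \<open>The Chu-Vandermonde sum for the arguments - k and 1 - \<nu> - m, reached by reflecting
  (\<nu> + k)_m into (-1)^m (1 - \<nu> - k - m)_m. The signs cancel after reflecting back.\<close>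

lemma pochhammer_ratio_shift:
  assumes "\<nu> > (0::real)"
  shows "pochhammer (\<nu> + real k) m / pochhammer \<nu> m
    = (\<Sum>j\<le>m. real (m choose j) * real (k choose j) * fact j / pochhammer \<nu> j)"
proof -
  have "pochhammer (\<nu> + real k) m = (- 1) ^ m * pochhammer (- real k + (1 - \<nu> - real m)) m"
    using pochhammer_minus[of "\<nu> + real k + real m - 1" m] by (simp add: algebra_simps power_mult_distrib[symmetric])
  also have "\<dots> = (\<Sum>j\<le>m. (- 1) ^ m * (real (m choose j) * pochhammer (- real k) j * pochhammer (1 - \<nu> - real m) (m - j)))"
    unfolding pochhammer_binomial_sum by (simp only: sum_distrib_left)
  also have "\<dots> = (\<Sum>j\<le>m. real (m choose j) * real (k choose j) * fact j * pochhammer (\<nu> + real j) (m - j))"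
  proof (intro sum.cong refl)
    fix j assume "j \<in> {..m}"
    then have j: "j \<le> m" by simp
    have 1: "pochhammer (1 - \<nu> - real m) (m - j) = (- 1) ^ (m - j) * pochhammer (\<nu> + real j) (m - j)"
      using pochhammer_minus[of "\<nu> + real m - 1" "m - j"] j by (simp add: of_nat_diff algebra_simps)
    have 2: "pochhammer (- real k) j = (- 1) ^ j * (real (k choose j) * fact j)"
      by (simp add: binomial_gbinomial gbinomial_pochhammer mult.assoc[symmetric] power_mult_distrib[symmetric])
    have 3: "(- 1 :: real) ^ m = (- 1) ^ j * (- 1) ^ (m - j)" using j by (simp flip: power_add)
    have sq: "(- 1 :: real) ^ i * (- 1) ^ i = 1" for i by (simp flip: power_mult_distrib)
    have gen: "(A * B) * (M * (A * X) * (B * Y)) = (A * A) * (B * B) * (M * X * Y)" for A B M X Y :: real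
      by (simp only: mult_ac)
    show "(- 1) ^ m * (real (m choose j) * pochhammer (- real k) j * pochhammer (1 - \<nu> - real m) (m - j))
       = real (m choose j) * real (k choose j) * fact j * pochhammer (\<nu> + real j) (m - j)"
      unfolding 1 2 3 by (subst gen) (simp only: sq mult_1 mult.assoc)
  qed
  finally have "pochhammer (\<nu> + real k) m / pochhammer \<nu> m
     = (\<Sum>j\<le>m. real (m choose j) * real (k choose j) * fact j * pochhammer (\<nu> + real j) (m - j) / pochhammer \<nu> m)"
    by (simp add: sum_divide_distrib)
  also have "\<dots> = (\<Sum>j\<le>m. real (m choose j) * real (k choose j) * fact j / pochhammer \<nu> j)"
  proof (intro sum.cong refl)
    fix j assume "j \<in> {..m}"
    then have "pochhammer \<nu> m = pochhammer \<nu> j * pochhammer (\<nu> + real j) (m - j)"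
      by (intro pochhammer_product) simp
    moreover have "pochhammer (\<nu> + real j) (m - j) > 0" "pochhammer \<nu> j > 0"
      using assms by (auto intro!: pochhammer_pos add_pos_nonneg)
    ultimately show "real (m choose j) * real (k choose j) * fact j * pochhammer (\<nu> + real j) (m - j) / pochhammer \<nu> m
        = real (m choose j) * real (k choose j) * fact j / pochhammer \<nu> j" by simp
  qed
  finally show ?thesis .
qed

text \<open>Kummer's transformation M (\<nu> + k, \<nu>, x) = exp x M (- k, \<nu>, - x), where the
  second function is a polynomial. It is obtained by multiplying that polynomial with the
  exponential series, whose shifts are \<open>e j\<close>; it also yields convergence and the second
  form of the coefficients d_k.\<close>

lemma kummer_sums:
  assumes "\<nu> > (0::real)"
  shows "(\<lambda>m. pochhammer (\<nu> + real k) m / pochhammer \<nu> m * (x ^ m / fact m)) sums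
    (exp x * (\<Sum>j\<le>k. real (k choose j) * x ^ j / pochhammer \<nu> j))"
proof -
  define e where "e j m = (if j \<le> m then x ^ m / fact (m - j) else 0)" for j m :: nat
  have e: "e j sums (x ^ j * exp x)" for j
  proof -
    have "(\<lambda>m. x ^ j * (x ^ m / fact m)) sums (x ^ j * exp x)"
      using exp_converges[of x] by (intro sums_mult) (simp add: divide_inverse mult.commute)
    then have "(\<lambda>m. e j (m + j)) sums (x ^ j * exp x)"
      by (simp add: e_def power_add mult.commute)
    then show ?thesis
      using sums_iff_shift[of "e j" j "x ^ j * exp x"] by (simp add: e_def)
  qed
  have "(\<lambda>m. \<Sum>j\<le>k. real (k choose j) / pochhammer \<nu> j * e j m) sums
      (\<Sum>j\<le>k. real (k choose j) / pochhammer \<nu> j * (x ^ j * exp x))"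
    by (intro sums_sum sums_mult e)
  moreover have "(\<Sum>j\<le>k. real (k choose j) / pochhammer \<nu> j * e j m)
      = pochhammer (\<nu> + real k) m / pochhammer \<nu> m * (x ^ m / fact m)" for m
  proof -
    have "(\<Sum>j\<le>k. real (k choose j) / pochhammer \<nu> j * e j m)
        = (\<Sum>j\<le>m. real (k choose j) / pochhammer \<nu> j * e j m)"
      by (intro sum.mono_neutral_cong) (auto simp: e_def not_le)
    also have "\<dots> = (\<Sum>j\<le>m. real (m choose j) * real (k choose j) * fact j / pochhammer \<nu> j * (x ^ m / fact m))"
    proof (intro sum.cong refl)
      fix j assume "j \<in> {..m}"
      then have j: "j \<le> m" by simp
      have "real (m choose j) * fact j / fact m = 1 / fact (m - j)"
        using j by (simp add: binomial_fact)
      then have "real (k choose j) / pochhammer \<nu> j * (x ^ m * (1 / fact (m - j)))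
          = real (k choose j) / pochhammer \<nu> j * (x ^ m * (real (m choose j) * fact j / fact m))" by simp
      then show "real (k choose j) / pochhammer \<nu> j * e j m
         = real (m choose j) * real (k choose j) * fact j / pochhammer \<nu> j * (x ^ m / fact m)"
        using j by (simp add: e_def mult_ac)
    qed
    also have "\<dots> = pochhammer (\<nu> + real k) m / pochhammer \<nu> m * (x ^ m / fact m)"
      unfolding pochhammer_ratio_shift[OF assms] sum_distrib_right ..
    finally show ?thesis .
  qed
  ultimately show ?thesis by (simp add: sum_distrib_left mult_ac)
qed

lemma kummer_M_shift:
  assumes "\<nu> > (0::real)"
  shows "kummer_M (\<nu> + real k) \<nu> x = exp x * (\<Sum>j\<le>k. real (k choose j) * x ^ j / pochhammer \<nu> j)"
  using kummer_sums[OF assms, of k x] by (simp add: kummer_M_def sums_iff)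

text \<open>The i-th moment of the noncentral gamma density after tilting by a second exponential; d
  is the scale that results from both.\<close>

definition gamma_moment :: "real \<Rightarrow> real \<Rightarrow> real \<Rightarrow> real \<Rightarrow> nat \<Rightarrow> real" where
  "gamma_moment \<nu> \<theta> c d i =
     (d / c) powr \<nu> * exp (- \<theta> * c) * pochhammer \<nu> i * d ^ i * kummer_M (\<nu> + real i) \<nu> (\<theta> * d)"

text \<open>Term by term in the mixture: \<open>t ^ i\<close> raises the index of each kernel by i,
  and the two exponentials merge into one of scale d.\<close>

lemma has_bochner_integral_gamma_moment:
  assumes "\<nu> > 0" "\<theta> \<ge> 0" "c > 0" "c' > 0" and d: "1 / d = 1 / c + 1 / c'"
  shows "has_bochner_integral lborel (\<lambda>t. t ^ i * (exp (- t / c') * noncentral_gamma \<nu> \<theta> c t)) (gamma_moment \<nu> \<theta> c d i)"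
proof (rule has_bochner_integral_nn_integral)
  have "1 / d > 0" unfolding d using assms by (simp add: add_pos_pos)
  then have d0: "d > 0" by simp
  define K where "K = 1 / (c powr \<nu> * exp (\<theta> * c))"
  have K: "K > 0" using assms by (simp add: K_def)
  let ?I = "\<lambda>t. t ^ i * (exp (- t / c') * noncentral_gamma \<nu> \<theta> c t)"
  let ?u = "\<lambda>k. K * (\<theta> ^ k / fact k * pochhammer (\<nu> + real k) i)"
  let ?e = "\<lambda>k t. power_kernel (\<nu> + real k + real i) t * exp (- t / d)"
  let ?v = "\<lambda>k. K * d powr \<nu> * d ^ i * pochhammer \<nu> i * (pochhammer (\<nu> + real i) k / pochhammer \<nu> k * ((\<theta> * d) ^ k / fact k))"
  have pk: "power_kernel (\<nu> + real k) t * t ^ i = pochhammer (\<nu> + real k) i * power_kernel (\<nu> + real k + real i) t" for k t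
  proof -
    have p: "\<nu> + real k > 0" using assms by simp
    then have "pochhammer (\<nu> + real k) i = Gamma (\<nu> + real k + real i) / Gamma (\<nu> + real k)"
      by (intro pochhammer_Gamma) (auto dest: nonpos_Ints_nonpos)
    moreover have "Gamma (\<nu> + real k) > 0" "Gamma (\<nu> + real k + real i) > 0"
      using p by (auto intro!: Gamma_real_pos add_pos_nonneg)
    moreover have "t powr (\<nu> + real k - 1) * t ^ i = t powr (\<nu> + real k + real i - 1)" if "t > 0"
      using that by (simp add: powr_realpow[symmetric] powr_add[symmetric] algebra_simps)
    ultimately show ?thesis by (simp add: power_kernel_def)
  qed
  have ex: "exp (- t / c') * exp (- t / c) = exp (- t / d)" for t
  proof -
    have "- t / d = - t * (1 / d)" by simp
    also have "\<dots> = - t / c' + - t / c" unfolding d by (simp add: algebra_simps)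
    finally show ?thesis by (simp only: exp_add)
  qed
  have ph: "pochhammer (\<nu> + real k) i \<ge> 0" for k using assms by (intro pochhammer_nonneg) (simp add: add_pos_nonneg)
  have pkn: "power_kernel (\<nu> + real k + real i) t \<ge> 0" for k t
    using assms by (intro power_kernel_nonneg) simp
  have "(\<integral>\<^sup>+t. ennreal (?I t) \<partial>lborel)
     = (\<integral>\<^sup>+t. (\<Sum>k. ennreal (?u k) * ennreal (?e k t)) \<partial>lborel)"
  proof (intro nn_integral_cong)
    fix t :: real
    show "ennreal (?I t)
      = (\<Sum>k. ennreal (?u k) * ennreal (?e k t))"
    proof (cases "t > 0")
      case True
      have "t ^ i * (exp (- t / c') * noncentral_gamma \<nu> \<theta> c t) = K * t ^ i * (exp (- t / c') * exp (- t / c)) * phi01_kernel \<nu> \<theta> t"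
        by (simp add: noncentral_gamma_def K_def)
      also have "\<dots> = (K * t ^ i * exp (- t / d)) * phi01_kernel \<nu> \<theta> t" by (simp only: ex)
      also have "ennreal \<dots> = ennreal (K * t ^ i * exp (- t / d)) * ennreal (phi01_kernel \<nu> \<theta> t)"
        using K True by (intro ennreal_mult') simp
      also have "ennreal (phi01_kernel \<nu> \<theta> t) = (\<Sum>k. ennreal (\<theta> ^ k / fact k) * ennreal (power_kernel (\<nu> + real k) t))"
        by (rule ennreal_phi01_kernel_series[OF assms(1,2)])
      finally have "ennreal (?I t)
         = ennreal (K * t ^ i * exp (- t / d)) * (\<Sum>k. ennreal (\<theta> ^ k / fact k) * ennreal (power_kernel (\<nu> + real k) t))" .
      also have "\<dots> = (\<Sum>k. ennreal (K * t ^ i * exp (- t / d)) * (ennreal (\<theta> ^ k / fact k) * ennreal (power_kernel (\<nu> + real k) t)))"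
        by simp
      also have "\<dots> = (\<Sum>k. ennreal (?u k) * ennreal (?e k t))"
      proof (intro suminf_cong)
        fix k
        have "(K * t ^ i * exp (- t / d)) * (\<theta> ^ k / fact k * power_kernel (\<nu> + real k) t)
            = K * (\<theta> ^ k / fact k) * exp (- t / d) * (power_kernel (\<nu> + real k) t * t ^ i)" by (simp only: mult_ac)
        also have "\<dots> = ?u k * (?e k t)"
          unfolding pk by (simp only: mult_ac)
        finally have eq: "(K * t ^ i * exp (- t / d)) * (\<theta> ^ k / fact k * power_kernel (\<nu> + real k) t)
             = ?u k * (?e k t)" .
        show "ennreal (K * t ^ i * exp (- t / d)) * (ennreal (\<theta> ^ k / fact k) * ennreal (power_kernel (\<nu> + real k) t))
          = ennreal (?u k) * ennreal (?e k t)"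
        proof -
          have "ennreal (K * t ^ i * exp (- t / d)) * (ennreal (\<theta> ^ k / fact k) * ennreal (power_kernel (\<nu> + real k) t))
             = ennreal ((K * t ^ i * exp (- t / d)) * (\<theta> ^ k / fact k * power_kernel (\<nu> + real k) t))"
            using K True assms by (subst ennreal_mult'[symmetric], simp, subst ennreal_mult'[symmetric]) auto
          also have "\<dots> = ennreal (?u k) * ennreal (?e k t)"
            unfolding eq using K assms ph[of k] by (intro ennreal_mult') simp
          finally show ?thesis .
        qed
      qed
      finally show ?thesis .
    qed (simp add: noncentral_gamma_def phi01_kernel_def power_kernel_def)
  qed
  also have "\<dots> = (\<Sum>k. ennreal (?u k) * (\<integral>\<^sup>+t. ennreal (?e k t) \<partial>lborel))"
    by (subst nn_integral_suminf, measurable) (intro suminf_cong nn_integral_cmult, measurable)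
  also have "\<dots> = (\<Sum>k. ennreal (?u k) * ennreal (d powr (\<nu> + real k + real i)))"
    using assms d0 by (subst nn_integral_power_kernel_exp) (auto intro: add_pos_nonneg)
  also have "\<dots> = (\<Sum>k. ennreal (?v k))"
  proof (intro suminf_cong)
    fix k
    have "pochhammer \<nu> (k + i) = pochhammer \<nu> k * pochhammer (\<nu> + real k) i"
      by (rule pochhammer_product')
    moreover have "pochhammer \<nu> (i + k) = pochhammer \<nu> i * pochhammer (\<nu> + real i) k"
      by (rule pochhammer_product')
    moreover have "pochhammer \<nu> k > 0" using assms by (intro pochhammer_pos)
    \<comment> \<open>Writing (\<nu>)_(k+i) in two ways moves k out of the base of the symbol; the
      series in k is then Kummer's with upper parameter \<nu> + i.\<close>
    ultimately have 1: "pochhammer (\<nu> + real k) i = pochhammer \<nu> i * pochhammer (\<nu> + real i) k / pochhammer \<nu> k"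
      by (simp add: field_simps add.commute[of k])
    have 2: "d powr (\<nu> + real k + real i) = d powr \<nu> * d ^ k * d ^ i"
      using d0 by (simp add: powr_add powr_realpow)
    have "?u k * d powr (\<nu> + real k + real i)
        = ?v k"
      unfolding 1 2 by (simp add: power_mult_distrib mult_ac)
    then show "ennreal (?u k) * ennreal (d powr (\<nu> + real k + real i))
       = ennreal (?v k)"
      by (simp add: ennreal_mult''[symmetric])
  qed
  also have "\<dots> = ennreal (\<Sum>k. ?v k)"
  proof (rule suminf_ennreal2)
    show "summable (\<lambda>k. ?v k)"
      using kummer_sums[of \<nu> i "\<theta> * d"] assms by (intro summable_mult) (simp add: sums_iff)
    show "0 \<le> ?v k" for k
      using K d0 assms by (intro mult_nonneg_nonneg divide_nonneg_nonneg pochhammer_nonneg zero_le_power) auto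
  qed
  also have "(\<Sum>k. ?v k)
      = K * d powr \<nu> * d ^ i * pochhammer \<nu> i * kummer_M (\<nu> + real i) \<nu> (\<theta> * d)"
    unfolding kummer_M_def using kummer_sums[of \<nu> i "\<theta> * d"] assms by (intro suminf_mult) (simp add: sums_iff)
  also have "\<dots> = gamma_moment \<nu> \<theta> c d i"
    by (simp add: gamma_moment_def K_def powr_divide exp_minus field_simps)
  finally show "(\<integral>\<^sup>+t. ennreal (?I t) \<partial>lborel) = ennreal (gamma_moment \<nu> \<theta> c d i)" .
  have "kummer_M (\<nu> + real i) \<nu> (\<theta> * d) \<ge> 0"
    using assms d0 by (subst kummer_M_shift) (auto intro!: mult_nonneg_nonneg sum_nonneg divide_nonneg_nonneg pochhammer_nonneg)
  then show "0 \<le> gamma_moment \<nu> \<theta> c d i"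
    using assms d0 by (auto simp: gamma_moment_def intro!: mult_nonneg_nonneg pochhammer_nonneg)
  show "AE t in lborel. 0 \<le> t ^ i * (exp (- t / c') * noncentral_gamma \<nu> \<theta> c t)"
  proof (rule AE_I2)
    fix t :: real
    show "0 \<le> t ^ i * (exp (- t / c') * noncentral_gamma \<nu> \<theta> c t)"
    proof (cases "t > 0")
      case True
      then show ?thesis using noncentral_gamma_nonneg[OF assms(1,2)] by (intro mult_nonneg_nonneg) auto
    qed (simp add: noncentral_gamma_def phi01_kernel_def)
  qed
qed measurable

text \<open>The error may grow like exp (t / c') because the tilt cancels precisely that; what is
  left is C times a density of total mass 1. The polynomials in t turn into moments.\<close>

lemma integrate_expansion:
  assumes "\<nu> > 0" "\<theta> \<ge> 0" "c > 0" "c' > 0" and d: "1 / d = 1 / c + 1 / c'"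
    and [measurable]: "E \<in> borel_measurable borel" and E: "\<And>t. t > 0 \<Longrightarrow> E t \<ge> 0"
    and bound: "\<And>t. t > 0 \<Longrightarrow> \<bar>E t - (\<Sum>l<N. (\<Sum>i\<le>l. k l i * t ^ i) * w ^ l)\<bar> \<le> C * exp (1 / c' * t)"
    and val: "(\<integral>\<^sup>+t. ennreal (E t * (exp (- t / c') * noncentral_gamma \<nu> \<theta> c t)) \<partial>lborel) = ennreal val" "val \<ge> 0"
  shows "\<bar>val - (\<Sum>l<N. (\<Sum>i\<le>l. k l i * gamma_moment \<nu> \<theta> c d i) * w ^ l)\<bar> \<le> C"
proof -
  define p where "p t = exp (- t / c') * noncentral_gamma \<nu> \<theta> c t" for t
  have [measurable]: "p \<in> borel_measurable borel" unfolding p_def by measurable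
  have p_nonneg: "p t \<ge> 0" for t using noncentral_gamma_nonneg[OF assms(1,2)] by (simp add: p_def)
  have p0: "p t = 0" if "\<not> t > 0" for t using that by (simp add: p_def noncentral_gamma_def phi01_kernel_def)
  have mom: "has_bochner_integral lborel (\<lambda>t. t ^ i * p t) (gamma_moment \<nu> \<theta> c d i)" for i
    unfolding p_def using has_bochner_integral_gamma_moment[OF assms(1-5)] .
  have H: "has_bochner_integral lborel (\<lambda>t. C * noncentral_gamma \<nu> \<theta> c t) (C * 1)"
    by (intro has_bochner_integral_mult_right has_bochner_integral_nn_integral)
      (use nn_integral_noncentral_gamma[OF assms(1-3)] noncentral_gamma_nonneg[OF assms(1,2)] in auto)
  have g: "has_bochner_integral lborel (\<lambda>t. ((\<Sum>i\<le>l. k l i * (t ^ i * p t))) * w ^ l) ((\<Sum>i\<le>l. k l i * gamma_moment \<nu> \<theta> c d i) * w ^ l)" for l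
    by (intro has_bochner_integral_mult_left has_bochner_integral_sum has_bochner_integral_mult_right mom)
  have "\<bar>val - (\<Sum>l<N. (\<Sum>i\<le>l. k l i * gamma_moment \<nu> \<theta> c d i) * w ^ l)\<bar> \<le> C * 1"
  proof (rule nn_integral_approx_sum[OF _ _ g H])
    show "(\<lambda>t. E t * p t) \<in> borel_measurable lborel" by measurable
    show "E t * p t \<ge> 0" for t using E[of t] p_nonneg[of t] p0[of t] by (cases "t > 0") auto
    show "(\<integral>\<^sup>+t. ennreal (E t * p t) \<partial>lborel) = ennreal val" using val by (simp add: p_def)
    show "val \<ge> 0" by fact
    fix t :: real
    show "\<bar>E t * p t - (\<Sum>l<N. (\<Sum>i\<le>l. k l i * (t ^ i * p t)) * w ^ l)\<bar> \<le> C * noncentral_gamma \<nu> \<theta> c t"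
    proof (cases "t > 0")
      case True
      have "(\<Sum>l<N. (\<Sum>i\<le>l. k l i * (t ^ i * p t)) * w ^ l) = (\<Sum>l<N. (\<Sum>i\<le>l. k l i * t ^ i) * w ^ l) * p t"
      proof -
        have "(\<Sum>i\<le>l. k l i * (t ^ i * p t)) * w ^ l = (\<Sum>i\<le>l. k l i * t ^ i) * w ^ l * p t" for l
        proof -
          have sp: "(\<Sum>i\<le>l. k l i * (t ^ i * p t)) = (\<Sum>i\<le>l. k l i * t ^ i) * p t"
            by (simp only: sum_distrib_right mult.assoc)
          show ?thesis unfolding sp by (simp only: mult_ac)
        qed
        then show ?thesis by (simp only: sum_distrib_right[of _ _ "p t"])
      qed
      then have "\<bar>E t * p t - (\<Sum>l<N. (\<Sum>i\<le>l. k l i * (t ^ i * p t)) * w ^ l)\<bar>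
          = \<bar>E t - (\<Sum>l<N. (\<Sum>i\<le>l. k l i * t ^ i) * w ^ l)\<bar> * p t"
        using p_nonneg[of t] by (simp only: left_diff_distrib[symmetric] abs_mult abs_of_nonneg)
      also have "\<dots> \<le> C * exp (1 / c' * t) * p t"
        using bound[OF True] p_nonneg[of t] by (rule mult_right_mono)
      also have "\<dots> = C * noncentral_gamma \<nu> \<theta> c t"
      proof -
        have "exp (1 / c' * t) * exp (- t / c') = 1" by (simp flip: exp_add)
        then have "C * (exp (1 / c' * t) * exp (- t / c')) * noncentral_gamma \<nu> \<theta> c t = C * noncentral_gamma \<nu> \<theta> c t"
          by simp
        then show ?thesis unfolding p_def by (simp only: mult.assoc)
      qed
      finally show ?thesis .
    qed (simp add: p0 noncentral_gamma_def phi01_kernel_def)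
  qed
  then show ?thesis by simp
qed

section \<open>The tail of a difference of noncentral gamma variables\<close>

text \<open>At z = (b / w) sqrt (1 + t w^2) the power 1 / z^k is (w / b)^k times (1 + t w^2)^(- k /
  2). So the k-th Hankel term is again a Puiseux function, with a lowered by k / 2, which explains
  the shifted argument in the coefficients. The condition w \<le> b guarantees z \<ge> 1.\<close>

lemma bessel_puiseux_remainder:
  fixes \<beta> :: "nat \<Rightarrow> real" and T :: "real \<Rightarrow> real"
  assumes T: "\<And>z. z \<ge> 1 \<Longrightarrow> \<bar>T z - (\<Sum>k<N. \<beta> k / z ^ k)\<bar> \<le> C0 / z ^ N"
    and "C0 \<ge> 0" "b > 0" "\<epsilon> > 0"
  obtains C where "C \<ge> 0"
    and "\<And>t w. t \<ge> 0 \<Longrightarrow> w > 0 \<Longrightarrow> w \<le> 1 \<Longrightarrow> w \<le> b \<Longrightarrow>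
      \<bar>puiseux_fun a b t w * T (b / w * sqrt (1 + t * w\<^sup>2))
        - (\<Sum>l<N. (\<Sum>j\<le>l. \<beta> (l - j) / b ^ (l - j) * puiseux_poly (a - real (l - j) / 2) b j t) * w ^ l)\<bar>
      \<le> C * w ^ N * exp (\<epsilon> * t)"
proof -
  \<comment> \<open>Order N - k suffices since the k-th term carries \<open>w ^ k\<close>. The case
    k = N, of order 0, is a plain bound on the Puiseux function and serves for Hankel's remainder.
    The constants for all k are fixed by choice.\<close>
  define good where "good k C \<longleftrightarrow> C \<ge> 0 \<and> (\<forall>t w. t \<ge> 0 \<longrightarrow> w > 0 \<longrightarrow> w \<le> 1 \<longrightarrow>
     \<bar>puiseux_fun (a - real k / 2) b t w - (\<Sum>j<N - k. puiseux_poly (a - real k / 2) b j t * w ^ j)\<bar>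
       \<le> C * w ^ (N - k) * exp (\<epsilon> * t))" for k C
  have "\<exists>C. good k C" for k
  proof (rule puiseux_remainder[OF \<open>\<epsilon> > 0\<close>, of "a - real k / 2" b "N - k"])
    fix C assume "C \<ge> 0" and "\<And>t w. t \<ge> 0 \<Longrightarrow> w > 0 \<Longrightarrow> w \<le> 1 \<Longrightarrow>
     \<bar>puiseux_fun (a - real k / 2) b t w - (\<Sum>j<N - k. puiseux_poly (a - real k / 2) b j t * w ^ j)\<bar>
       \<le> C * w ^ (N - k) * exp (\<epsilon> * t)"
    then show "\<exists>C. good k C" unfolding good_def by (intro exI[of _ C] conjI allI impI)
  qed
  define Ck where "Ck k = (SOME C. good k C)" for k
  have good: "good k (Ck k)" for k unfolding Ck_def by (rule someI_ex) fact
  have Ck: "Ck k \<ge> 0" "\<And>t w. t \<ge> 0 \<Longrightarrow> w > 0 \<Longrightarrow> w \<le> 1 \<Longrightarrow>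
     \<bar>puiseux_fun (a - real k / 2) b t w - (\<Sum>j<N - k. puiseux_poly (a - real k / 2) b j t * w ^ j)\<bar>
       \<le> Ck k * w ^ (N - k) * exp (\<epsilon> * t)" for k
    using good[of k] unfolding good_def by simp_all
  define C where "C = C0 / b ^ N * Ck N + (\<Sum>k<N. \<bar>\<beta> k\<bar> / b ^ k * Ck k)"
  show thesis
  proof (rule that[of C])
    show "C \<ge> 0" unfolding C_def using Ck(1) assms by (intro add_nonneg_nonneg sum_nonneg) auto
    fix t w :: real assume tw: "t \<ge> 0" "w > 0" "w \<le> 1" "w \<le> b"
    define q where "q = sqrt (1 + t * w\<^sup>2)"
    define z where "z = b / w * q"
    have q: "q \<ge> 1" using tw by (simp add: q_def)
    have z: "z \<ge> 1" using mult_mono[of 1 "b / w" 1 q] q tw by (simp add: z_def)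
    have zk: "puiseux_fun a b t w / z ^ k = w ^ k / b ^ k * puiseux_fun (a - real k / 2) b t w" for k
    proof -
      have "q ^ k = (1 + t * w\<^sup>2) powr (real k / 2)"
        unfolding q_def using tw by (intro sqrt_power_eq_powr) (simp add: add_pos_nonneg)
      then have "puiseux_fun (a - real k / 2) b t w = puiseux_fun a b t w / q ^ k"
        by (simp add: puiseux_fun_def powr_diff)
      then show ?thesis by (simp add: z_def power_mult_distrib power_divide)
    qed
    have PF: "puiseux_fun a b t w \<ge> 0" by (simp add: puiseux_fun_def)
    define S where "S = (\<Sum>k<N. \<beta> k / z ^ k)"
    define R where "R k = puiseux_fun (a - real k / 2) b t w - (\<Sum>j<N - k. puiseux_poly (a - real k / 2) b j t * w ^ j)" for k
    have S: "puiseux_fun a b t w * S = (\<Sum>k<N. \<beta> k / b ^ k * w ^ k * puiseux_fun (a - real k / 2) b t w)"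
    proof -
      have "puiseux_fun a b t w * (\<beta> k / z ^ k) = \<beta> k * (puiseux_fun a b t w / z ^ k)" for k by simp
      then show ?thesis by (simp add: S_def sum_distrib_left zk mult_ac)
    qed
    \<comment> \<open>The triangle j + k < N is summed by l = j + k on one side and by k on the
      other, so no terms beyond order N arise.\<close>
    have main: "(\<Sum>l<N. (\<Sum>j\<le>l. \<beta> (l - j) / b ^ (l - j) * puiseux_poly (a - real (l - j) / 2) b j t) * w ^ l)
       = (\<Sum>k<N. \<beta> k / b ^ k * w ^ k * (\<Sum>j<N - k. puiseux_poly (a - real k / 2) b j t * w ^ j))"
    proof -
      define f where "f j k = \<beta> k / b ^ k * puiseux_poly (a - real k / 2) b j t * w ^ (j + k)" for j k
      have "(\<Sum>l<N. (\<Sum>j\<le>l. \<beta> (l - j) / b ^ (l - j) * puiseux_poly (a - real (l - j) / 2) b j t) * w ^ l)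
          = (\<Sum>l<N. \<Sum>j\<le>l. f j (l - j))"
        by (simp add: f_def sum_distrib_right)
      also have "\<dots> = (\<Sum>(j, k)\<in>{(j, k). j + k < N}. f j k)"
        by (rule sum.triangle_reindex[symmetric])
      also have "\<dots> = (\<Sum>(k, j)\<in>Sigma {..<N} (\<lambda>k. {..<N - k}). f j k)"
        by (rule sum.reindex_bij_witness[of _ "\<lambda>(k, j). (j, k)" "\<lambda>(j, k). (k, j)"]) auto
      also have "\<dots> = (\<Sum>k<N. \<Sum>j<N - k. f j k)" by (rule sum.Sigma[symmetric]) auto
      also have "\<dots> = (\<Sum>k<N. \<beta> k / b ^ k * w ^ k * (\<Sum>j<N - k. puiseux_poly (a - real k / 2) b j t * w ^ j))"
        by (simp add: f_def sum_distrib_left power_add mult_ac)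
      finally show ?thesis .
    qed
    have "puiseux_fun a b t w * T z - (\<Sum>l<N. (\<Sum>j\<le>l. \<beta> (l - j) / b ^ (l - j) * puiseux_poly (a - real (l - j) / 2) b j t) * w ^ l)
        = puiseux_fun a b t w * (T z - S) + (\<Sum>k<N. \<beta> k / b ^ k * w ^ k * R k)"
      unfolding main right_diff_distrib S R_def by (simp add: sum_subtractf)
    also have "\<bar>\<dots>\<bar> \<le> C0 / b ^ N * Ck N * w ^ N * exp (\<epsilon> * t) + (\<Sum>k<N. \<bar>\<beta> k\<bar> / b ^ k * Ck k * w ^ N * exp (\<epsilon> * t))"
    proof (rule order.trans[OF abs_triangle_ineq add_mono])
      have "\<bar>puiseux_fun a b t w * (T z - S)\<bar> \<le> puiseux_fun a b t w * (C0 / z ^ N)"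
        unfolding abs_mult abs_of_nonneg[OF PF] S_def by (intro mult_left_mono T z PF)
      also have "\<dots> = C0 * (puiseux_fun a b t w / z ^ N)" by simp
      also have "\<dots> = C0 / b ^ N * w ^ N * puiseux_fun (a - real N / 2) b t w" unfolding zk by simp
      also have "\<dots> \<le> C0 / b ^ N * w ^ N * (Ck N * exp (\<epsilon> * t))"
        using Ck(2)[of t w N] tw assms by (intro mult_left_mono) auto
      finally show "\<bar>puiseux_fun a b t w * (T z - S)\<bar> \<le> C0 / b ^ N * Ck N * w ^ N * exp (\<epsilon> * t)"
        by (simp add: mult_ac)
      show "\<bar>\<Sum>k<N. \<beta> k / b ^ k * w ^ k * R k\<bar> \<le> (\<Sum>k<N. \<bar>\<beta> k\<bar> / b ^ k * Ck k * w ^ N * exp (\<epsilon> * t))"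
      proof (rule order.trans[OF sum_abs sum_mono])
        fix k assume "k \<in> {..<N}"
        then have k: "w ^ k * w ^ (N - k) = w ^ N" by (simp flip: power_add)
        have "\<bar>\<beta> k / b ^ k * w ^ k * R k\<bar> = \<bar>\<beta> k\<bar> / b ^ k * w ^ k * \<bar>R k\<bar>"
          using tw assms by (simp add: abs_mult)
        also have "\<dots> \<le> \<bar>\<beta> k\<bar> / b ^ k * w ^ k * (Ck k * w ^ (N - k) * exp (\<epsilon> * t))"
          unfolding R_def using tw assms by (intro mult_left_mono Ck(2)) auto
        also have "\<dots> = \<bar>\<beta> k\<bar> / b ^ k * Ck k * (w ^ k * w ^ (N - k)) * exp (\<epsilon> * t)" by (simp only: mult_ac)
        finally show "\<bar>\<beta> k / b ^ k * w ^ k * R k\<bar> \<le> \<bar>\<beta> k\<bar> / b ^ k * Ck k * w ^ N * exp (\<epsilon> * t)"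
          unfolding k .
      qed
    qed
    also have "\<dots> = C * w ^ N * exp (\<epsilon> * t)"
      by (simp add: C_def sum_distrib_right distrib_right)
    finally show "\<bar>puiseux_fun a b t w * T (b / w * sqrt (1 + t * w\<^sup>2))
        - (\<Sum>l<N. (\<Sum>j\<le>l. \<beta> (l - j) / b ^ (l - j) * puiseux_poly (a - real (l - j) / 2) b j t) * w ^ l)\<bar>
      \<le> C * w ^ N * exp (\<epsilon> * t)"
      by (simp add: z_def q_def)
  qed
qed

lemma puiseux_poly_atMost: "puiseux_poly a b j t = (\<Sum>i\<le>j. puiseux_coeff a b i j * t ^ i)"
  unfolding puiseux_poly_def by (intro sum.mono_neutral_left) (auto simp: puiseux_coeff_def)

definition gamma_difference_density :: "real \<Rightarrow> real \<Rightarrow> real \<Rightarrow> real \<Rightarrow> real \<Rightarrow> real \<Rightarrow> ennreal" where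
  "gamma_difference_density \<nu> \<theta> c \<theta>' c' y =
     (\<integral>\<^sup>+t. ennreal (noncentral_gamma \<nu> \<theta> c (y + t)) * ennreal (noncentral_gamma \<nu> \<theta>' c' t) \<partial>lborel)"

text \<open>\<open>m\<close> stands for the moments that replace the powers of t; l - j is the order
  in Hankel's expansion and j that in the Puiseux expansion.\<close>

definition sqrt_expansion_coeff :: "real \<Rightarrow> real \<Rightarrow> real \<Rightarrow> (nat \<Rightarrow> real) \<Rightarrow> nat \<Rightarrow> real" where
  "sqrt_expansion_coeff a b \<nu> m l =
     (\<Sum>j\<le>l. bessel_coeff \<nu> (l - j) / b ^ (l - j) * (\<Sum>i\<le>j. puiseux_coeff (a - real (l - j) / 2) b i j * m i))"

text \<open>The common frame of both cases: once the first density at y + t is split into a part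
  \<Phi> free of t, the exponential and a factor E with a polynomial expansion, only moments of the
  tilted second density remain.\<close>

lemma gamma_difference_density_expansion:
  assumes "\<nu> > 0" "\<theta>' \<ge> 0" "c > 0" "c' > 0" and d: "1 / d = 1 / c' + 1 / c"
    and [measurable]: "E \<in> borel_measurable borel"
    and E: "\<And>t. t > 0 \<Longrightarrow> E t \<ge> 0" and \<Phi>: "\<Phi> > 0"
    and factor: "\<And>t. t > 0 \<Longrightarrow> noncentral_gamma \<nu> \<theta> c (y + t) = \<Phi> * (E t * exp (- t / c))"
    and bound: "\<And>t. t > 0 \<Longrightarrow> \<bar>E t - (\<Sum>l<N. (\<Sum>i\<le>l. k l i * t ^ i) * w ^ l)\<bar> \<le> C * exp (1 / c * t)"
    and val: "val \<ge> 0" "gamma_difference_density \<nu> \<theta> c \<theta>' c' y = ennreal val"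
  shows "\<bar>val - \<Phi> * (\<Sum>l<N. (\<Sum>i\<le>l. k l i * gamma_moment \<nu> \<theta>' c' d i) * w ^ l)\<bar> \<le> \<Phi> * C"
proof -
  let ?S = "\<Sum>l<N. (\<Sum>i\<le>l. k l i * gamma_moment \<nu> \<theta>' c' d i) * w ^ l"
  let ?I = "\<integral>\<^sup>+t. ennreal (E t * (exp (- t / c) * noncentral_gamma \<nu> \<theta>' c' t)) \<partial>lborel"
  have "ennreal val = (\<integral>\<^sup>+t. ennreal \<Phi> * ennreal (E t * (exp (- t / c) * noncentral_gamma \<nu> \<theta>' c' t)) \<partial>lborel)"
    unfolding val(2)[symmetric] gamma_difference_density_def
  proof (intro nn_integral_cong)
    fix t :: real
    show "ennreal (noncentral_gamma \<nu> \<theta> c (y + t)) * ennreal (noncentral_gamma \<nu> \<theta>' c' t)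
        = ennreal \<Phi> * ennreal (E t * (exp (- t / c) * noncentral_gamma \<nu> \<theta>' c' t))"
    proof (cases "t > 0")
      case True
      have nn: "0 \<le> \<Phi> * (E t * exp (- t / c))" using E[OF True] \<Phi> by simp
      show ?thesis unfolding factor[OF True]
        using nn \<Phi> by (simp only: ennreal_mult'[symmetric] less_imp_le mult.assoc)
    qed (simp add: noncentral_gamma_def phi01_kernel_def)
  qed
  also have "\<dots> = ennreal \<Phi> * ?I" by (rule nn_integral_cmult) measurable
  finally have "ennreal (1 / \<Phi>) * ennreal val = ennreal (1 / \<Phi>) * (ennreal \<Phi> * ?I)" by simp
  then have "?I = ennreal (val / \<Phi>)"
    using \<Phi> by (simp add: mult.assoc[symmetric] ennreal_mult'[symmetric])
  then have "\<bar>val / \<Phi> - ?S\<bar> \<le> C"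
    using E bound val \<Phi> by (intro integrate_expansion[OF assms(1,2,4,3) d, where E = E]) auto
  then have "\<Phi> * \<bar>val / \<Phi> - ?S\<bar> \<le> \<Phi> * C" using \<Phi> by (intro mult_left_mono) auto
  moreover have "\<Phi> * \<bar>val / \<Phi> - ?S\<bar> = \<bar>\<Phi> * (val / \<Phi> - ?S)\<bar>" using \<Phi> by (simp add: abs_mult)
  ultimately show ?thesis using \<Phi> by (simp add: right_diff_distrib)
qed

text \<open>With b = 2 sqrt \<theta> the Bessel function at u = y + t has the argument z = b sqrt u,
  so z^2 / 4 = \<theta> u; dividing by the leading behaviour at y leaves a Puiseux function with w =
  1 / sqrt y times the normalised Bessel function. The estimate quantifies over finite values
  \<open>val\<close>, as the density is an extended real known to be finite only almost
  everywhere.\<close>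

lemma gamma_difference_density_asymptotic:
  assumes n: "n \<ge> 1" "\<nu> = real n / 2" and th: "\<theta> > 0" "\<theta>' \<ge> 0" and c: "c > 0" "c' > 0"
    and d: "1 / d = 1 / c' + 1 / c" and b: "b = 2 * sqrt \<theta>" and a: "a = (real n - 3) / 4"
    and K: "K = (b / 2) powr (1 - \<nu>) / sqrt (2 * pi * b) / (c powr \<nu> * exp (\<theta> * c))"
  shows "\<exists>C y0. y0 > 0 \<and> (\<forall>y val. y \<ge> y0 \<longrightarrow> val \<ge> 0 \<longrightarrow> gamma_difference_density \<nu> \<theta> c \<theta>' c' y = ennreal val \<longrightarrow>
     \<bar>val - K * y powr a * exp (b * sqrt y - y / c) *
        (\<Sum>l<N. sqrt_expansion_coeff a b \<nu> (gamma_moment \<nu> \<theta>' c' d) l * y powr (- (real l * (1/2))))\<bar>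
      \<le> C * (K * y powr a * exp (b * sqrt y - y / c) * y powr (- (real N * (1/2)))))"
proof -
  have \<nu>: "\<nu> > 0" using n by simp
  have b0: "b > 0" using th b by simp
  have K0: "K > 0" using b0 c unfolding K by simp
  define T where "T z = phi01 \<nu> (z\<^sup>2 / 4) * (z / 2) powr (\<nu> - 1) * sqrt (2 * pi * z) * exp (- z)" for z
  have [measurable]: "T \<in> borel_measurable borel" unfolding T_def by measurable
  obtain C0 where C0: "C0 \<ge> 0" "\<And>z. z \<ge> 1 \<Longrightarrow> \<bar>T z - (\<Sum>k<N. bessel_coeff \<nu> k / z ^ k)\<bar> \<le> C0 / z ^ N"
    unfolding T_def using phi01_asymptotic[OF n, of N] by blast
  have "1 / c > 0" using c by simp
  then obtain C where C: "C \<ge> 0" "\<And>t w. t \<ge> 0 \<Longrightarrow> w > 0 \<Longrightarrow> w \<le> 1 \<Longrightarrow> w \<le> b \<Longrightarrow>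
      \<bar>puiseux_fun a b t w * T (b / w * sqrt (1 + t * w\<^sup>2))
        - (\<Sum>l<N. (\<Sum>j\<le>l. bessel_coeff \<nu> (l - j) / b ^ (l - j) * puiseux_poly (a - real (l - j) / 2) b j t) * w ^ l)\<bar>
      \<le> C * w ^ N * exp (1 / c * t)"
    using bessel_puiseux_remainder[OF C0(2) C0(1) b0, where \<epsilon> = "1 / c" and a = a] by blast
  \<comment> \<open>The double sum reordered by powers of t, the form in which moments are
    inserted.\<close>
  define k where "k l i = (\<Sum>j\<le>l. if i \<le> j then bessel_coeff \<nu> (l - j) / b ^ (l - j) * puiseux_coeff (a - real (l - j) / 2) b i j else 0)" for l i
  have ksum: "(\<Sum>i\<le>l. k l i * m i) = (\<Sum>j\<le>l. bessel_coeff \<nu> (l - j) / b ^ (l - j) * (\<Sum>i\<le>j. puiseux_coeff (a - real (l - j) / 2) b i j * m i))" for l and m :: "nat \<Rightarrow> real"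
  proof -
    have "(\<Sum>i\<le>l. k l i * m i) = (\<Sum>i\<le>l. \<Sum>j\<le>l. if i \<le> j then bessel_coeff \<nu> (l - j) / b ^ (l - j) * (puiseux_coeff (a - real (l - j) / 2) b i j * m i) else 0)"
      by (simp add: k_def sum_distrib_right if_distrib[of "\<lambda>x. x * _"] mult.assoc cong: if_cong)
    also have "\<dots> = (\<Sum>j\<le>l. \<Sum>i\<le>l. if i \<le> j then bessel_coeff \<nu> (l - j) / b ^ (l - j) * (puiseux_coeff (a - real (l - j) / 2) b i j * m i) else 0)"
      by (rule sum.swap)
    also have "\<dots> = (\<Sum>j\<le>l. \<Sum>i\<le>j. bessel_coeff \<nu> (l - j) / b ^ (l - j) * (puiseux_coeff (a - real (l - j) / 2) b i j * m i))"
      by (intro sum.cong refl sum.mono_neutral_cong_right) auto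
    finally show ?thesis by (simp add: sum_distrib_left)
  qed
  have T_nonneg: "T z \<ge> 0" if "z \<ge> 0" for z using that \<nu> by (simp add: T_def phi01_nonneg)
  show ?thesis
  \<comment> \<open>Beyond this point w = 1 / sqrt y is at most 1 and at most b.\<close>
  proof (rule exI[of _ C], rule exI[of _ "max 1 (1 / b\<^sup>2)"], intro conjI allI impI)
    show "max 1 (1 / b\<^sup>2) > 0" by simp
    fix y val assume y: "y \<ge> max 1 (1 / b\<^sup>2)" and val: "val \<ge> 0" "gamma_difference_density \<nu> \<theta> c \<theta>' c' y = ennreal val"
    define w where "w = 1 / sqrt y"
    have y1: "y \<ge> 1" using y by simp
    have w: "w > 0" "w \<le> 1" "w\<^sup>2 = 1 / y" using y1 by (auto simp: w_def power_divide)
    have wb: "w \<le> b"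
    proof (rule power2_le_imp_le)
      have "1 / b\<^sup>2 \<le> y" using y by simp
      then show "w\<^sup>2 \<le> b\<^sup>2" using b0 y1 unfolding w(3) by (simp add: field_simps)
    qed (use b0 in simp)
    define \<Phi> where "\<Phi> = K * y powr a * exp (b * sqrt y - y / c)"
    have \<Phi>: "\<Phi> > 0" using K0 y1 by (simp add: \<Phi>_def)
    define E where "E t = puiseux_fun a b t w * T (b / w * sqrt (1 + t * w\<^sup>2))" for t
    have [measurable]: "E \<in> borel_measurable borel" unfolding E_def puiseux_fun_def by measurable
    have factor: "noncentral_gamma \<nu> \<theta> c (y + t) = \<Phi> * (E t * exp (- t / c))" if "t > 0" for t
    proof -
      define u where "u = y + t"
      have u: "u > 0" using that y1 by (simp add: u_def)
      have uw: "1 + t * w\<^sup>2 = u / y" using y1 unfolding w(3) u_def by (simp add: field_simps)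
      have z: "b / w * sqrt (1 + t * w\<^sup>2) = b * sqrt u"
        unfolding uw using y1 by (simp add: w_def real_sqrt_divide)
      have z2: "(b * sqrt u)\<^sup>2 / 4 = \<theta> * u" using u th by (simp add: b power_mult_distrib)
      have PF: "puiseux_fun a b t w = u powr a / y powr a * exp (b * sqrt u - b * sqrt y)"
      proof -
        have "b * (sqrt (u / y) - 1) / w = b * sqrt u - b * sqrt y"
          using y1 by (simp add: w_def real_sqrt_divide field_simps)
        then show ?thesis unfolding puiseux_fun_def uw by (simp add: powr_divide)
      qed
      have "(b * sqrt u / 2) powr (\<nu> - 1) * sqrt (2 * pi * (b * sqrt u))
         = (b / 2) powr (\<nu> - 1) * sqrt (2 * pi * b) * u powr (\<nu> - 1 - a)"
      proof -
        have "(b * sqrt u / 2) powr (\<nu> - 1) = (b / 2) powr (\<nu> - 1) * u powr ((\<nu> - 1) / 2)"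
        proof -
          have "b * sqrt u / 2 = (b / 2) * u powr (1/2)" using u by (simp add: powr_half_sqrt)
          then show ?thesis by (simp only: powr_mult powr_powr) simp
        qed
        moreover have "sqrt (2 * pi * (b * sqrt u)) = sqrt (2 * pi * b) * u powr (1/4)"
        proof -
          have "sqrt (sqrt u) = (u powr (1/2)) powr (1/2)" using u by (simp add: powr_half_sqrt)
          then have "sqrt (sqrt u) = u powr (1/4)" by (simp only: powr_powr) simp
          moreover have "2 * pi * (b * sqrt u) = 2 * pi * b * sqrt u" by simp
          ultimately show ?thesis by (simp only: real_sqrt_mult)
        qed
        \<comment> \<open>This fixes a: it is what remains of the exponent \<nu> - 1 after the
          algebraic factor of the Bessel asymptotics, namely (n - 3) / 4.\<close>
        moreover have "u powr ((\<nu> - 1) / 2) * u powr (1/4) = u powr (\<nu> - 1 - a)"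
          unfolding powr_add[symmetric] a n(2) by (rule arg_cong[of _ _ "(powr) u"]) (simp add: field_simps)
        moreover have "(A * B) * (D * G) = A * D * (B * G)" for A B D G :: real by (simp only: mult_ac)
        ultimately show ?thesis by (simp only:)
      qed
      then have T: "T (b * sqrt u) = phi01 \<nu> (\<theta> * u) * ((b / 2) powr (\<nu> - 1) * sqrt (2 * pi * b) * u powr (\<nu> - 1 - a)) * exp (- (b * sqrt u))"
        unfolding T_def z2 by (simp only: mult.assoc)
      have up: "u powr a * u powr (\<nu> - 1 - a) = u powr (\<nu> - 1)" by (simp flip: powr_add)
      have bp: "(b / 2) powr (1 - \<nu>) * (b / 2) powr (\<nu> - 1) = 1"
        using b0 by (simp flip: powr_add)
      have ee: "exp (b * sqrt y - y / c) * (exp (b * sqrt u - b * sqrt y) * exp (- (b * sqrt u)) * exp (- t / c)) = exp (- u / c)"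
        unfolding exp_add[symmetric] by (rule arg_cong[of _ _ exp]) (simp add: u_def add_divide_distrib diff_divide_distrib)
      have "\<Phi> * (E t * exp (- t / c)) =
         ((b / 2) powr (1 - \<nu>) * (b / 2) powr (\<nu> - 1)) * (sqrt (2 * pi * b) / sqrt (2 * pi * b)) * (y powr a / y powr a)
          * (u powr a * u powr (\<nu> - 1 - a)) * phi01 \<nu> (\<theta> * u)
          * (exp (b * sqrt y - y / c) * (exp (b * sqrt u - b * sqrt y) * exp (- (b * sqrt u)) * exp (- t / c))) / (c powr \<nu> * exp (\<theta> * c))"
        unfolding \<Phi>_def E_def z PF T K
        by (simp only: times_divide_eq_left times_divide_eq_right divide_divide_eq_left mult_ac)
      also have "\<dots> = noncentral_gamma \<nu> \<theta> c u"
        unfolding ee up bp using u y1 b0 by (simp add: noncentral_gamma_def phi01_kernel_def)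
      finally show ?thesis by (simp add: u_def)
    qed
    have E_nonneg: "E t \<ge> 0" if "t > 0" for t
      unfolding E_def using w(1) b0 that by (intro mult_nonneg_nonneg T_nonneg) (auto simp: puiseux_fun_def)
    have fin: "\<bar>val - \<Phi> * (\<Sum>l<N. (\<Sum>i\<le>l. k l i * gamma_moment \<nu> \<theta>' c' d i) * w ^ l)\<bar> \<le> \<Phi> * (C * w ^ N)"
    proof (rule gamma_difference_density_expansion[OF \<nu> th(2) c d _ E_nonneg \<Phi> factor _ val])
      show "\<bar>E t - (\<Sum>l<N. (\<Sum>i\<le>l. k l i * t ^ i) * w ^ l)\<bar> \<le> C * w ^ N * exp (1 / c * t)" if "t > 0" for t
        using C(2)[of t w] that w wb by (simp add: E_def ksum puiseux_poly_atMost)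
    qed measurable
    have wl: "w ^ l = y powr (- (real l * (1/2)))" for l
      using y1 sqrt_power_eq_powr[of y l] by (simp add: w_def power_divide powr_minus_divide)
    show "\<bar>val - K * y powr a * exp (b * sqrt y - y / c) *
        (\<Sum>l<N. sqrt_expansion_coeff a b \<nu> (gamma_moment \<nu> \<theta>' c' d) l * y powr (- (real l * (1/2))))\<bar>
      \<le> C * (K * y powr a * exp (b * sqrt y - y / c) * y powr (- (real N * (1/2))))"
      using fin unfolding wl ksum sqrt_expansion_coeff_def \<Phi>_def by (simp only: mult_ac)
  qed
qed

section \<open>The central case\<close>

lemma puiseux_coeff_0: "puiseux_coeff a 0 i j = (if j = 2 * i then a gchoose i else 0)"
proof (cases "i \<in> {(j + 1) div 2..j}")
  case True
  then have "j \<le> 2 * i" by auto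
  \<comment> \<open>For b = 0 only r = 2 i - j = 0 survives, through
    \<open>0 ^ 0 = 1\<close>.\<close>
  then show ?thesis using True by (auto simp: puiseux_coeff_def sqrt_coeff_def power_0_left)
qed (auto simp: puiseux_coeff_def)

lemma sum_lessThan_double: "(\<Sum>l<2 * N. F l) = (\<Sum>k<N. F (2 * k) + F (Suc (2 * k)))" for F :: "nat \<Rightarrow> real"
  by (induction N) (simp_all add: mult_Suc_right)

text \<open>Without noncentrality the expansion is the case b = 0 of the previous one, which has only even powers of w.\<close>

lemma gamma_difference_density_asymptotic_central:
  assumes \<nu>: "\<nu> > 0" and th: "\<theta>' \<ge> 0" and c: "c > 0" "c' > 0"
    and d: "1 / d = 1 / c' + 1 / c" and K: "K = 1 / (Gamma \<nu> * c powr \<nu>)"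
  shows "\<exists>C y0. y0 > 0 \<and> (\<forall>y val. y \<ge> y0 \<longrightarrow> val \<ge> 0 \<longrightarrow> gamma_difference_density \<nu> 0 c \<theta>' c' y = ennreal val \<longrightarrow>
     \<bar>val - K * y powr (\<nu> - 1) * exp (- y / c) *
        (\<Sum>k<N. ((\<nu> - 1) gchoose k) * gamma_moment \<nu> \<theta>' c' d k * y powr (- (real k * 1)))\<bar>
      \<le> C * (K * y powr (\<nu> - 1) * exp (- y / c) * y powr (- (real N * 1))))"
proof (rule puiseux_remainder[of "1 / c" "\<nu> - 1" 0 "2 * N"])
  show "1 / c > 0" using c by simp
  fix C assume C: "C \<ge> 0" "\<And>t w. t \<ge> 0 \<Longrightarrow> w > 0 \<Longrightarrow> w \<le> 1 \<Longrightarrow>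
       \<bar>puiseux_fun (\<nu> - 1) 0 t w - (\<Sum>j<2 * N. puiseux_poly (\<nu> - 1) 0 j t * w ^ j)\<bar> \<le> C * w ^ (2 * N) * exp (1 / c * t)"
  have G: "Gamma \<nu> > 0" using \<nu> by (rule Gamma_real_pos)
  have phi0: "phi01 \<nu> 0 = 1 / Gamma \<nu>"
    using powser_zero[of "\<lambda>k. 1 / (fact k * Gamma (\<nu> + real k))"] by (simp add: phi01_def)
  show ?thesis
  proof (rule exI[of _ C], rule exI[of _ 1], intro conjI allI impI)
    show "(1::real) > 0" by simp
    fix y val assume y1: "y \<ge> (1::real)" and val: "val \<ge> 0" "gamma_difference_density \<nu> 0 c \<theta>' c' y = ennreal val"
    define w where "w = 1 / sqrt y"
    have w: "w > 0" "w \<le> 1" "w\<^sup>2 = 1 / y" using y1 by (auto simp: w_def power_divide)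
    define \<Phi> where "\<Phi> = K * y powr (\<nu> - 1) * exp (- y / c)"
    have \<Phi>: "\<Phi> > 0" using G c y1 by (simp add: \<Phi>_def K)
    define E where "E t = puiseux_fun (\<nu> - 1) 0 t w" for t
    have [measurable]: "E \<in> borel_measurable borel" unfolding E_def puiseux_fun_def by measurable
    have E_nonneg: "E t \<ge> 0" for t by (simp add: E_def puiseux_fun_def)
    have factor: "noncentral_gamma \<nu> 0 c (y + t) = \<Phi> * (E t * exp (- t / c))" if "t > 0" for t
    proof -
      have "1 + t * w\<^sup>2 = (y + t) / y" using y1 unfolding w(3) by (simp add: field_simps)
      then have E: "E t = (y + t) powr (\<nu> - 1) / y powr (\<nu> - 1)"
        by (simp add: E_def puiseux_fun_def powr_divide)
      have e: "exp (- (y + t) / c) = exp (- y / c) * exp (- t / c)"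
        unfolding exp_add[symmetric] by (rule arg_cong[of _ _ exp]) (simp add: add_divide_distrib diff_divide_distrib)
      have "y powr (\<nu> - 1) > 0" using y1 by simp
      then show ?thesis using that y1 unfolding noncentral_gamma_def phi01_kernel_def e E \<Phi>_def K
        by (simp add: phi0 mult_ac)
    qed
    have "\<bar>val - \<Phi> * (\<Sum>l<2 * N. (\<Sum>i\<le>l. puiseux_coeff (\<nu> - 1) 0 i l * gamma_moment \<nu> \<theta>' c' d i) * w ^ l)\<bar> \<le> \<Phi> * (C * w ^ (2 * N))"
    proof (rule gamma_difference_density_expansion[OF \<nu> th c d _ E_nonneg \<Phi> factor _ val])
      show "\<bar>E t - (\<Sum>l<2 * N. (\<Sum>i\<le>l. puiseux_coeff (\<nu> - 1) 0 i l * t ^ i) * w ^ l)\<bar> \<le> C * w ^ (2 * N) * exp (1 / c * t)" if "t > 0" for t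
        using C(2)[of t w] that w by (simp add: E_def puiseux_poly_atMost)
    qed measurable
    moreover have w2: "w ^ (2 * k) = y powr (- (real k * 1))" for k
      using y1 by (simp add: power_mult w(3) power_divide powr_minus_divide powr_realpow)
    moreover have "(\<Sum>l<2 * N. (\<Sum>i\<le>l. puiseux_coeff (\<nu> - 1) 0 i l * gamma_moment \<nu> \<theta>' c' d i) * w ^ l)
       = (\<Sum>k<N. ((\<nu> - 1) gchoose k) * gamma_moment \<nu> \<theta>' c' d k * y powr (- (real k * 1)))"
    proof -
      have ev: "(\<Sum>i\<le>2 * k. puiseux_coeff (\<nu> - 1) 0 i (2 * k) * gamma_moment \<nu> \<theta>' c' d i)
          = ((\<nu> - 1) gchoose k) * gamma_moment \<nu> \<theta>' c' d k" for k
      proof -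
        have "(\<Sum>i\<le>2 * k. puiseux_coeff (\<nu> - 1) 0 i (2 * k) * gamma_moment \<nu> \<theta>' c' d i)
           = (\<Sum>i\<in>{k}. puiseux_coeff (\<nu> - 1) 0 i (2 * k) * gamma_moment \<nu> \<theta>' c' d i)"
          by (intro sum.mono_neutral_right) (auto simp: puiseux_coeff_0)
        then show ?thesis by (simp add: puiseux_coeff_0)
      qed
      have od: "(\<Sum>i\<le>Suc (2 * k). puiseux_coeff (\<nu> - 1) 0 i (Suc (2 * k)) * gamma_moment \<nu> \<theta>' c' d i) = 0" for k
      proof (intro sum.neutral ballI)
        fix i
        have "Suc (2 * k) \<noteq> 2 * i" by presburger
        then show "puiseux_coeff (\<nu> - 1) 0 i (Suc (2 * k)) * gamma_moment \<nu> \<theta>' c' d i = 0" by (simp add: puiseux_coeff_0)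
      qed
      show ?thesis unfolding sum_lessThan_double ev od w2 by simp
    qed
    ultimately show "\<bar>val - K * y powr (\<nu> - 1) * exp (- y / c) *
        (\<Sum>k<N. ((\<nu> - 1) gchoose k) * gamma_moment \<nu> \<theta>' c' d k * y powr (- (real k * 1)))\<bar>
      \<le> C * (K * y powr (\<nu> - 1) * exp (- y / c) * y powr (- (real N * 1)))"
      unfolding \<Phi>_def by (simp only: mult_ac)
  qed
qed

section \<open>Poincare expansions\<close>

text \<open>The set where D is negative is open, so a single point in it would bring an interval of
  positive length.\<close>

lemma AE_imp_nonneg_on_open:
  fixes D :: "real \<Rightarrow> real"
  assumes "open S" "continuous_on S D" "AE x in lborel. x \<in> S \<longrightarrow> D x \<ge> 0" "x \<in> S"
  shows "D x \<ge> 0"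
proof (rule ccontr)
  assume "\<not> D x \<ge> 0"
  define T where "T = S \<inter> D -` {..<0}"
  have "open T" unfolding T_def by (rule continuous_open_preimage[OF assms(2,1)]) simp
  moreover have "x \<in> T" using assms(4) \<open>\<not> D x \<ge> 0\<close> by (simp add: T_def)
  ultimately obtain e where e: "e > 0" "ball x e \<subseteq> T" by (auto simp: open_contains_ball)
  have "AE z in lborel. z \<notin> T" using assms(3) by eventually_elim (auto simp: T_def)
  then have "emeasure lborel T = 0"
    using AE_iff_null_sets[of T lborel] \<open>open T\<close> by auto
  moreover have "emeasure lborel {x<..<x + e} \<le> emeasure lborel T"
    using e(2) \<open>open T\<close> by (intro emeasure_mono) (auto simp: ball_def dist_real_def subset_eq)
  ultimately show False using e(1) by simp
qed

text \<open>
  A density is only determined almost everywhere, but an estimate between continuous functions that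
  holds almost everywhere holds everywhere.
\<close>

lemma poincare_expansion_at_topI:
  assumes f: "continuous_on {0<..} f" and \<phi>: "continuous_on {0<..} \<phi>" and pos: "\<And>x. x > 0 \<Longrightarrow> \<phi> x > 0"
    and bound: "\<And>N. \<exists>C X0. X0 > 0 \<and> (AE x in lborel. x \<ge> X0 \<longrightarrow>
       \<bar>f x - \<phi> x * (\<Sum>l<N. a l * x powr (- (real l * \<kappa>)))\<bar> \<le> C * (\<phi> x * x powr (- (real N * \<kappa>))))"
  shows "poincare_expansion at_top \<kappa> f \<phi> a"
  unfolding poincare_expansion_def
proof (intro allI impI)
  fix N :: nat
  define S where "S x = (\<Sum>l<N. a l * x powr (- (real l * \<kappa>)))" for x
  obtain C X0 where X0: "X0 > 0" and ae: "AE x in lborel. x \<ge> X0 \<longrightarrow> \<bar>f x - \<phi> x * S x\<bar> \<le> C * (\<phi> x * x powr (- (real N * \<kappa>)))"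
    using bound[of N] unfolding S_def by blast
  have le: "\<bar>f x - \<phi> x * S x\<bar> \<le> C * (\<phi> x * x powr (- (real N * \<kappa>)))" if "x > X0" for x
  proof -
    have sub: "{X0<..} \<subseteq> {0<..}" using X0 by auto
    have "C * (\<phi> x * x powr (- (real N * \<kappa>))) - \<bar>f x - \<phi> x * S x\<bar> \<ge> 0"
    proof (rule AE_imp_nonneg_on_open[where S = "{X0<..}" and x = x
          and D = "\<lambda>x. C * (\<phi> x * x powr (- (real N * \<kappa>))) - \<bar>f x - \<phi> x * S x\<bar>"])
      show "continuous_on {X0<..} (\<lambda>x. C * (\<phi> x * x powr (- (real N * \<kappa>))) - \<bar>f x - \<phi> x * S x\<bar>)"
        unfolding S_def using X0
        by (intro continuous_intros continuous_on_subset[OF f sub] continuous_on_subset[OF \<phi> sub]) auto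
      show "AE x in lborel. x \<in> {X0<..} \<longrightarrow> C * (\<phi> x * x powr (- (real N * \<kappa>))) - \<bar>f x - \<phi> x * S x\<bar> \<ge> 0"
        using ae by eventually_elim auto
    qed (use that in auto)
    then show ?thesis by simp
  qed
  show "\<exists>R. R \<in> O(\<lambda>x. \<bar>x\<bar> powr (- (real N * \<kappa>))) \<and>
        (\<forall>\<^sub>F x in at_top. f x = \<phi> x * ((\<Sum>l<N. a l * \<bar>x\<bar> powr (- (real l * \<kappa>))) + R x))"
  proof (intro exI[of _ "\<lambda>x. f x / \<phi> x - S x"] conjI)
    show "(\<lambda>x. f x / \<phi> x - S x) \<in> O(\<lambda>x. \<bar>x\<bar> powr (- (real N * \<kappa>)))"
    proof (rule bigoI)
      show "\<forall>\<^sub>F x in at_top. norm (f x / \<phi> x - S x) \<le> C * norm (\<bar>x\<bar> powr (- (real N * \<kappa>)))"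
        using eventually_gt_at_top[of X0]
      proof eventually_elim
        case (elim x)
        then have x: "x > 0" using X0 by simp
        have p: "\<phi> x > 0" using pos[OF x] .
        have "f x / \<phi> x - S x = (f x - \<phi> x * S x) / \<phi> x" using p by (simp add: diff_divide_distrib)
        then have "norm (f x / \<phi> x - S x) = \<bar>f x - \<phi> x * S x\<bar> / \<phi> x" using p by simp
        also have "\<dots> \<le> C * (\<phi> x * x powr (- (real N * \<kappa>))) / \<phi> x"
          using le[OF elim] p by (intro divide_right_mono) auto
        also have "\<dots> = C * norm (\<bar>x\<bar> powr (- (real N * \<kappa>)))" using p x by simp
        finally show ?case .
      qed
    qed
    show "\<forall>\<^sub>F x in at_top. f x = \<phi> x * ((\<Sum>l<N. a l * \<bar>x\<bar> powr (- (real l * \<kappa>))) + (f x / \<phi> x - S x))"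
      using eventually_gt_at_top[of 0]
    proof eventually_elim
      case (elim x)
      then show ?case using pos[OF elim] by (simp add: S_def)
    qed
  qed
qed

text \<open>Returns from y = x / s to x. The coefficients of the expansion of \<open>G\<close> share
  the factor m, which comes from the zeroth moment; moving it into the prefactor normalises the
  leading coefficient to 1.\<close>

lemma poincare_expansion_rescale:
  assumes s: "s > 0" and m: "m > 0" and f: "\<And>x. f x \<ge> 0" "continuous_on {0<..} f"
    and \<Phi>: "continuous_on {0<..} \<Phi>" "\<And>x. x > 0 \<Longrightarrow> \<Phi> x > 0"
    and ae: "AE x in lborel. x > 0 \<longrightarrow> ennreal (s * f x) = G (x / s)"
    and pre: "\<And>x. x > 0 \<Longrightarrow> \<Psi> (x / s) * m = s * \<Phi> x"
    and bound: "\<And>N. \<exists>C y0. y0 > 0 \<and> (\<forall>y val. y \<ge> y0 \<longrightarrow> val \<ge> 0 \<longrightarrow> G y = ennreal val \<longrightarrow>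
       \<bar>val - \<Psi> y * (\<Sum>l<N. m * a l * y powr (- (real l * \<kappa>)))\<bar> \<le> C * (\<Psi> y * y powr (- (real N * \<kappa>))))"
  shows "poincare_expansion at_top \<kappa> f \<Phi> (\<lambda>l. a l * s powr (real l * \<kappa>))"
proof (rule poincare_expansion_at_topI[OF f(2) \<Phi>])
  fix N
  obtain C y0 where y0: "y0 > 0" and C: "\<And>y val. y \<ge> y0 \<Longrightarrow> val \<ge> 0 \<Longrightarrow> G y = ennreal val \<Longrightarrow>
     \<bar>val - \<Psi> y * (\<Sum>l<N. m * a l * y powr (- (real l * \<kappa>)))\<bar> \<le> C * (\<Psi> y * y powr (- (real N * \<kappa>)))"
    using bound[of N] by blast
  let ?S = "\<lambda>x. \<Sum>l<N. a l * s powr (real l * \<kappa>) * x powr (- (real l * \<kappa>))"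
  show "\<exists>C X0. X0 > 0 \<and> (AE x in lborel. x \<ge> X0 \<longrightarrow> \<bar>f x - \<Phi> x * ?S x\<bar> \<le> C * (\<Phi> x * x powr (- (real N * \<kappa>))))"
  proof (intro exI conjI)
    show "s * y0 > 0" using s y0 by simp
    show "AE x in lborel. x \<ge> s * y0 \<longrightarrow>
       \<bar>f x - \<Phi> x * ?S x\<bar> \<le> C * s powr (real N * \<kappa>) / m * (\<Phi> x * x powr (- (real N * \<kappa>)))"
      using ae
    proof eventually_elim
      case (elim x)
      show ?case
      proof
        assume xs: "x \<ge> s * y0"
        then have x: "x > 0" using s y0 by (meson less_le_trans mult_pos_pos)
        have y: "x / s \<ge> y0" using xs s by (simp add: field_simps)
        have pw: "(x / s) powr (- (real l * \<kappa>)) = s powr (real l * \<kappa>) * x powr (- (real l * \<kappa>))" for l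
          by (simp add: powr_divide powr_minus_divide)
        have "(\<Sum>l<N. m * a l * (x / s) powr (- (real l * \<kappa>))) = m * ?S x"
          unfolding pw by (simp only: sum_distrib_left mult.assoc)
        then have "\<Psi> (x / s) * (\<Sum>l<N. m * a l * (x / s) powr (- (real l * \<kappa>))) = s * (\<Phi> x * ?S x)"
          using pre[OF x] by (simp only: mult.assoc[symmetric])
        moreover have "C * (\<Psi> (x / s) * (x / s) powr (- (real N * \<kappa>)))
           = s * (C * s powr (real N * \<kappa>) / m * (\<Phi> x * x powr (- (real N * \<kappa>))))"
        proof -
          have \<Psi>: "\<Psi> (x / s) = s * \<Phi> x / m"
            by (rule nonzero_eq_divide_eq[THEN iffD2, OF _ pre[OF x]]) (use m in simp)
          show ?thesis unfolding pw \<Psi> by simp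
        qed
        ultimately have "\<bar>s * f x - s * (\<Phi> x * ?S x)\<bar> \<le> s * (C * s powr (real N * \<kappa>) / m * (\<Phi> x * x powr (- (real N * \<kappa>))))"
          using C[OF y, of "s * f x"] elim x s f(1)[of x] by simp
        moreover have "\<bar>s * f x - s * (\<Phi> x * ?S x)\<bar> = s * \<bar>f x - \<Phi> x * ?S x\<bar>"
          using s by (simp only: right_diff_distrib[symmetric] abs_mult abs_of_pos)
        ultimately have "s * \<bar>f x - \<Phi> x * ?S x\<bar> \<le> s * (C * s powr (real N * \<kappa>) / m * (\<Phi> x * x powr (- (real N * \<kappa>))))"
          by (simp only:)
        then show "\<bar>f x - \<Phi> x * ?S x\<bar> \<le> C * s powr (real N * \<kappa>) / m * (\<Phi> x * x powr (- (real N * \<kappa>)))"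
          using s by (rule mult_left_le_imp_le)
      qed
    qed
  qed
qed

lemma poincare_expansion_mirror:
  assumes "poincare_expansion at_top \<kappa> (\<lambda>x. f (- x)) \<phi> a" and eq: "\<And>x. x < 0 \<Longrightarrow> \<psi> x = \<phi> (- x)"
  shows "poincare_expansion at_bot \<kappa> f \<psi> a"
  unfolding poincare_expansion_def
proof (intro allI impI)
  fix N :: nat assume "N \<ge> 1"
  then obtain R where R: "R \<in> O(\<lambda>x. \<bar>x\<bar> powr (- (real N * \<kappa>)))"
    "\<forall>\<^sub>F x in at_top. f (- x) = \<phi> x * ((\<Sum>l<N. a l * \<bar>x\<bar> powr (- (real l * \<kappa>))) + R x)"
    using assms(1) unfolding poincare_expansion_def by blast
  have lim: "filterlim (uminus :: real \<Rightarrow> real) at_top at_bot"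
    by (rule filterlim_uminus_at_top_at_bot)
  show "\<exists>R. R \<in> O[at_bot](\<lambda>x. \<bar>x\<bar> powr (- (real N * \<kappa>))) \<and>
        (\<forall>\<^sub>F x in at_bot. f x = \<psi> x * ((\<Sum>l<N. a l * \<bar>x\<bar> powr (- (real l * \<kappa>))) + R x))"
  proof (intro exI[of _ "\<lambda>x. R (- x)"] conjI)
    show "(\<lambda>x. R (- x)) \<in> O[at_bot](\<lambda>x. \<bar>x\<bar> powr (- (real N * \<kappa>)))"
      using landau_o.big.compose[OF R(1) lim] by simp
    show "\<forall>\<^sub>F x in at_bot. f x = \<psi> x * ((\<Sum>l<N. a l * \<bar>x\<bar> powr (- (real l * \<kappa>))) + R (- x))"
      using eventually_compose_filterlim[OF R(2) lim] eventually_gt_at_bot[of 0]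
      by eventually_elim (simp add: eq)
  qed
qed

section \<open>Matching constants with the stated coefficients\<close>

lemma d_coeff_eq_sum:
  assumes "n \<ge> 1" "k \<ge> 1"
  shows "d_coeff k r \<rho> n = d_coeff_sum k r \<rho> n"
proof -
  define z where "z = real n / 2 * ((1 + \<rho>) / (1 - \<rho>)) * r\<^sup>2"
  \<comment> \<open>By \<open>kummer_M_shift\<close> Kummer's function is exp z times a polynomial,
    so the exponentials cancel.\<close>
  have "exp (- z) * kummer_M (real n / 2 + real k) (real n / 2) z
     = (\<Sum>j\<le>k. real (k choose j) * z ^ j / pochhammer (real n / 2) j)"
    using assms by (subst kummer_M_shift) (simp_all add: mult.assoc[symmetric] flip: exp_add)
  also have "\<dots> = (\<Sum>j = 0..k. (real n / 2) ^ j / pochhammer (real n / 2) j * real (k choose j) *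
        ((1 + \<rho>) / (1 - \<rho>)) ^ j * r ^ (2 * j))"
  proof (intro sum.cong)
    fix j
    have "z ^ j = (real n / 2) ^ j * ((1 + \<rho>) / (1 - \<rho>)) ^ j * r ^ (2 * j)"
      by (simp only: z_def power_mult_distrib power_mult)
    then show "real (k choose j) * z ^ j / pochhammer (real n / 2) j
       = (real n / 2) ^ j / pochhammer (real n / 2) j * real (k choose j) * ((1 + \<rho>) / (1 - \<rho>)) ^ j * r ^ (2 * j)"
      by (simp only: times_divide_eq_left times_divide_eq_right mult_ac)
  qed auto
  finally have e: "exp (- z) * kummer_M (real n / 2 + real k) (real n / 2) z
      = (\<Sum>j = 0..k. (real n / 2) ^ j / pochhammer (real n / 2) j * real (k choose j) *
        ((1 + \<rho>) / (1 - \<rho>)) ^ j * r ^ (2 * j))" .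
  have "d_coeff k r \<rho> n = (- 1) ^ k * (pochhammer (1 - real n / 2) k * pochhammer (real n / 2) k / fact k) *
     ((1 - \<rho>\<^sup>2) / 2) ^ k * (exp (- z) * kummer_M (real n / 2 + real k) (real n / 2) z)"
    unfolding d_coeff_def z_def[symmetric] using assms by (simp add: mult.assoc)
  then show ?thesis unfolding e d_coeff_sum_def .
qed

lemma nn_integral_rescaled_gamma_difference:
  assumes "s > 0" "c > 0" "c' > 0" "\<nu> > 0" "\<theta> \<ge> 0"
  shows "(\<integral>\<^sup>+t. ennreal (noncentral_gamma \<nu> (\<theta> / s) (s * c) (x + t)) * ennreal (noncentral_gamma \<nu> (\<theta>' / s) (s * c') t) \<partial>lborel)
     = ennreal (1 / s) * gamma_difference_density \<nu> \<theta> c \<theta>' c' (x / s)"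
proof -
  let ?A = "noncentral_gamma \<nu> \<theta> c" and ?B = "noncentral_gamma \<nu> \<theta>' c'"
  have s2: "ennreal (A / s) * ennreal (B / s) = ennreal (1 / s) * ennreal (1 / s) * (ennreal A * ennreal B)" if "A \<ge> 0" for A B
  proof -
    have "ennreal (A / s) = ennreal (1 / s) * ennreal A" "ennreal (B / s) = ennreal (1 / s) * ennreal B"
      using assms by (simp_all add: ennreal_mult'[symmetric])
    then show ?thesis by (simp only: mult_ac)
  qed
  have "(\<integral>\<^sup>+t. ennreal (noncentral_gamma \<nu> (\<theta> / s) (s * c) (x + t)) * ennreal (noncentral_gamma \<nu> (\<theta>' / s) (s * c') t) \<partial>lborel)
     = (\<integral>\<^sup>+t. ennreal (?A ((x + t) / s) / s) * ennreal (?B (t / s) / s) \<partial>lborel)"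
    using assms by (simp only: noncentral_gamma_scale)
  also have "\<dots> = ennreal s * (\<integral>\<^sup>+t. ennreal (?A ((x + (0 + s * t)) / s) / s) * ennreal (?B ((0 + s * t) / s) / s) \<partial>lborel)"
    using assms by (subst nn_integral_real_affine[where c = s and t = 0]) auto
  also have "\<dots> = ennreal s * (\<integral>\<^sup>+t. ennreal (1 / s) * ennreal (1 / s) * (ennreal (?A (x / s + t)) * ennreal (?B t)) \<partial>lborel)"
  proof -
    have eq: "ennreal (?A ((x + (0 + s * t)) / s) / s) * ennreal (?B ((0 + s * t) / s) / s)
        = ennreal (1 / s) * ennreal (1 / s) * (ennreal (?A (x / s + t)) * ennreal (?B t))" for t
    proof -
      have 1: "(x + (0 + s * t)) / s = x / s + t" and 2: "(0 + s * t) / s = t"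
        using assms by (simp_all add: add_divide_distrib)
      show ?thesis unfolding 1 2 by (rule s2) (use assms in \<open>simp add: noncentral_gamma_nonneg\<close>)
    qed
    show ?thesis by (simp only: eq)
  qed
  also have "\<dots> = ennreal s * (ennreal (1 / s) * ennreal (1 / s) * gamma_difference_density \<nu> \<theta> c \<theta>' c' (x / s))"
    unfolding gamma_difference_density_def by (subst nn_integral_cmult) simp_all
  also have "\<dots> = ennreal (s * (1 / s * (1 / s))) * gamma_difference_density \<nu> \<theta> c \<theta>' c' (x / s)"
    using assms by (simp only: ennreal_mult' less_imp_le zero_le_divide_1_iff mult.assoc)
  finally show ?thesis using assms by simp
qed

text \<open>The Pochhammer symbols form Hankel's coefficient, and the powers of (1 + \<rho>) / |rX +
  rY| and of n^(-1/2) together are those of 1 / b.\<close>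

lemma h_coeff_eq:
  assumes "b = \<bar>rX + rY\<bar> / (1 + \<rho>) * sqrt (real n)" "a = (real n - 3) / 4" "\<nu> = real n / 2"
    and "z = real n / 8 * ((1 + \<rho>) / (1 - \<rho>)) * (rX - rY)\<^sup>2" and n: "n \<ge> 1"
  shows "h_coeff j l rX rY \<rho> n = bessel_coeff \<nu> (l - j) / b ^ (l - j) *
    (\<Sum>i\<le>j. puiseux_coeff (a - real (l - j) / 2) b i j * (pochhammer \<nu> i * ((1 - \<rho>\<^sup>2) / 2) ^ i * kummer_M (\<nu> + real i) \<nu> z))"
proof -
  define k where "k = l - j"
  have nk: "real n powr (real k / 2) = sqrt (real n) ^ k" using n sqrt_power_eq_powr[of "real n" k] by simp
  have "(\<Sum>i = nat \<lceil>real j / 2\<rceil>..j. pochhammer \<nu> i * ((1 - \<rho>\<^sup>2) / 2) ^ i * kummer_M (\<nu> + real i) \<nu> z * g_coeff i j (a - real k / 2) b)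
      = (\<Sum>i\<le>j. puiseux_coeff (a - real k / 2) b i j * (pochhammer \<nu> i * ((1 - \<rho>\<^sup>2) / 2) ^ i * kummer_M (\<nu> + real i) \<nu> z))"
    unfolding nat_ceiling_half g_coeff_eq
    by (intro sum.mono_neutral_cong_left) (auto simp: puiseux_coeff_def)
  moreover have "pochhammer ((3 - real n) / 2) k * pochhammer ((real n - 1) / 2) k / (fact k * 2 ^ k * sqrt (real n) ^ k) * ((1 + \<rho>) / \<bar>rX + rY\<bar>) ^ k
      = bessel_coeff \<nu> k / b ^ k"
  proof -
    have h: "3/2 - \<nu> = (3 - real n) / 2" "\<nu> - 1/2 = (real n - 1) / 2" by (simp_all add: assms diff_divide_distrib)
    show ?thesis
      unfolding bessel_coeff_def h assms(1) by (simp add: power_mult_distrib power_divide mult_ac)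
  qed
  ultimately show ?thesis
    unfolding h_coeff_def assms(1-4)[symmetric] k_def[symmetric] nk by (simp only:)
qed

text \<open>The left side is the product of the exponential normalising factors of the two
  noncentral gamma densities. The identity is the diagonalisation behind
  \<open>bivariate_normal_density_factor\<close>, applied to the means.\<close>

lemma C_const_eq:
  assumes "- 1 < \<rho>" "\<rho> < 1"
  shows "exp (- (real n * (rX + rY)\<^sup>2 / (4 * (1 + \<rho>)\<^sup>2) * (1 + \<rho>))) * exp (- (real n * (rX - rY)\<^sup>2 / (4 * (1 - \<rho>)\<^sup>2) * (1 - \<rho>)))
    = C_const rX rY \<rho> n"
proof -
  have c: "X / (4 * c\<^sup>2) * c = X / (4 * c)" if "c \<noteq> 0" for X c :: real
    using that by (simp add: power2_eq_square)
  have "X / (4 * c) + Y / (4 * e) = (X * e + Y * c) / (4 * (c * e))" if "c \<noteq> 0" "e \<noteq> 0" for X Y c e :: real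
    using that by (simp add: field_simps)
  from this[of "1 + \<rho>" "1 - \<rho>" "real n * (rX + rY)\<^sup>2" "real n * (rX - rY)\<^sup>2"]
  have "real n * (rX + rY)\<^sup>2 / (4 * (1 + \<rho>)) + real n * (rX - rY)\<^sup>2 / (4 * (1 - \<rho>))
      = (real n * (rX + rY)\<^sup>2 * (1 - \<rho>) + real n * (rX - rY)\<^sup>2 * (1 + \<rho>)) / (4 * ((1 + \<rho>) * (1 - \<rho>)))"
    using assms by simp
  also have "real n * (rX + rY)\<^sup>2 * (1 - \<rho>) + real n * (rX - rY)\<^sup>2 * (1 + \<rho>) = 2 * (real n * (rX\<^sup>2 + rY\<^sup>2 - 2 * \<rho> * rX * rY))"
    by (simp add: power2_eq_square algebra_simps)
  also have "4 * ((1 + \<rho>) * (1 - \<rho>)) = 2 * (2 * (1 - \<rho>\<^sup>2))" by (simp add: power2_eq_square algebra_simps)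
  also have "2 * (real n * (rX\<^sup>2 + rY\<^sup>2 - 2 * \<rho> * rX * rY)) / (2 * (2 * (1 - \<rho>\<^sup>2)))
      = real n * (rX\<^sup>2 + rY\<^sup>2 - 2 * \<rho> * rX * rY) / (2 * (1 - \<rho>\<^sup>2))"
    by (rule mult_divide_mult_cancel_left) simp
  finally have e: "real n * (rX + rY)\<^sup>2 / (4 * (1 + \<rho>)) + real n * (rX - rY)\<^sup>2 / (4 * (1 - \<rho>))
      = real n * (rX\<^sup>2 + rY\<^sup>2 - 2 * \<rho> * rX * rY) / (2 * (1 - \<rho>\<^sup>2))" .
  have n0: "1 + \<rho> \<noteq> 0" "1 - \<rho> \<noteq> 0" using assms by auto
  show ?thesis
    unfolding C_const_def c[OF n0(1)] c[OF n0(2)] e[symmetric] by (simp add: exp_add[symmetric])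
qed

text \<open>The scales 1 + \<rho> and 1 - \<rho> add up to 2, so the sum of their reciprocals is 2 /
  (1 - \<open>\<rho>\<^sup>2\<close>), the reciprocal of d. Multiplied by this d, the noncentrality
  of the second density is the argument z of Kummer's function.\<close>

lemma poincare_expansion_noncentral:
  fixes n :: nat and f :: "real \<Rightarrow> real"
  assumes n: "n \<ge> 1" and r: "- 1 < \<rho>" "\<rho> < 1" and s: "s > 0" and p: "rX + rY \<noteq> 0"
    and f: "\<And>x. f x \<ge> 0" "continuous_on {0<..} f"
    and ae: "AE x in lborel. x > 0 \<longrightarrow> ennreal (s * f x) =
       gamma_difference_density (real n / 2) (real n * (rX + rY)\<^sup>2 / (4 * (1 + \<rho>)\<^sup>2)) (1 + \<rho>)
         (real n * (rX - rY)\<^sup>2 / (4 * (1 - \<rho>)\<^sup>2)) (1 - \<rho>) (x / s)"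
  shows "poincare_expansion at_top (1/2) f
         (\<lambda>x. s powr (- (real n + 1) / 4) * C_const rX rY \<rho> n / (2 * sqrt (2 * pi)) *
              ((1 + \<rho>) / (\<bar>rX + rY\<bar> * sqrt (real n))) powr ((real n - 1) / 2) *
              exp (real n / 8 * ((1 + \<rho>) / (1 - \<rho>)) * (rX - rY)\<^sup>2) *
              x powr ((real n - 3) / 4) *
              exp (\<bar>rX + rY\<bar> / (1 + \<rho>) * sqrt (real n * x / s) - x / (s * (1 + \<rho>))))
         (\<lambda>l. c_coeff l rX rY \<rho> n * s powr (real l / 2))"
proof -
  define \<nu> where "\<nu> = real n / 2"
  define \<theta> where "\<theta> = real n * (rX + rY)\<^sup>2 / (4 * (1 + \<rho>)\<^sup>2)"
  define \<theta>' where "\<theta>' = real n * (rX - rY)\<^sup>2 / (4 * (1 - \<rho>)\<^sup>2)"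
  define d where "d = (1 - \<rho>\<^sup>2) / 2"
  define b where "b = \<bar>rX + rY\<bar> / (1 + \<rho>) * sqrt (real n)"
  define a where "a = (real n - 3) / 4"
  define z where "z = real n / 8 * ((1 + \<rho>) / (1 - \<rho>)) * (rX - rY)\<^sup>2"
  define K where "K = (b / 2) powr (1 - \<nu>) / sqrt (2 * pi * b) / ((1 + \<rho>) powr \<nu> * exp (\<theta> * (1 + \<rho>)))"
  define A where "A = (d / (1 - \<rho>)) powr \<nu> * exp (- \<theta>' * (1 - \<rho>))"
  define \<Phi> where "\<Phi> x = s powr (- (real n + 1) / 4) * C_const rX rY \<rho> n / (2 * sqrt (2 * pi)) *
              ((1 + \<rho>) / (\<bar>rX + rY\<bar> * sqrt (real n))) powr ((real n - 1) / 2) * exp z * x powr a *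
              exp (\<bar>rX + rY\<bar> / (1 + \<rho>) * sqrt (real n * x / s) - x / (s * (1 + \<rho>)))" for x
  have \<nu>: "\<nu> > 0" using n by (simp add: \<nu>_def)
  have c: "1 + \<rho> > 0" "1 - \<rho> > 0" using r by auto
  have dd: "d = (1 + \<rho>) * (1 - \<rho>) / 2" by (simp add: d_def power2_eq_square algebra_simps)
  have b0: "b > 0" using n p c by (simp add: b_def)
  have \<theta>: "\<theta> > 0" unfolding \<theta>_def using n p c by (intro divide_pos_pos mult_pos_pos) auto
  have \<theta>': "\<theta>' \<ge> 0" unfolding \<theta>'_def by simp
  have d1: "1 / d = 1 / (1 - \<rho>) + 1 / (1 + \<rho>)"
  proof -
    have "1 / e + 1 / c = 1 / (c * e / 2)" if "c \<noteq> 0" "e \<noteq> 0" "c + e = 2" for c e :: real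
      using that by (simp add: field_simps)
    from this[of "1 + \<rho>" "1 - \<rho>"] show ?thesis using c unfolding dd by simp
  qed
  have b\<theta>: "b = 2 * sqrt \<theta>"
  proof (rule power2_eq_imp_eq)
    show "b\<^sup>2 = (2 * sqrt \<theta>)\<^sup>2"
      using \<theta> by (simp add: b_def power_mult_distrib power_divide) (simp add: \<theta>_def)
  qed (use b0 \<theta> in auto)
  have z: "\<theta>' * d = z"
  proof -
    have "X / (4 * e\<^sup>2) * (c * e / 2) = X * c / (8 * e)" if "e \<noteq> 0" for X c e :: real
      using that by (simp add: power2_eq_square)
    from this[of "1 - \<rho>" "real n * (rX - rY)\<^sup>2" "1 + \<rho>"]
    have "\<theta>' * d = real n * (rX - rY)\<^sup>2 * (1 + \<rho>) / (8 * (1 - \<rho>))"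
      unfolding \<theta>'_def dd using c by simp
    then show ?thesis
      unfolding z_def by (simp only: times_divide_times_eq times_divide_eq_left times_divide_eq_right divide_divide_eq_left mult_ac)
  qed
  have d0: "d > 0" unfolding dd using c by simp
  have A: "A > 0" unfolding A_def using d0 c by (intro mult_pos_pos) simp_all
  have mom: "gamma_moment \<nu> \<theta>' (1 - \<rho>) d i = A * (pochhammer \<nu> i * d ^ i * kummer_M (\<nu> + real i) \<nu> z)" for i
    unfolding gamma_moment_def A_def z by (simp only: mult.assoc)
  have coeff: "sqrt_expansion_coeff a b \<nu> (gamma_moment \<nu> \<theta>' (1 - \<rho>) d) l = A * exp z * c_coeff l rX rY \<rho> n" for l
  proof -
    have S: "sqrt_expansion_coeff a b \<nu> (gamma_moment \<nu> \<theta>' (1 - \<rho>) d) l = A * (\<Sum>j\<le>l. h_coeff j l rX rY \<rho> n)"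
    proof -
      have "h_coeff j l rX rY \<rho> n = bessel_coeff \<nu> (l - j) / b ^ (l - j) *
        (\<Sum>i\<le>j. puiseux_coeff (a - real (l - j) / 2) b i j * (pochhammer \<nu> i * d ^ i * kummer_M (\<nu> + real i) \<nu> z))" for j
        using h_coeff_eq[OF b_def a_def \<nu>_def z_def n] by (simp add: d_def)
      moreover have "(\<Sum>i\<le>j. X i * (A * Y i)) = A * (\<Sum>i\<le>j. X i * Y i)" for X Y :: "nat \<Rightarrow> real" and j
        by (simp add: sum_distrib_left mult_ac)
      moreover have "X * (A * Y) = A * (X * Y)" for X Y by simp
      ultimately show ?thesis
        unfolding sqrt_expansion_coeff_def mom by (simp only: sum_distrib_left)
    qed
    show ?thesis
    proof (cases "l = 0")
      \<comment> \<open>Here Kummer's function with equal parameters gives exp z, in accordance with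
        the separate value c_0 = 1.\<close>
      case True
      have "sqrt_expansion_coeff a b \<nu> (gamma_moment \<nu> \<theta>' (1 - \<rho>) d) 0 = A * kummer_M \<nu> \<nu> z"
        by (simp add: sqrt_expansion_coeff_def mom bessel_coeff_def puiseux_coeff_def sqrt_coeff_def)
      then show ?thesis using True kummer_M_shift[OF \<nu>, of 0 z] by (simp add: c_coeff_def)
    next
      case False
      then show ?thesis
        unfolding S c_coeff_def z_def[symmetric] by (simp add: atLeast0AtMost exp_minus)
    qed
  qed
  have pre: "K * (x / s) powr a * exp (b * sqrt (x / s) - x / s / (1 + \<rho>)) * (A * exp z) = s * \<Phi> x" if x: "x > 0" for x
  proof -
    \<comment> \<open>As d / (1 - \<rho>) = (1 + \<rho>) / 2, the powers of 1 + \<rho> cancel, and b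
      is left with the exponent - (n - 1) / 2.\<close>
    have P1: "(b / 2) powr (1 - \<nu>) / sqrt (2 * pi * b) / (1 + \<rho>) powr \<nu> * (d / (1 - \<rho>)) powr \<nu>
        = 1 / (2 * sqrt (2 * pi)) * ((1 + \<rho>) / (\<bar>rX + rY\<bar> * sqrt (real n))) powr ((real n - 1) / 2)"
    proof -
      have "c * e / 2 / e = c / 2" if "e \<noteq> 0" for c e :: real using that by simp
      then have "d / (1 - \<rho>) = (1 + \<rho>) / 2" unfolding dd using c by (metis less_irrefl)
      then have 1: "(d / (1 - \<rho>)) powr \<nu> = (1 + \<rho>) powr \<nu> / 2 powr \<nu>" by (simp only: powr_divide)
      have 2: "(b / 2) powr (1 - \<nu>) = b powr (1 - \<nu>) / 2 powr (1 - \<nu>)" by (rule powr_divide)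
      have 3: "sqrt (2 * pi * b) = sqrt (2 * pi) * b powr (1/2)" using b0 by (simp add: real_sqrt_mult powr_half_sqrt)
      have 4: "(2::real) powr (1 - \<nu>) * 2 powr \<nu> = 2" by (simp flip: powr_add)
      have 5: "(1 + \<rho>) / (\<bar>rX + rY\<bar> * sqrt (real n)) = 1 / b" by (simp add: b_def)
      have "(1 / b) powr ((real n - 1) / 2) = b powr (- ((real n - 1) / 2))" by (simp add: powr_divide powr_minus_divide)
      also have "- ((real n - 1) / 2) = 1 - \<nu> - 1/2" by (simp add: \<nu>_def field_simps)
      also have "b powr (1 - \<nu> - 1/2) = b powr (1 - \<nu>) / b powr (1/2)" by (rule powr_diff)
      finally have 6: "(1 / b) powr ((real n - 1) / 2) = b powr (1 - \<nu>) / b powr (1/2)" .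
      have "(1 + \<rho>) powr \<nu> \<noteq> 0" using c by simp
      then have "b powr (1 - \<nu>) / 2 powr (1 - \<nu>) / (sqrt (2 * pi) * b powr (1/2)) / (1 + \<rho>) powr \<nu> * ((1 + \<rho>) powr \<nu> / 2 powr \<nu>)
         = b powr (1 - \<nu>) / b powr (1/2) / sqrt (2 * pi) / (2 powr (1 - \<nu>) * 2 powr \<nu>)"
        by (simp add: mult_ac)
      then show ?thesis unfolding 1 2 3 5 6 4 by simp
    qed
    have P2: "exp (- (\<theta> * (1 + \<rho>))) * exp (- (\<theta>' * (1 - \<rho>))) = C_const rX rY \<rho> n"
      unfolding \<theta>_def \<theta>'_def by (rule C_const_eq[OF r])
    have P3: "(x / s) powr a = s * s powr (- (real n + 1) / 4) * x powr a"
    proof -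
      have "s * s powr (- (real n + 1) / 4) = s powr (1 + (- (real n + 1) / 4))"
        using s powr_add[of s 1 "- (real n + 1) / 4"] by simp
      also have "1 + (- (real n + 1) / 4) = - a" by (simp add: a_def field_simps)
      finally show ?thesis by (simp add: powr_divide powr_minus_divide)
    qed
    have P4: "b * sqrt (x / s) - x / s / (1 + \<rho>) = \<bar>rX + rY\<bar> / (1 + \<rho>) * sqrt (real n * x / s) - x / (s * (1 + \<rho>))"
      by (simp add: b_def real_sqrt_mult real_sqrt_divide)
    have "K * (x / s) powr a * exp (b * sqrt (x / s) - x / s / (1 + \<rho>)) * (A * exp z)
      = ((b / 2) powr (1 - \<nu>) / sqrt (2 * pi * b) / (1 + \<rho>) powr \<nu> * (d / (1 - \<rho>)) powr \<nu>)
        * (exp (- (\<theta> * (1 + \<rho>))) * exp (- (\<theta>' * (1 - \<rho>))))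
        * (x / s) powr a * exp (b * sqrt (x / s) - x / s / (1 + \<rho>)) * exp z"
    proof -
      have "exp (- \<theta>' * (1 - \<rho>)) = exp (- (\<theta>' * (1 - \<rho>)))" by simp
      moreover have "1 / exp (\<theta> * (1 + \<rho>)) = exp (- (\<theta> * (1 + \<rho>)))" by (simp add: exp_minus divide_inverse)
      moreover have "B / (P * T) * X * E * (D * T' * Z) = (B / P * D) * (1 / T * T') * X * E * Z" for B P T X E D T' Z :: real
        by simp
      ultimately show ?thesis unfolding K_def A_def by (simp only:)
    qed
    also have "\<dots> = s * \<Phi> x"
      unfolding P1 P2 P3 P4 \<Phi>_def by simp
    finally show ?thesis .
  qed
  have C0: "C_const rX rY \<rho> n > 0" by (simp add: C_const_def)
  have base: "(1 + \<rho>) / (\<bar>rX + rY\<bar> * sqrt (real n)) > 0" using c p n by simp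
  define k0 where "k0 = s powr (- (real n + 1) / 4) * C_const rX rY \<rho> n / (2 * sqrt (2 * pi)) *
              ((1 + \<rho>) / (\<bar>rX + rY\<bar> * sqrt (real n))) powr ((real n - 1) / 2) * exp z"
  have k0: "k0 > 0"
  proof -
    have bp: "((1 + \<rho>) / (\<bar>rX + rY\<bar> * sqrt (real n))) powr ((real n - 1) / 2) > 0"
      using base by (simp only: powr_gt_zero)
    show ?thesis unfolding k0_def using s by (intro mult_pos_pos divide_pos_pos bp C0) auto
  qed
  have \<Phi>_eq: "\<Phi> = (\<lambda>x. k0 * x powr a * exp (\<bar>rX + rY\<bar> / (1 + \<rho>) * sqrt (real n * x / s) - x / (s * (1 + \<rho>))))"
    unfolding \<Phi>_def k0_def by (rule ext) (rule refl)
  note ae' = ae[folded \<nu>_def \<theta>_def \<theta>'_def]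
  have "poincare_expansion at_top (1/2) f \<Phi> (\<lambda>l. c_coeff l rX rY \<rho> n * s powr (real l * (1/2)))"
  proof (rule poincare_expansion_rescale[where m = "A * exp z"
        and \<Psi> = "\<lambda>y. K * y powr a * exp (b * sqrt y - y / (1 + \<rho>))"
        and G = "gamma_difference_density \<nu> \<theta> (1 + \<rho>) \<theta>' (1 - \<rho>)", OF s _ f _ _ ae' pre])
    show "A * exp z > 0" using A by simp
    have "s * (1 + \<rho>) \<noteq> 0" using s c by simp
    then show "continuous_on {0<..} \<Phi>" unfolding \<Phi>_eq using s by (intro continuous_intros) simp_all
    show "\<Phi> x > 0" if "x > 0" for x unfolding \<Phi>_eq using that k0 by (intro mult_pos_pos) simp_all
  qed (assumption, rule gamma_difference_density_asymptotic[OF n \<nu>_def \<theta> \<theta>' c d1 b\<theta> a_def K_def, unfolded coeff])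
  then show ?thesis unfolding \<Phi>_def[abs_def] z_def a_def by simp
qed

lemma poincare_expansion_central:
  fixes n :: nat and f :: "real \<Rightarrow> real"
  assumes n: "n \<ge> 1" and r: "- 1 < \<rho>" "\<rho> < 1" and s: "s > 0" and p: "rX + rY = 0"
    and f: "\<And>x. f x \<ge> 0" "continuous_on {0<..} f"
    and ae: "AE x in lborel. x > 0 \<longrightarrow> ennreal (s * f x) =
       gamma_difference_density (real n / 2) (real n * (rX + rY)\<^sup>2 / (4 * (1 + \<rho>)\<^sup>2)) (1 + \<rho>)
         (real n * (rX - rY)\<^sup>2 / (4 * (1 - \<rho>)\<^sup>2)) (1 - \<rho>) (x / s)"
  shows "poincare_expansion at_top 1 f
         (\<lambda>x. x powr (real n / 2 - 1) / ((2 * s) powr (real n / 2) * Gamma (real n / 2)) *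
              exp (- (real n * rX\<^sup>2 / 2) - x / (s * (1 + \<rho>))))
         (\<lambda>k. d_coeff k rX \<rho> n * s ^ k)"
proof -
  define \<nu> where "\<nu> = real n / 2"
  define \<theta>' where "\<theta>' = real n * rX\<^sup>2 / (1 - \<rho>)\<^sup>2"
  define d where "d = (1 - \<rho>\<^sup>2) / 2"
  define z where "z = real n / 2 * ((1 + \<rho>) / (1 - \<rho>)) * rX\<^sup>2"
  define K where "K = 1 / (Gamma \<nu> * (1 + \<rho>) powr \<nu>)"
  define A where "A = (d / (1 - \<rho>)) powr \<nu> * exp (- \<theta>' * (1 - \<rho>))"
  define \<Phi> where "\<Phi> x = x powr (\<nu> - 1) / ((2 * s) powr \<nu> * Gamma \<nu>) * exp (- (real n * rX\<^sup>2 / 2) - x / (s * (1 + \<rho>)))" for x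
  have \<nu>: "\<nu> > 0" using n by (simp add: \<nu>_def)
  have G: "Gamma \<nu> > 0" using \<nu> by (rule Gamma_real_pos)
  have c: "1 + \<rho> > 0" "1 - \<rho> > 0" using r by auto
  have dd: "d = (1 + \<rho>) * (1 - \<rho>) / 2" by (simp add: d_def power2_eq_square algebra_simps)
  have rY: "rY = - rX" using p by simp
  have q: "real n * (rX - rY)\<^sup>2 / (4 * (1 - \<rho>)\<^sup>2) = \<theta>'"
    by (simp add: rY \<theta>'_def power_mult_distrib mult_2[symmetric])
  have \<theta>': "\<theta>' \<ge> 0" unfolding \<theta>'_def by simp
  have d1: "1 / d = 1 / (1 - \<rho>) + 1 / (1 + \<rho>)"
  proof -
    have "1 / e + 1 / c = 1 / (c * e / 2)" if "c \<noteq> 0" "e \<noteq> 0" "c + e = 2" for c e :: real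
      using that by (simp add: field_simps)
    from this[of "1 + \<rho>" "1 - \<rho>"] show ?thesis using c unfolding dd by simp
  qed
  have z: "\<theta>' * d = z"
  proof -
    have "X / e\<^sup>2 * (c * e / 2) = X * c / (2 * e)" if "e \<noteq> 0" for X c e :: real
      using that by (simp add: power2_eq_square)
    from this[of "1 - \<rho>" "real n * rX\<^sup>2" "1 + \<rho>"]
    have "\<theta>' * d = real n * rX\<^sup>2 * (1 + \<rho>) / (2 * (1 - \<rho>))"
      unfolding \<theta>'_def dd using c by simp
    then show ?thesis
      unfolding z_def by (simp only: times_divide_times_eq times_divide_eq_left times_divide_eq_right divide_divide_eq_left mult_ac)
  qed
  have d0: "d > 0" unfolding dd using c by simp
  have A: "A > 0" unfolding A_def using d0 c by (intro mult_pos_pos) simp_all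
  have coeff: "((\<nu> - 1) gchoose k) * gamma_moment \<nu> \<theta>' (1 - \<rho>) d k = A * exp z * d_coeff k rX \<rho> n" for k
  proof -
    have m: "gamma_moment \<nu> \<theta>' (1 - \<rho>) d k = A * (pochhammer \<nu> k * d ^ k * kummer_M (\<nu> + real k) \<nu> z)"
      unfolding gamma_moment_def A_def z by (simp only: mult.assoc)
    \<comment> \<open>The sign and the first Pochhammer symbol in d_k stem from the binomial series
      of (1 + t / y)^(\<nu> - 1).\<close>
    have g: "((\<nu> - 1) gchoose k) = (- 1) ^ k * pochhammer (1 - \<nu>) k / fact k"
      by (simp add: gbinomial_pochhammer)
    show ?thesis
    proof (cases "k = 0")
      case True
      then show ?thesis using m kummer_M_shift[OF \<nu>, of 0 z] by (simp add: d_coeff_def)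
    next
      case False
      have e1: "exp z * exp (- z) = 1" by (simp flip: exp_add)
      then have "A * exp z * ((- 1) ^ k * (pochhammer (1 - \<nu>) k * pochhammer \<nu> k / fact k) * d ^ k * exp (- z) * kummer_M (\<nu> + real k) \<nu> z)
         = ((- 1) ^ k * pochhammer (1 - \<nu>) k / fact k) * (A * (pochhammer \<nu> k * d ^ k * kummer_M (\<nu> + real k) \<nu> z))"
        by (simp add: mult_ac exp_minus)
      then show ?thesis
        unfolding m g d_coeff_def z_def[symmetric] unfolding \<nu>_def[symmetric] d_def[symmetric] using False e1 by simp
    qed
  qed
  have pre: "K * (x / s) powr (\<nu> - 1) * exp (- (x / s) / (1 + \<rho>)) * (A * exp z) = s * \<Phi> x" if x: "x > 0" for x
  proof -
    have P1: "1 / (1 + \<rho>) powr \<nu> * (d / (1 - \<rho>)) powr \<nu> = 1 / 2 powr \<nu>"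
    proof -
      have "c * e / 2 / e = c / 2" if "e \<noteq> 0" for c e :: real using that by simp
      then have "d / (1 - \<rho>) = (1 + \<rho>) / 2" unfolding dd using c by (metis less_irrefl)
      then have "(d / (1 - \<rho>)) powr \<nu> = (1 + \<rho>) powr \<nu> / 2 powr \<nu>" by (simp only: powr_divide)
      then show ?thesis using c by simp
    qed
    have P2: "exp (- \<theta>' * (1 - \<rho>)) * exp z * exp (- (x / s) / (1 + \<rho>)) = exp (- (real n * rX\<^sup>2 / 2) - x / (s * (1 + \<rho>)))"
    proof -
      \<comment> \<open>The noncentral normalisation and the exp z of the zeroth moment combine to
        exp (- n rX^2 / 2), free of \<rho>, because the two scales add up to 2.\<close>
      have "- (X / e\<^sup>2) * e + X / 2 * (c / e) = - (X / 2)" if "e \<noteq> 0" "c = 2 - e" for X c e :: real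
        using that(1) unfolding that(2) by (simp add: power2_eq_square field_simps)
      from this[of "1 - \<rho>" "1 + \<rho>" "real n * rX\<^sup>2"]
      have "- \<theta>' * (1 - \<rho>) + z = - (real n * rX\<^sup>2 / 2)" using c by (simp add: \<theta>'_def z_def mult_ac)
      then show ?thesis unfolding exp_add[symmetric] by simp
    qed
    have P3: "(x / s) powr (\<nu> - 1) / 2 powr \<nu> = s * (x powr (\<nu> - 1) / (2 * s) powr \<nu>)"
      using s by (simp add: powr_divide powr_mult powr_diff) (simp add: mult_ac)
    have "K * (x / s) powr (\<nu> - 1) * exp (- (x / s) / (1 + \<rho>)) * (A * exp z)
       = (1 / Gamma \<nu>) * (1 / (1 + \<rho>) powr \<nu> * (d / (1 - \<rho>)) powr \<nu>) * (x / s) powr (\<nu> - 1)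
         * (exp (- \<theta>' * (1 - \<rho>)) * exp z * exp (- (x / s) / (1 + \<rho>)))"
      by (simp add: K_def A_def mult_ac)
    also have "\<dots> = (1 / Gamma \<nu>) * ((x / s) powr (\<nu> - 1) / 2 powr \<nu>) * exp (- (real n * rX\<^sup>2 / 2) - x / (s * (1 + \<rho>)))"
      unfolding P1 P2 by simp
    also have "\<dots> = s * \<Phi> x" unfolding P3 \<Phi>_def by (simp add: mult_ac)
    finally show ?thesis .
  qed
  have ae': "AE x in lborel. x > 0 \<longrightarrow> ennreal (s * f x) = gamma_difference_density \<nu> 0 (1 + \<rho>) \<theta>' (1 - \<rho>) (x / s)"
    using ae unfolding q p \<nu>_def[symmetric] by simp
  have "poincare_expansion at_top 1 f \<Phi> (\<lambda>k. d_coeff k rX \<rho> n * s powr (real k * 1))"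
  proof (rule poincare_expansion_rescale[where m = "A * exp z"
        and \<Psi> = "\<lambda>y. K * y powr (\<nu> - 1) * exp (- y / (1 + \<rho>))"
        and G = "gamma_difference_density \<nu> 0 (1 + \<rho>) \<theta>' (1 - \<rho>)", OF s _ f _ _ ae' pre])
    show "A * exp z > 0" using A by simp
    show "continuous_on {0<..} \<Phi>"
      unfolding \<Phi>_def using s c G by (intro continuous_intros) auto
    show "\<Phi> x > 0" if "x > 0" for x
      unfolding \<Phi>_def using that s G by (intro mult_pos_pos divide_pos_pos) auto
  qed (assumption, rule gamma_difference_density_asymptotic_central[OF \<nu> \<theta>' c d1 K_def, unfolded coeff])
  then show ?thesis unfolding \<Phi>_def[abs_def] \<nu>_def using s by (simp add: powr_realpow)
qed

section \<open>The tail at minus infinity and the theorem\<close>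

lemma gamma_difference_density_reflect:
  "(\<integral>\<^sup>+t. ennreal (noncentral_gamma \<nu> \<theta> c (- x + t)) * ennreal (noncentral_gamma \<nu> \<theta>' c' t) \<partial>lborel)
   = (\<integral>\<^sup>+t. ennreal (noncentral_gamma \<nu> \<theta>' c' (x + t)) * ennreal (noncentral_gamma \<nu> \<theta> c t) \<partial>lborel)"
  \<comment> \<open>Translating t by x exchanges the two variables: the density of a difference at -
    x is that of the opposite difference at x.\<close>
  by (subst nn_integral_real_affine[where c = 1 and t = x]) (simp_all add: mult.commute)

lemma AE_lborel_uminus:
  fixes P :: "real \<Rightarrow> bool"
  assumes "AE x in lborel. P x" and [measurable]: "Measurable.pred borel P"
  shows "AE x in lborel. P (- x)"
proof -
  have "AE x in distr lborel borel (uminus :: real \<Rightarrow> real). P x"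
    unfolding lborel_distr_uminus by (rule assms(1))
  then show ?thesis by (subst (asm) AE_distr_iff) auto
qed

text \<open>The pair (X, Y) and the copies of its product may live on different probability spaces,
  since only laws are compared. Continuity selects a version of the density; the origin is excepted
  because for n = 1 the density has a logarithmic singularity there.\<close>

theorem theorem3p1:
  fixes N :: "'b measure" and M :: "'a measure"
    and X Y :: "'b \<Rightarrow> real" and Z :: "nat \<Rightarrow> 'a \<Rightarrow> real"
    and \<mu>X \<mu>Y \<sigma>X \<sigma>Y \<rho> rX rY s :: real and n :: nat and f :: "real \<Rightarrow> real"
  assumes "\<sigma>X > 0" and "\<sigma>Y > 0" and "- 1 < \<rho>" and "\<rho> < 1" and "n \<ge> 1"
    and "prob_space N" and "bivariate_normal N X Y \<mu>X \<mu>Y \<sigma>X \<sigma>Y \<rho>"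
    and "prob_space M" and "prob_space.indep_vars M (\<lambda>_. borel) Z {1..n}"
    and "\<And>i. i \<in> {1..n} \<Longrightarrow> distr M borel (Z i) = distr N borel (\<lambda>\<omega>. X \<omega> * Y \<omega>)"
    and "distributed M lborel (\<lambda>\<omega>. \<Sum>i = 1..n. Z i \<omega>) (\<lambda>x. ennreal (f x))"
    and "\<And>x. f x \<ge> 0" and "continuous_on (- {0}) f"
    and "rX = \<mu>X / \<sigma>X" and "rY = \<mu>Y / \<sigma>Y" and "s = \<sigma>X * \<sigma>Y"
  shows
   "(rX + rY \<noteq> 0 \<longrightarrow>
       poincare_expansion at_top (1/2) f
         (\<lambda>x. s powr (- (real n + 1) / 4) * C_const rX rY \<rho> n / (2 * sqrt (2 * pi)) *
              ((1 + \<rho>) / (\<bar>rX + rY\<bar> * sqrt (real n))) powr ((real n - 1) / 2) *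
              exp (real n / 8 * ((1 + \<rho>) / (1 - \<rho>)) * (rX - rY)\<^sup>2) *
              x powr ((real n - 3) / 4) *
              exp (\<bar>rX + rY\<bar> / (1 + \<rho>) * sqrt (real n * x / s) - x / (s * (1 + \<rho>))))
         (\<lambda>l. c_coeff l rX rY \<rho> n * s powr (real l / 2)))
    \<and>
    (rX + rY = 0 \<longrightarrow>
       poincare_expansion at_top 1 f
         (\<lambda>x. x powr (real n / 2 - 1) / ((2 * s) powr (real n / 2) * Gamma (real n / 2)) *
              exp (- (real n * rX\<^sup>2 / 2) - x / (s * (1 + \<rho>))))
         (\<lambda>k. d_coeff k rX \<rho> n * s ^ k) \<and>
       (\<forall>k\<ge>1. d_coeff k rX \<rho> n = d_coeff_sum k rX \<rho> n))
    \<and>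
    (rX - rY \<noteq> 0 \<longrightarrow>
       poincare_expansion at_bot (1/2) f
         (\<lambda>x. s powr (- (real n + 1) / 4) * C_const rX rY \<rho> n / (2 * sqrt (2 * pi)) *
              ((1 - \<rho>) / (\<bar>rX - rY\<bar> * sqrt (real n))) powr ((real n - 1) / 2) *
              exp (real n / 8 * ((1 - \<rho>) / (1 + \<rho>)) * (rX + rY)\<^sup>2) *
              \<bar>x\<bar> powr ((real n - 3) / 4) *
              exp (\<bar>rX - rY\<bar> / (1 - \<rho>) * sqrt (real n * \<bar>x\<bar> / s) + x / (s * (1 - \<rho>))))
         (\<lambda>l. c_coeff l rX (- rY) (- \<rho>) n * s powr (real l / 2)))
    \<and>
    (rX - rY = 0 \<longrightarrow>
       poincare_expansion at_bot 1 f
         (\<lambda>x. \<bar>x\<bar> powr (real n / 2 - 1) / ((2 * s) powr (real n / 2) * Gamma (real n / 2)) *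
              exp (- (real n * rX\<^sup>2 / 2) + x / (s * (1 - \<rho>))))
         (\<lambda>k. d_coeff k rX (- \<rho>) n * s ^ k) \<and>
       (\<forall>k\<ge>1. d_coeff k rX (- \<rho>) n = d_coeff_sum k rX (- \<rho>) n))"
proof -
  define \<nu> where "\<nu> = real n / 2"
  define p where "p = rX + rY"
  define q where "q = rX - rY"
  define \<theta> where "\<theta> = real n * p\<^sup>2 / (4 * (1 + \<rho>)\<^sup>2)"
  define \<theta>' where "\<theta>' = real n * q\<^sup>2 / (4 * (1 - \<rho>)\<^sup>2)"
  have s: "s > 0" and c: "1 + \<rho> > 0" "1 - \<rho> > 0" using assms by auto
  have \<nu>: "\<nu> > 0" using \<open>n \<ge> 1\<close> by (simp add: \<nu>_def)
  have \<theta>: "\<theta> \<ge> 0" "\<theta>' \<ge> 0" by (simp_all add: \<theta>_def \<theta>'_def)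
  \<comment> \<open>Noncentralities of a single summand before scaling; n of them add up to \<theta>
    / s and \<theta>' / s.\<close>
  define A1 where "A1 = p\<^sup>2 / (4 * (1 + \<rho>)\<^sup>2 * s)"
  define B1 where "B1 = q\<^sup>2 / (4 * (1 - \<rho>)\<^sup>2 * s)"
  have A1: "A1 \<ge> 0" "real n * A1 = \<theta> / s" and B1: "B1 \<ge> 0" "real n * B1 = \<theta>' / s"
    using s by (simp_all add: A1_def B1_def \<theta>_def \<theta>'_def)
  have law: "distr N borel (\<lambda>\<omega>. X \<omega> * Y \<omega>)
     = (gamma_measure (1/2) A1 (s * (1 + \<rho>)) \<star> neg_gamma_measure (1/2) B1 (s * (1 - \<rho>)))"
    unfolding A1_def B1_def
    by (rule distr_product_bivariate_normal[OF assms(1-4) _ _ _ assms(7)]) (simp_all add: p_def q_def assms)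
  interpret M: prob_space M by fact
  have fm [measurable]: "(\<lambda>x. ennreal (f x)) \<in> borel_measurable borel"
    using distributed_borel_measurable[OF assms(11)] by simp
  have "density lborel (\<lambda>x. ennreal (f x)) = distr M borel (\<lambda>\<omega>. \<Sum>i = 1..n. Z i \<omega>)"
    using distributed_distr_eq_density[OF assms(11)] by (simp cong: distr_cong)
  also have "\<dots> = (gamma_measure (real n / 2) (real n * A1) (s * (1 + \<rho>)) \<star> neg_gamma_measure (real n / 2) (real n * B1) (s * (1 - \<rho>)))"
    using assms(10) law A1(1) B1(1) s c
    by (intro M.distr_sum_gamma_measures[OF assms(5) assms(9)]) auto
  finally have dens: "density lborel (\<lambda>x. ennreal (f x)) = (gamma_measure \<nu> (\<theta> / s) (s * (1 + \<rho>)) \<star> neg_gamma_measure \<nu> (\<theta>' / s) (s * (1 - \<rho>)))"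
    unfolding A1 B1 \<nu>_def .
  define g where "g x = (\<integral>\<^sup>+t. ennreal (noncentral_gamma \<nu> (\<theta> / s) (s * (1 + \<rho>)) (x + t)) * ennreal (noncentral_gamma \<nu> (\<theta>' / s) (s * (1 - \<rho>)) t) \<partial>lborel)" for x
  have [measurable]: "g \<in> borel_measurable borel" unfolding g_def by measurable
  have ae: "AE x in lborel. ennreal (f x) = g x"
    unfolding g_def using \<nu> \<theta> s c by (intro convolution_gamma_measures_density dens) auto
  have ae': "AE x in lborel. ennreal (f (- x)) = g (- x)"
    using ae by (rule AE_lborel_uminus) measurable
  have mult_s: "ennreal (s * u) = G" if "ennreal u = ennreal (1 / s) * G" for u G
  proof -
    have "ennreal (s * u) = ennreal s * (ennreal (1 / s) * G)" using s that by (simp add: ennreal_mult')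
    also have "\<dots> = ennreal (s * (1 / s)) * G" using s by (subst ennreal_mult') (simp_all add: mult.assoc)
    finally show ?thesis using s by simp
  qed
  have top: "AE x in lborel. x > 0 \<longrightarrow> ennreal (s * f x) =
       gamma_difference_density (real n / 2) (real n * (rX + rY)\<^sup>2 / (4 * (1 + \<rho>)\<^sup>2)) (1 + \<rho>)
         (real n * (rX - rY)\<^sup>2 / (4 * (1 - \<rho>)\<^sup>2)) (1 - \<rho>) (x / s)"
    using ae
  proof eventually_elim
    case (elim x)
    then have "ennreal (f x) = ennreal (1 / s) * gamma_difference_density \<nu> \<theta> (1 + \<rho>) \<theta>' (1 - \<rho>) (x / s)"
      unfolding g_def using s c \<nu> \<theta> by (simp add: nn_integral_rescaled_gamma_difference)
    from mult_s[OF this] show ?case by (simp add: \<nu>_def \<theta>_def \<theta>'_def p_def q_def)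
  qed
  \<comment> \<open>Replacing (rY, \<rho>) by (- rY, - \<rho>) exchanges p with q and 1 + \<rho>
    with 1 - \<rho>, hence the two gamma variables; so the results at plus infinity apply to the
    reflected density.\<close>
  have bot: "AE x in lborel. x > 0 \<longrightarrow> ennreal (s * f (- x)) =
       gamma_difference_density (real n / 2) (real n * (rX + (- rY))\<^sup>2 / (4 * (1 + (- \<rho>))\<^sup>2)) (1 + (- \<rho>))
         (real n * (rX - (- rY))\<^sup>2 / (4 * (1 - (- \<rho>))\<^sup>2)) (1 - (- \<rho>)) (x / s)"
    using ae'
  proof eventually_elim
    case (elim x)
    then have "ennreal (f (- x)) = ennreal (1 / s) * gamma_difference_density \<nu> \<theta>' (1 - \<rho>) \<theta> (1 + \<rho>) (x / s)"
      unfolding g_def gamma_difference_density_reflect using s c \<nu> \<theta> by (simp add: nn_integral_rescaled_gamma_difference)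
    from mult_s[OF this] show ?case by (simp add: \<nu>_def \<theta>_def \<theta>'_def p_def q_def)
  qed
  have ft: "continuous_on {0<..} f" using assms(13) by (rule continuous_on_subset) auto
  have fb: "continuous_on {0<..} (\<lambda>x. f (- x))"
    by (rule continuous_on_compose2[OF assms(13)]) (auto intro!: continuous_intros)
  have C: "C_const rX (- rY) (- \<rho>) n = C_const rX rY \<rho> n" by (simp add: C_const_def)
  have r: "- 1 < - \<rho>" "- \<rho> < 1" using assms by auto
  note n = \<open>n \<ge> 1\<close>
  show ?thesis
  proof (intro conjI impI allI, goal_cases)
    case 1
    then show ?case by (rule poincare_expansion_noncentral[OF n assms(3,4) s _ assms(12) ft top])
  next
    case 2
    then show ?case by (rule poincare_expansion_central[OF n assms(3,4) s _ assms(12) ft top])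
  next
    case 4
    then have q: "rX + (- rY) \<noteq> 0" by simp
    show ?case
      by (rule poincare_expansion_mirror[OF poincare_expansion_noncentral[OF n r s q assms(12) fb bot]])
        (simp add: C)
  next
    case 5
    then have q: "rX + (- rY) = 0" by simp
    show ?case
      by (rule poincare_expansion_mirror[OF poincare_expansion_central[OF n r s q assms(12) fb bot]]) simp
  qed (use n in \<open>simp_all add: d_coeff_eq_sum\<close>)
qed

end
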